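(* Let $q$ be a prime power, $m$ a positive integer with $\gcd(q,m)=1$, and $n\geq 2$ an integer. Let $x_1,\dots,x_q$ be the elements of $\mathbb{F}_q$, and let $\mathcal{F}_d$ be the set of $n$th power-free polynomials in $\mathbb{F}_q[x]$ of degree exactly $d$. For $f\in\mathbb{F}_q[x]$ let $C_f$ be the affine curve $y^m=f(x)$ over $\mathbb{F}_q$ and $\tilde{C_f}$ its normalization. Let $k_1,\dots,k_q$ be integers. Then $$ \lim_{d\to\infty} \frac{\#\{f\in \mathcal{F}_d \mid C_f \text{ has exactly } k_i\ \mathbb{F}_q\text{-points with } x=x_i \text{ for all } i\}}{\# \mathcal{F}_d}= \Pr(X_i=k_i \text{ for all } i), $$ where $X_1,\dots,X_q$ are independent identically distributed random variables with $$ X_{j}= \begin{cases} 0 & \text{with probability } \left(1-\frac{1}{(m,q-1)} \right)\frac{1-q^{-1}}{1-q^{-n}}, \\ 1 & \text{with probability } \frac{q^{-1}-q^{-n}}{1-q^{-n}}, \\ (m,q-1) & \text{with probability } \frac{1}{(m,q-1)} \frac{1-q^{-1}}{1-q^{-n}}, \end{cases} $$ where, when $(m,q-1)=1$, the last two probabilities are added to give $\Pr(X_j=1)$. Also, $$ \lim_{d\to\infty} \frac{\#\{f\in \mathcal{F}_d \mid \tilde{C_f} \text{ has exactly } k_i\ \mathbb{F}_q\text{-points with } x=x_i \text{ for all } i\}}{\# \mathcal{F}_d}= \Pr(X_i=k_i \text{ for all } i), $$ where now $X_1,\dots,X_q$ are independent identically distributed random variables with $$ X_{j}= \begin{cases}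 0 & \text{with probability } \displaystyle\sum_{0 \leq s \leq n-1}\left(1-\frac{1}{(m, s, q-1)}\right)\frac{1-q^{-1}}{1-q^{-n}}, \\ N & \text{with probability } \displaystyle\sum_{\substack{0 \leq s \leq n-1 \\ (m, s,q-1) = N}}\frac{q^{-s}(1-q^{-1})}{N(1-q^{-n})}\quad (N\ge 1). \end{cases} $$ Both conclusions remain true if, in numerator and denominator, one additionally restricts to those $f$ for which $C_f$ (respectively $\tilde{C_f}$) is irreducible, or to those for which it is geometrically irreducible.
   Context: A polynomial $f$ is $n$th power-free if there is no nonconstant $g\in\mathbb{F}_q[x]$ with $g^n\mid f$. $(a,b,c)$ denotes the greatest common divisor. An $\mathbb{F}_q$-point of $\tilde{C_f}$ "with $x=x_i$" is a degree-$1$ closed point mapping to $x=x_i$ under $\tilde{C_f}\to C_f\to\mathbb{A}^1=\operatorname{Spec}\mathbb{F}_q[x]$; for $C_f$ these are the pairs $(x_i,y)\in\mathbb{F}_q^2$ with $y^m=f(x_i)$.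
   Formalization: In the second law, each summand of the probability that X_j = 0 is given the extra factor q^{-s} (as in the case N ≥ 1); as displayed, without it, the probabilities sum to more than 1 in general (e.g. 17/13 for q=3, m=2, n=3). *)

theory Defs
  imports
    "HOL-Probability.Probability"
    "HOL-Algebra.Algebraic_Closure_Type"
    "HOL-Algebra.Free_Abelian_Groups"
begin

section \<open>Normalization and irreducibility of affine schemes\<close>

definition nonzerodivisors :: "('b, 'c) ring_scheme \<Rightarrow> 'b set" where
  "nonzerodivisors R =
     {d \<in> carrier R. \<forall>a \<in> carrier R. d \<otimes>\<^bsub>R\<^esub> a = \<zero>\<^bsub>R\<^esub> \<longrightarrow> a = \<zero>\<^bsub>R\<^esub>}"

definition frac_rel :: "('b, 'c) ring_scheme \<Rightarrow> (('b \<times> 'b) \<times> ('b \<times> 'b)) set" where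
  "frac_rel R =
     {((a, d), (b, e)). a \<in> carrier R \<and> b \<in> carrier R \<and>
        d \<in> nonzerodivisors R \<and> e \<in> nonzerodivisors R \<and> a \<otimes>\<^bsub>R\<^esub> e = b \<otimes>\<^bsub>R\<^esub> d}"

definition ring_frac :: "('b, 'c) ring_scheme \<Rightarrow> 'b \<Rightarrow> 'b \<Rightarrow> ('b \<times> 'b) set" where
  "ring_frac R a d = frac_rel R `` {(a, d)}"

definition total_fraction_ring :: "('b, 'c) ring_scheme \<Rightarrow> ('b \<times> 'b) set ring" where
  "total_fraction_ring R =
     \<lparr>carrier = {ring_frac R a d | a d. a \<in> carrier R \<and> d \<in> nonzerodivisors R},
      monoid.mult = (\<lambda>A B. \<Union>(a, d)\<in>A. \<Union>(b, e)\<in>B. ring_frac R (a \<otimes>\<^bsub>R\<^esub> b) (d \<otimes>\<^bsub>R\<^esub> e)),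
      monoid.one = ring_frac R \<one>\<^bsub>R\<^esub> \<one>\<^bsub>R\<^esub>,
      ring.zero = ring_frac R \<zero>\<^bsub>R\<^esub> \<one>\<^bsub>R\<^esub>,
      ring.add = (\<lambda>A B. \<Union>(a, d)\<in>A. \<Union>(b, e)\<in>B.
               ring_frac R (a \<otimes>\<^bsub>R\<^esub> e \<oplus>\<^bsub>R\<^esub> b \<otimes>\<^bsub>R\<^esub> d) (d \<otimes>\<^bsub>R\<^esub> e))\<rparr>"

text \<open>Lists represent polynomials with the leading coefficient first.\<close>

definition integral_over :: "('b, 'c) ring_scheme \<Rightarrow> 'b set \<Rightarrow> 'b \<Rightarrow> bool" where
  "integral_over T S z \<longleftrightarrow>
     (\<exists>p. set p \<subseteq> S \<and> p \<noteq> [] \<and> hd p = \<one>\<^bsub>T\<^esub> \<and> ring.eval T p z = \<zero>\<^bsub>T\<^esub>)"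

definition normalization :: "('b, 'c) ring_scheme \<Rightarrow> ('b \<times> 'b) set ring" where
  "normalization R =
     (let T = total_fraction_ring R; S = (\<lambda>a. ring_frac R a \<one>\<^bsub>R\<^esub>) ` carrier R
      in T\<lparr>carrier := {z \<in> carrier T. integral_over T S z}\<rparr>)"

definition spectrum :: "('b, 'c) ring_scheme \<Rightarrow> 'b set set" where
  "spectrum R = {P. primeideal P R}"

definition zariski_closed :: "('b, 'c) ring_scheme \<Rightarrow> 'b set set \<Rightarrow> bool" where
  "zariski_closed R Z \<longleftrightarrow> (\<exists>S \<subseteq> carrier R. Z = {P \<in> spectrum R. S \<subseteq> P})"

definition irreducible_spectrum :: "('b, 'c) ring_scheme \<Rightarrow> bool" where
  "irreducible_spectrum R \<longleftrightarrow>
     spectrum R \<noteq> {} \<and>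
     (\<forall>Z W. zariski_closed R Z \<and> zariski_closed R W \<and> spectrum R = Z \<union> W \<longrightarrow>
        Z = spectrum R \<or> W = spectrum R)"


section \<open>Tensor products of commutative algebras\<close>

text \<open>
  For \<open>k\<close>-algebras \<open>R\<close> and \<open>S\<close> with structure maps \<open>\<rho>\<close> and \<open>\<sigma>\<close>, the ring \<open>R \<otimes>\<^sub>k S\<close> is the free
  abelian group on the set \<open>R \<times> S\<close>, with the product extending
  \<open>(a, b) (c, d) = (a c, b d)\<close> bilinearly, modulo the usual relations. The ideal generated
  by these relations is also the subgroup they generate.
\<close>

definition pair_ring ::
    "('r, 'x) ring_scheme \<Rightarrow> ('s, 'y) ring_scheme \<Rightarrow> (('r \<times> 's) \<Rightarrow>\<^sub>0 int) ring" where
  "pair_ring R S =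
     \<lparr>carrier = {u. Poly_Mapping.keys u \<subseteq> carrier R \<times> carrier S},
      monoid.mult = (\<lambda>u v. frag_extend (\<lambda>(a, b).
                frag_extend (\<lambda>(c, d). frag_of (a \<otimes>\<^bsub>R\<^esub> c, b \<otimes>\<^bsub>S\<^esub> d)) v) u),
      monoid.one = frag_of (\<one>\<^bsub>R\<^esub>, \<one>\<^bsub>S\<^esub>),
      ring.zero = 0,
      ring.add = (+)\<rparr>"

definition tensor_relations ::
    "('r, 'x) ring_scheme \<Rightarrow> ('k \<Rightarrow> 'r) \<Rightarrow> ('s, 'y) ring_scheme \<Rightarrow> ('k \<Rightarrow> 's) \<Rightarrow>
     (('r \<times> 's) \<Rightarrow>\<^sub>0 int) set" where
  "tensor_relations R \<rho> S \<sigma> =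
     {frag_of (a \<oplus>\<^bsub>R\<^esub> a', b) - frag_of (a, b) - frag_of (a', b) | a a' b.
        a \<in> carrier R \<and> a' \<in> carrier R \<and> b \<in> carrier S} \<union>
     {frag_of (a, b \<oplus>\<^bsub>S\<^esub> b') - frag_of (a, b) - frag_of (a, b') | a b b'.
        a \<in> carrier R \<and> b \<in> carrier S \<and> b' \<in> carrier S} \<union>
     {frag_of (\<rho> c \<otimes>\<^bsub>R\<^esub> a, b) - frag_of (a, \<sigma> c \<otimes>\<^bsub>S\<^esub> b) | a b c.
        a \<in> carrier R \<and> b \<in> carrier S}"

definition tensor_ring ::
    "('r, 'x) ring_scheme \<Rightarrow> ('k \<Rightarrow> 'r) \<Rightarrow> ('s, 'y) ring_scheme \<Rightarrow> ('k \<Rightarrow> 's) \<Rightarrow>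
     (('r \<times> 's) \<Rightarrow>\<^sub>0 int) set ring" where
  "tensor_ring R \<rho> S \<sigma> =
     pair_ring R S Quot (Idl\<^bsub>pair_ring R S\<^esub> (tensor_relations R \<rho> S \<sigma>))"

definition geom_irreducible_spectrum ::
    "('b, 'c) ring_scheme \<Rightarrow> ('k :: field \<Rightarrow> 'b) \<Rightarrow> bool" where
  "geom_irreducible_spectrum R \<rho> \<longleftrightarrow>
     irreducible_spectrum
       (tensor_ring R \<rho> (ring_of_type_algebra :: 'k alg_closure ring) to_ac)"


section \<open>The curve \<open>y\<^sup>m = f(x)\<close> and its normalization\<close>

text \<open>
  The inner variable of \<^typ>\<open>'a poly poly\<close> is \<open>x\<close>, the outer one is \<open>y\<close>. In the maps
  \<open>coord_map\<close> and \<open>norm_map\<close> a polynomial in \<open>x\<close> goes to the function it defines on the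
  curve; they give the projections of the two curves to the affine \<open>x\<close>-line.
\<close>

definition curve_ideal :: "nat \<Rightarrow> 'a :: field poly \<Rightarrow> 'a poly poly set" where
  "curve_ideal m f =
     PIdl\<^bsub>ring_of_type_algebra\<^esub> (Polynomial.monom 1 m - [:f:])"

definition coord_ring :: "nat \<Rightarrow> 'a :: field poly \<Rightarrow> 'a poly poly set ring" where
  "coord_ring m f = ring_of_type_algebra Quot curve_ideal m f"

definition coord_map :: "nat \<Rightarrow> 'a :: field poly \<Rightarrow> 'a poly \<Rightarrow> 'a poly poly set" where
  "coord_map m f p = curve_ideal m f +>\<^bsub>ring_of_type_algebra\<^esub> [:p:]"

definition norm_ring ::
    "nat \<Rightarrow> 'a :: field poly \<Rightarrow> ('a poly poly set \<times> 'a poly poly set) set ring" where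
  "norm_ring m f = normalization (coord_ring m f)"

definition norm_map ::
    "nat \<Rightarrow> 'a :: field poly \<Rightarrow> 'a poly \<Rightarrow> ('a poly poly set \<times> 'a poly poly set) set" where
  "norm_map m f p = ring_frac (coord_ring m f) (coord_map m f p) \<one>\<^bsub>coord_ring m f\<^esub>"

definition curve_points :: "nat \<Rightarrow> 'a :: field poly \<Rightarrow> 'a \<Rightarrow> ('a \<times> 'a) set" where
  "curve_points m f a = {(x, y). x = a \<and> y ^ m = poly f x}"

text \<open>
  The closed points of degree 1 over \<open>x = a\<close>: maximal ideals \<open>P\<close> such that the constants
  surject onto the residue field, and whose preimage in the polynomial ring is \<open>(x - a)\<close>.
\<close>

definition norm_points ::
    "nat \<Rightarrow> 'a :: field poly \<Rightarrow> 'a \<Rightarrow> ('a poly poly set \<times> 'a poly poly set) set set set" where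
  "norm_points m f a =
     {P. maximalideal P (norm_ring m f) \<and>
         (\<forall>b \<in> carrier (norm_ring m f). \<exists>c. b \<ominus>\<^bsub>norm_ring m f\<^esub> norm_map m f [:c:] \<in> P) \<and>
         {p. norm_map m f p \<in> P} = {p. [:- a, 1:] dvd p}}"

definition curve_irreducible :: "nat \<Rightarrow> 'a :: field poly \<Rightarrow> bool" where
  "curve_irreducible m f \<longleftrightarrow> irreducible_spectrum (coord_ring m f)"

definition curve_geom_irreducible :: "nat \<Rightarrow> 'a :: field poly \<Rightarrow> bool" where
  "curve_geom_irreducible m f \<longleftrightarrow>
     geom_irreducible_spectrum (coord_ring m f) (\<lambda>c. coord_map m f [:c:])"

definition norm_irreducible :: "nat \<Rightarrow> 'a :: field poly \<Rightarrow> bool" where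
  "norm_irreducible m f \<longleftrightarrow> irreducible_spectrum (norm_ring m f)"

definition norm_geom_irreducible :: "nat \<Rightarrow> 'a :: field poly \<Rightarrow> bool" where
  "norm_geom_irreducible m f \<longleftrightarrow>
     geom_irreducible_spectrum (norm_ring m f) (\<lambda>c. norm_map m f [:c:])"


section \<open>Power-free polynomials and the limiting laws\<close>

definition power_free :: "nat \<Rightarrow> 'a :: field poly \<Rightarrow> bool" where
  "power_free n f \<longleftrightarrow> \<not> (\<exists>g. Polynomial.degree g > 0 \<and> g ^ n dvd f)"

definition power_free_polys :: "nat \<Rightarrow> nat \<Rightarrow> 'a :: field poly set" where
  "power_free_polys n d = {f. Polynomial.degree f = d \<and> power_free n f}"

definition iid_with_law ::
    "'w measure \<Rightarrow> 'i set \<Rightarrow> ('i \<Rightarrow> 'w \<Rightarrow> int) \<Rightarrow> (int \<Rightarrow> real) \<Rightarrow> bool" where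
  "iid_with_law M I U law \<longleftrightarrow>
     prob_space M \<and>
     prob_space.indep_vars M (\<lambda>_. count_space UNIV) U I \<and>
     (\<forall>j\<in>I. \<forall>v. measure M {w \<in> space M. U j w = v} = law v)"

text \<open>
  As a sum of three terms, so that the masses at \<open>1\<close> and at \<open>gcd m (q - 1)\<close> add up when these
  values coincide.
\<close>

definition curve_law :: "nat \<Rightarrow> nat \<Rightarrow> nat \<Rightarrow> int \<Rightarrow> real" where
  "curve_law q m n v =
     (if v = 0 then (1 - 1 / real (gcd m (q - 1))) * ((1 - 1 / real q) / (1 - 1 / real q ^ n))
      else 0) +
     (if v = 1 then (1 / real q - 1 / real q ^ n) / (1 - 1 / real q ^ n) else 0) +
     (if v = int (gcd m (q - 1))
      then 1 / real (gcd m (q - 1)) * ((1 - 1 / real q) / (1 - 1 / real q ^ n)) else 0)"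

text \<open>
  The weight \<open>q\<^sup>-\<^sup>s (1 - q\<^sup>-\<^sup>1) / (1 - q\<^sup>-\<^sup>n)\<close> occurs at \<open>0\<close> as well as at the positive values:
  the total mass is 1 only with the factor \<open>q\<^sup>-\<^sup>s\<close> in both places.
\<close>

definition norm_law :: "nat \<Rightarrow> nat \<Rightarrow> nat \<Rightarrow> int \<Rightarrow> real" where
  "norm_law q m n v =
     (if v = 0 then
        (\<Sum>s\<in>{0..n - 1}. (1 - 1 / real (gcd m (gcd s (q - 1)))) *
           (1 / real q ^ s * (1 - 1 / real q) / (1 - 1 / real q ^ n)))
      else if v \<ge> 1 then
        (\<Sum>s\<in>{s \<in> {0..n - 1}. int (gcd m (gcd s (q - 1))) = v}.
           1 / real q ^ s * (1 - 1 / real q) / (of_int v * (1 - 1 / real q ^ n)))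
      else 0)"

end

theory Submission
  imports Defs
begin

text \<open>
  Translating by multiples of a fixed modulus shows that, up to a tail which is small uniformly in
  the degree, the power-free polynomials are equidistributed among the admissible residue classes
  modulo \<open>\<Prod>a. (x - a) ^ n\<close>. By the Chinese remainder theorem the jets of \<open>f\<close> at the points
  \<open>a\<close> of the line are then independent and uniform on the nonzero jets, which gives the
  independence of the \<open>X\<^sub>i\<close>.

  A polynomial without a simple root in an algebraic closure has a square factor of degree
  proportional to its own, so almost all \<open>f\<close> have a simple root \<open>c\<close>. For these,
  \<open>y ^ m - f\<close> satisfies Eisenstein's criterion at \<open>x - c\<close>; hence the coordinate ring and its
  normalization embed in a field in which they are linearly disjoint from the algebraic closure of
  the constants, and the curve is geometrically irreducible.

  Write \<open>f = (x - a) ^ s * u\<close> with \<open>u(a) \<noteq> 0\<close>, and let \<open>g\<close> be the gcd of \<open>m\<close> and \<open>s\<close>.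
  The substitution \<open>x = a + t ^ m\<close>, \<open>y = t ^ s * v\<close> makes the curve smooth over \<open>t = 0\<close>
  and shows that near \<open>a\<close> the normalization is generated by the elements
  \<open>y ^ l / (x - a) ^ (s * l div m)\<close>. At a rational point over \<open>a\<close> these vanish unless
  \<open>m / g\<close> divides \<open>l\<close>, and the value \<open>z\<close> of the one with \<open>l = m / g\<close> can be any root of
  \<open>z ^ g = u(a)\<close>. Counting such roots gives the two laws.
\<close>

text \<open>The density of the power-free polynomials themselves is never computed. Residue classes
  are only compared with one another, so a crude lower bound q^(d-4) for their total size suffices,
  and the limit comes out as a ratio of numbers of jets. The comparison is a sieve with a cutoff J:
  divisors g^n with g of degree at most J are respected exactly by the translation, larger ones cost
  at most q^(d-J) by a union bound, and J is fixed before d grows. For arbitrary f the coordinate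
  ring need not be a domain, and its normalization is then out of reach of the method. A simple root
  excludes this and forces all the irreducibility conditions at once. Hence the restricted families
  differ from the full one by density zero only, and one limit theorem covers every case.\<close>

hide_const (open) Polynomials.degree Polynomials.lead_coeff UnivPoly.up_ring.coeff
  UnivPoly.up_ring.monom Module.module.smult Coset.order

section \<open>Counting polynomials over a finite field\<close>

text \<open>Phrased by coefficients instead of \<open>degree\<close>, so that zero belongs to it for
  every \<open>N\<close> and over a finite field the set is an additive group with exactly q^N
  elements.\<close>

definition polys_below :: "nat \<Rightarrow> 'a::zero poly set" where
  "polys_below N = {p. \<forall>i\<ge>N. coeff p i = 0}"

lemma polys_below_iff: "p \<in> polys_below N \<longleftrightarrow> p = 0 \<or> degree p < N"
  unfolding polys_below_def
  by (auto intro: coeff_eq_0 simp: le_degree) (metis leading_coeff_neq_0 not_le)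

lemma polys_below_add: "p \<in> polys_below N \<Longrightarrow> r \<in> polys_below N \<Longrightarrow> p + r \<in> polys_below N"
  for p :: "'a::comm_monoid_add poly"
  by (simp add: polys_below_def)

lemma polys_below_diff: "p \<in> polys_below N \<Longrightarrow> r \<in> polys_below N \<Longrightarrow> p - r \<in> polys_below N"
  for p :: "'a::ab_group_add poly"
  by (simp add: polys_below_def)

lemma polys_below_mono: "N \<le> N' \<Longrightarrow> polys_below N \<subseteq> polys_below N'"
  by (auto simp: polys_below_def)

lemma polys_below_Suc:
  "polys_below (Suc N) = (\<lambda>(a, p). pCons a p) ` (UNIV \<times> polys_below N)"
proof (intro Set.set_eqI iffI)
  fix p :: "'a poly" assume p: "p \<in> polys_below (Suc N)"
  obtain a r where ar: "p = pCons a r" by (cases p)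
  have "r \<in> polys_below N"
    using p unfolding ar polys_below_def by (auto simp: coeff_pCons)
  with ar show "p \<in> (\<lambda>(a, p). pCons a p) ` (UNIV \<times> polys_below N)" by auto
qed (auto simp: polys_below_def coeff_pCons split: nat.split)

lemma polys_below_0 [simp]: "polys_below 0 = {0}"
  by (auto simp: polys_below_def poly_eq_iff)

lemma finite_polys_below [simp]: "finite (polys_below N :: 'a::{zero,finite} poly set)"
  by (induction N) (auto simp: polys_below_Suc)

lemma card_polys_below: "card (polys_below N :: 'a::{zero,finite} poly set) = CARD('a) ^ N"
proof (induction N)
  case (Suc N)
  have "inj_on (\<lambda>(a, p). pCons a p) (UNIV \<times> (polys_below N :: 'a poly set))"
    by (auto simp: inj_on_def)
  then show ?case
    by (simp add: polys_below_Suc card_image card_cartesian_product Suc)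
qed auto

definition polys_of_degree :: "nat \<Rightarrow> 'a::zero poly set" where
  "polys_of_degree d = {f. f \<noteq> 0 \<and> degree f = d}"

lemma polys_of_degree_eq: "polys_of_degree d = polys_below (Suc d) - polys_below d"
  by (auto simp: polys_of_degree_def polys_below_iff)

lemma finite_polys_of_degree [simp]: "finite (polys_of_degree d :: 'a::{zero,finite} poly set)"
  by (simp add: polys_of_degree_eq)

lemma card_polys_of_degree:
  "card (polys_of_degree d :: 'a::{field,finite} poly set) = (CARD('a) - 1) * CARD('a) ^ d"
  unfolding polys_of_degree_eq
  by (subst card_Diff_subset) (auto simp: polys_below_mono card_polys_below diff_mult_distrib)

lemma polys_of_degree_add:
  "f \<in> polys_of_degree d \<Longrightarrow> s \<in> polys_below d \<Longrightarrow> f + s \<in> polys_of_degree d"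
  for f :: "'a::ab_group_add poly"
  unfolding polys_of_degree_eq
  using polys_below_add[of f "Suc d" s] polys_below_diff[of "f + s" d s] polys_below_mono[of d "Suc d"]
  by auto

lemma multiples_below:
  fixes W :: "'a::field poly"
  assumes "W \<noteq> 0" "degree W = D"
  shows "{f \<in> polys_below (D + e). W dvd f} = (*) W ` polys_below e"
proof (intro Set.set_eqI iffI)
  fix f assume f: "f \<in> {f \<in> polys_below (D + e). W dvd f}"
  then obtain g where g: "f = W * g" by auto
  have "g \<in> polys_below e"
    using f assms unfolding g by (cases "g = 0") (auto simp: polys_below_iff degree_mult_eq)
  with g show "f \<in> (*) W ` polys_below e" by auto
next
  fix f assume "f \<in> (*) W ` polys_below e"
  then obtain g where "f = W * g" "g \<in> polys_below e" by auto
  then show "f \<in> {f \<in> polys_below (D + e). W dvd f}"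
    using assms by (cases "g = 0") (auto simp: polys_below_iff degree_mult_eq)
qed

lemma card_multiples_below:
  fixes W :: "'a::{field,finite} poly"
  assumes "W \<noteq> 0" "degree W = D"
  shows "card {f \<in> polys_below (D + e). W dvd f} = CARD('a) ^ e"
  using assms by (simp add: multiples_below card_image inj_on_def card_polys_below)

lemma card_multiples_of_degree:
  fixes W :: "'a::{field,finite} poly"
  assumes "W \<noteq> 0" "degree W = D" "D \<le> d"
  shows "card {f \<in> polys_of_degree d. W dvd f} = (CARD('a) - 1) * CARD('a) ^ (d - D)"
proof -
  have "{f \<in> polys_of_degree d. W dvd f} = {f \<in> polys_below (D + Suc (d - D)). W dvd f} - {f \<in> polys_below (D + (d - D)). W dvd f}"
    using assms by (auto simp: polys_of_degree_eq)
  also have "card \<dots> = CARD('a) ^ (Suc (d - D)) - CARD('a) ^ (d - D)"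
    using assms(1,2) polys_below_mono[of "D + (d - D)" "D + Suc (d - D)", where 'a = 'a]
    by (subst card_Diff_subset) (auto simp: card_multiples_below simp del: add_Suc_right)
  finally show ?thesis by (simp add: diff_mult_distrib)
qed

section \<open>Monic divisors and the union bound over their squares\<close>

definition monic_polys :: "nat \<Rightarrow> 'a::zero_neq_one poly set" where
  "monic_polys j = {g. degree g = j \<and> lead_coeff g = 1}"

lemma monic_polys_eq: "monic_polys j = (\<lambda>p. p + monom 1 j) ` (polys_below j :: 'a::field poly set)"
proof (intro Set.set_eqI iffI)
  fix g :: "'a poly" assume g: "g \<in> monic_polys j"
  then have "g - monom 1 j \<in> polys_below j"
    by (auto simp: monic_polys_def polys_below_def) (metis coeff_eq_0 le_neq_implies_less)
  then show "g \<in> (\<lambda>p. p + monom 1 j) ` polys_below j"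
    by (auto intro: image_eqI[of _ _ "g - monom 1 j"])
next
  fix g :: "'a poly" assume "g \<in> (\<lambda>p. p + monom 1 j) ` polys_below j"
  then obtain p where p: "p \<in> polys_below j" "g = p + monom 1 j" by auto
  have c: "coeff g j = 1" using p by (simp add: polys_below_def)
  have "degree g \<le> j" using p by (intro degree_le) (auto simp: polys_below_def)
  with c have "degree g = j" by (metis le_antisym le_degree zero_neq_one)
  with c show "g \<in> monic_polys j" by (simp add: monic_polys_def)
qed

lemma finite_monic_polys [simp]: "finite (monic_polys j :: 'a::{field,finite} poly set)"
  by (simp add: monic_polys_eq)

lemma card_monic_polys: "card (monic_polys j :: 'a::{field,finite} poly set) = CARD('a) ^ j"
  by (simp add: monic_polys_eq card_image inj_on_def card_polys_below)

text \<open>Normalizing divisors leaves q^j candidates of degree j and saves a factor q - 1 in the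
  union bounds.\<close>

lemma monic_multiple:
  fixes g :: "'a::field poly"
  assumes "g \<noteq> 0"
  obtains g' where "lead_coeff g' = 1" "degree g' = degree g" "\<And>n f. g' ^ n dvd f \<longleftrightarrow> g ^ n dvd f"
    "\<And>c. poly g' c = 0 \<longleftrightarrow> poly g c = 0"
proof
  let ?g = "smult (inverse (lead_coeff g)) g"
  show "lead_coeff ?g = 1" "degree ?g = degree g" using assms by auto
  show "?g ^ n dvd f \<longleftrightarrow> g ^ n dvd f" for n f
    using assms by (simp add: smult_power smult_dvd_iff flip: power_inverse)
  show "poly ?g c = 0 \<longleftrightarrow> poly g c = 0" for c using assms by auto
qed

lemma card_UNIV_field_ge2: "CARD('a::{field,finite}) \<ge> 2"
proof -
  have "card {0, 1::'a} \<le> CARD('a)" by (rule card_mono) auto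
  then show ?thesis by simp
qed

text \<open>The exceptional set of all later estimates. For n \<ge> 2 an nth power dividing f
  contains a square, so this family bounds the tail for every n; with \<open>J = 0\<close> it
  consists of the polynomials that are not squarefree.\<close>

definition square_multiples :: "nat \<Rightarrow> nat \<Rightarrow> 'a::field poly set" where
  "square_multiples J d = {f \<in> polys_of_degree d. \<exists>g. degree g > J \<and> g ^ 2 dvd f}"

lemma finite_square_multiples [simp]: "finite (square_multiples J d :: 'a::{field,finite} poly set)"
  by (simp add: square_multiples_def)

lemma sum_inverse_powers_le:
  fixes q :: real assumes "q \<ge> 2"
  shows "(\<Sum>j\<in>{J<..K}. 1 / q ^ j) \<le> 1 / ((q - 1) * q ^ J)"
proof (cases "J \<le> K")
  case True
  have "(q - 1) * (\<Sum>j\<in>{J<..K}. 1 / q ^ j) = 1 / q ^ J - 1 / q ^ K"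
    using True
  proof (induction K rule: dec_induct)
    case (step K)
    have "{J<..Suc K} = insert (Suc K) {J<..K}" using step by auto
    then have "(q - 1) * (\<Sum>j\<in>{J<..Suc K}. 1 / q ^ j) = (q - 1) * (1 / q ^ Suc K) + (1 / q ^ J - 1 / q ^ K)"
      using step by (simp only: sum.insert finite_greaterThanAtMost) (simp add: ring_distribs)
    also have "(q - 1) * (1 / q ^ Suc K) = 1 / q ^ K - 1 / q ^ Suc K"
      using assms by (simp add: diff_divide_distrib)
    finally show ?case by simp
  qed simp
  also have "\<dots> \<le> 1 / q ^ J" using assms by simp
  finally have *: "(q - 1) * (\<Sum>j\<in>{J<..K}. 1 / q ^ j) \<le> 1 / q ^ J" .
  have "(\<Sum>j\<in>{J<..K}. 1 / q ^ j) \<le> 1 / q ^ J / (q - 1)"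
    using assms by (subst pos_le_divide_eq) (use * in \<open>simp_all only: mult.commute\<close>)
  also have "\<dots> = 1 / ((q - 1) * q ^ J)" by (simp add: mult.commute)
  finally show ?thesis .
qed (use assms in simp)

text \<open>A union bound: g^2 with g of degree j has (q - 1) q^(d - 2j) multiples of degree d. The
  family \<open>G\<close> stays a parameter because the tail estimate uses all monic g, while the
  positive lower bound needs a smaller family.\<close>

lemma card_square_multiples_family:
  fixes G :: "nat \<Rightarrow> 'a::{field,finite} poly set"
  assumes G: "\<And>j. G j \<subseteq> monic_polys j" and S: "S \<subseteq> polys_of_degree d"
    and ex: "\<And>f. f \<in> S \<Longrightarrow> \<exists>j>J. \<exists>g\<in>G j. g ^ 2 dvd f"
  defines "q \<equiv> real CARD('a)"
  shows "real (card S) \<le> (\<Sum>j | J < j \<and> 2 * j \<le> d. real (card (G j)) * ((q - 1) * (q ^ d / (q ^ j * q ^ j))))"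
proof -
  have q: "q \<ge> 2" using card_UNIV_field_ge2[where 'a='a] by (simp add: q_def)
  have q1: "real (CARD('a) - 1) = q - 1"
    using card_UNIV_field_ge2[where 'a='a] unfolding q_def by (subst of_nat_diff) auto
  let ?B = "\<lambda>g. {f \<in> polys_of_degree d. g ^ 2 dvd f} :: 'a poly set"
  let ?I = "{j. J < j \<and> 2 * j \<le> d}"
  have fin: "finite ?I" by (rule finite_subset[of _ "{..d}"]) auto
  have finG: "finite (G j)" for j using G finite_monic_polys finite_subset by blast
  have sub: "S \<subseteq> (\<Union>j\<in>?I. \<Union>g\<in>G j. ?B g)"
  proof
    fix f assume f: "f \<in> S"
    from ex[OF this] obtain j g where g: "j > J" "g \<in> G j" "g ^ 2 dvd f" by auto
    from g G have g': "lead_coeff g = 1" "degree g = j" by (auto simp: monic_polys_def)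
    then have "g \<noteq> 0" by auto
    have "degree (g ^ 2) \<le> degree f"
      using f S g(3) by (intro dvd_imp_degree_le) (auto simp: polys_of_degree_def)
    then have "2 * j \<le> d"
      using f S \<open>g \<noteq> 0\<close> g' by (auto simp: degree_power_eq polys_of_degree_def)
    then show "f \<in> (\<Union>j\<in>?I. \<Union>g\<in>G j. ?B g)"
      using f S g by (intro UN_I[of j] UN_I[of g]) auto
  qed
  have "card S \<le> card (\<Union>j\<in>?I. \<Union>g\<in>G j. ?B g)"
    by (rule card_mono[OF _ sub]) (auto simp: fin finG)
  also have "\<dots> \<le> (\<Sum>j\<in>?I. card (\<Union>g\<in>G j. ?B g))" by (rule card_UN_le[OF fin])
  also have "\<dots> \<le> (\<Sum>j\<in>?I. \<Sum>g\<in>G j. card (?B g))"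
    by (intro sum_mono card_UN_le finG)
  also have "\<dots> = (\<Sum>j\<in>?I. \<Sum>g\<in>G j. (CARD('a) - 1) * CARD('a) ^ (d - 2 * j))"
  proof (intro sum.cong refl)
    fix j g assume j: "j \<in> ?I" and "g \<in> G j"
    with G have "g \<in> monic_polys j" by blast
    then have "g \<noteq> 0" "degree g = j" by (auto simp: monic_polys_def)
    then have "g ^ 2 \<noteq> 0" "degree (g ^ 2) = 2 * j" by (auto simp: degree_power_eq)
    then show "card (?B g) = (CARD('a) - 1) * CARD('a) ^ (d - 2 * j)"
      using j by (intro card_multiples_of_degree) auto
  qed
  also have "real \<dots> = (\<Sum>j\<in>?I. real (card (G j)) * ((q - 1) * (q ^ d / (q ^ j * q ^ j))))"
    unfolding of_nat_sum
  proof (rule sum.cong[OF refl])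
    fix j assume j: "j \<in> ?I"
    then have "d = j + j + (d - 2 * j)" by simp
    then have "q ^ d = q ^ j * q ^ j * q ^ (d - 2 * j)" by (metis power_add)
    moreover have "q ^ j \<noteq> 0" using q by auto
    moreover have "b = c / (a * a)" if "c = a * a * b" "a \<noteq> 0" for a b c :: real
      using that by simp
    ultimately have e: "q ^ (d - 2 * j) = q ^ d / (q ^ j * q ^ j)" by blast
    show "(\<Sum>g\<in>G j. real ((CARD('a) - 1) * CARD('a) ^ (d - 2 * j)))
        = real (card (G j)) * ((q - 1) * (q ^ d / (q ^ j * q ^ j)))"
      by (simp only: sum_constant of_nat_mult of_nat_power q1 e flip: q_def)
  qed
  finally show ?thesis by simp
qed

text \<open>The terms (q - 1) q^(d - j) with j > J form a geometric series of sum at most q^(d - J).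
  The proportion 1 / q^J is independent of d, which is the uniformity the sieve needs.\<close>

lemma card_square_multiples:
  "real (card (square_multiples J d :: 'a::{field,finite} poly set)) \<le> CARD('a) ^ d / CARD('a) ^ J"
proof -
  define q where "q = real (CARD('a))"
  have q: "q \<ge> 2" using card_UNIV_field_ge2[where 'a='a] by (simp add: q_def)
  have "real (card (square_multiples J d :: 'a poly set))
      \<le> (\<Sum>j | J < j \<and> 2 * j \<le> d. real (card (monic_polys j :: 'a poly set)) * ((q - 1) * (q ^ d / (q ^ j * q ^ j))))"
    unfolding q_def
  proof (rule card_square_multiples_family)
    fix f :: "'a poly" assume "f \<in> square_multiples J d"
    then obtain g where g: "degree g > J" "g ^ 2 dvd f"
      by (auto simp: square_multiples_def)
    from g(1) have "g \<noteq> 0" by auto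
    then obtain g' where g': "lead_coeff g' = 1" "degree g' = degree g" "g' ^ 2 dvd f"
      using g(2) by (elim monic_multiple) blast
    then show "\<exists>j>J. \<exists>g\<in>monic_polys j. g ^ 2 dvd f"
      using g(1) by (intro exI[of _ "degree g"] conjI bexI[of _ g']) (auto simp: monic_polys_def)
  qed (auto simp: square_multiples_def)
  also have "\<dots> = (\<Sum>j | J < j \<and> 2 * j \<le> d. (q - 1) * q ^ d * (1 / q ^ j))"
    using q by (intro sum.cong refl) (simp add: card_monic_polys flip: q_def)
  also have "\<dots> \<le> (\<Sum>j\<in>{J<..d}. (q - 1) * q ^ d * (1 / q ^ j))"
    using q by (intro sum_mono2) auto
  also have "\<dots> = (q - 1) * q ^ d * (\<Sum>j\<in>{J<..d}. 1 / q ^ j)" by (simp add: sum_distrib_left)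
  also have "\<dots> \<le> (q - 1) * q ^ d * (1 / ((q - 1) * q ^ J))"
    using q by (intro mult_left_mono sum_inverse_powers_le) auto
  also have "\<dots> = q ^ d / q ^ J" using q by simp
  finally show ?thesis by (simp add: q_def)
qed

text \<open>For \<open>q = 2\<close> the union bound over all monic \<open>g\<close> only gives \<open>0\<close>; leaving out
  \<open>g = x\<^sup>2\<close>, whose multiples are already multiples of \<open>x\<close>, makes it positive.\<close>

lemma card_squarefree_ge:
  assumes "d \<ge> 4"
  shows "real (card (polys_of_degree d - square_multiples 0 d :: 'a::{field,finite} poly set))
    \<ge> (real CARD('a) - 1) * real CARD('a) ^ d / real CARD('a) ^ 4"
proof -
  define q where "q = real (CARD('a))"
  have q: "q \<ge> 2" using card_UNIV_field_ge2[where 'a='a] by (simp add: q_def)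
  define G where "G j = monic_polys j - {monom 1 2 :: 'a poly}" for j
  have x2: "monom 1 2 \<in> (monic_polys 2 :: 'a poly set)" by (simp add: monic_polys_def degree_monom_eq)
  have cG: "real (card (G j)) = q ^ j - (if j = 2 then 1 else 0)" for j
  proof (cases "j = 2")
    case True
    have "1 \<le> CARD('a) ^ 2" using card_UNIV_field_ge2[where 'a='a] by simp
    then show ?thesis
      using True x2 by (simp add: G_def card_Diff_singleton card_monic_polys q_def of_nat_diff)
  next
    case False
    then have "G j = monic_polys j" by (auto simp: G_def monic_polys_def degree_monom_eq)
    with False show ?thesis by (simp add: card_monic_polys q_def)
  qed
  have fin: "finite {j. 0 < j \<and> 2 * j \<le> d}" by (rule finite_subset[of _ "{..d}"]) auto
  have "real (card (square_multiples 0 d :: 'a poly set))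
      \<le> (\<Sum>j | 0 < j \<and> 2 * j \<le> d. real (card (G j)) * ((q - 1) * (q ^ d / (q ^ j * q ^ j))))"
    unfolding q_def
  proof (rule card_square_multiples_family)
    fix f :: "'a poly" assume "f \<in> square_multiples 0 d"
    then obtain g where g: "degree g > 0" "g ^ 2 dvd f"
      by (auto simp: square_multiples_def)
    from g(1) have "g \<noteq> 0" by auto
    then obtain g' where g': "lead_coeff g' = 1" "degree g' = degree g" "g' ^ 2 dvd f"
      using g(2) by (elim monic_multiple) blast
    show "\<exists>j>0. \<exists>g\<in>G j. g ^ 2 dvd f"
    proof (cases "g' = monom 1 2")
      case True
      have "monom 1 1 ^ 2 = (monom 1 2 :: 'a poly)" by (simp add: monom_power)
      then have "monom 1 1 ^ 2 dvd (monom 1 2 :: 'a poly) ^ 2" by (simp add: power2_eq_square)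
      with True g'(3) have "monom 1 1 ^ 2 dvd f" by (metis dvd_trans)
      then show ?thesis
        by (intro exI[of _ 1] conjI bexI[of _ "monom 1 1"])
           (auto simp: G_def monic_polys_def degree_monom_eq monom_eq_iff')
    next
      case False
      then show ?thesis using g g'
        by (intro exI[of _ "degree g'"] conjI bexI[of _ g']) (auto simp: G_def monic_polys_def)
    qed
  qed (auto simp: G_def square_multiples_def)
  \<comment> \<open>Leaving out \<open>monom 1 2\<close> lowers only the term j = 2, by (q - 1) q^d
    / q^4, and this amount becomes the lower bound. The assumption d \<ge> 4 puts j = 2 into the
    range.\<close>
  also have "\<dots> = (\<Sum>j | 0 < j \<and> 2 * j \<le> d. (q - 1) * q ^ d * (1 / q ^ j) - (if j = 2 then (q - 1) * q ^ d / q ^ 4 else 0))"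
  proof (rule sum.cong[OF refl])
    fix j
    have *: "(x - c) * (a * (b / (x * x))) = a * b * (1 / x) - c * (a * b / (x * x))" if "x \<noteq> 0" for x a b c :: real
      using that by (simp add: left_diff_distrib diff_divide_distrib)
    have "q ^ j \<noteq> 0" using q by simp
    from *[OF this, of "if j = 2 then 1 else 0" "q - 1" "q ^ d"]
    show "real (card (G j)) * ((q - 1) * (q ^ d / (q ^ j * q ^ j))) =
      (q - 1) * q ^ d * (1 / q ^ j) - (if j = 2 then (q - 1) * q ^ d / q ^ 4 else 0)"
      unfolding cG by (simp split: if_splits flip: power_add)
  qed
  also have "\<dots> = (\<Sum>j | 0 < j \<and> 2 * j \<le> d. (q - 1) * q ^ d * (1 / q ^ j)) - (q - 1) * q ^ d / q ^ 4"
    using fin assms by (simp only: sum_subtractf sum.delta) simp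
  finally have bad: "real (card (square_multiples 0 d :: 'a poly set)) \<le>
    (\<Sum>j | 0 < j \<and> 2 * j \<le> d. (q - 1) * q ^ d * (1 / q ^ j)) - (q - 1) * q ^ d / q ^ 4" .
  have "(\<Sum>j | 0 < j \<and> 2 * j \<le> d. (q - 1) * q ^ d * (1 / q ^ j)) \<le> (\<Sum>j\<in>{0<..d}. (q - 1) * q ^ d * (1 / q ^ j))"
    using q by (intro sum_mono2) auto
  also have "\<dots> = (q - 1) * q ^ d * (\<Sum>j\<in>{0<..d}. 1 / q ^ j)" by (simp add: sum_distrib_left)
  also have "\<dots> \<le> (q - 1) * q ^ d * (1 / ((q - 1) * q ^ 0))"
    using q by (intro mult_left_mono sum_inverse_powers_le) auto
  also have "\<dots> = q ^ d" using q by simp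
  also have "q ^ d \<le> (q - 1) * q ^ d" using q by (simp add: mult_le_cancel_right1)
  finally have "real (card (square_multiples 0 d :: 'a poly set)) \<le> (q - 1) * q ^ d - (q - 1) * q ^ d / q ^ 4"
    using bad by linarith
  moreover have "real (card (polys_of_degree d :: 'a poly set)) = (q - 1) * q ^ d"
    using q unfolding card_polys_of_degree by (simp add: q_def of_nat_diff)
  moreover have "card (polys_of_degree d - square_multiples 0 d :: 'a poly set) = card (polys_of_degree d :: 'a poly set) - card (square_multiples 0 d :: 'a poly set)"
    by (intro card_Diff_subset) (auto simp: square_multiples_def)
  moreover have "card (square_multiples 0 d :: 'a poly set) \<le> card (polys_of_degree d :: 'a poly set)"
    by (intro card_mono) (auto simp: square_multiples_def)
  ultimately show ?thesis by (simp add: of_nat_diff flip: q_def)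
qed

section \<open>Ring homomorphisms between types\<close>

locale type_ring_hom =
  fixes h :: "'a::comm_ring_1 \<Rightarrow> 'b::comm_ring_1"
  assumes hom_1: "h 1 = 1" and hom_add: "h (x + y) = h x + h y" and hom_mult: "h (x * y) = h x * h y"
begin

lemma hom_0: "h 0 = 0"
  using hom_add[of 0 0] by simp

lemma hom_uminus: "h (- x) = - h x"
  using hom_add[of x "- x"] by (simp add: hom_0 add_eq_0_iff)

lemma hom_diff: "h (x - y) = h x - h y"
  using hom_add[of x "- y"] by (simp add: hom_uminus)

lemma hom_power: "h (x ^ i) = h x ^ i"
  by (induction i) (simp_all add: hom_1 hom_mult)

lemma hom_sum: "h (sum f A) = (\<Sum>x\<in>A. h (f x))"
  by (induction A rule: infinite_finite_induct) (simp_all add: hom_0 hom_add)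

lemma hom_of_nat: "h (of_nat i) = of_nat i"
  by (induction i) (simp_all add: hom_0 hom_1 hom_add)

lemma hom_dvd: "x dvd y \<Longrightarrow> h x dvd h y"
  by (auto simp: dvd_def hom_mult)

lemmas homs = hom_0 hom_1 hom_add hom_uminus hom_diff hom_mult hom_power

lemma map_poly_add': "map_poly h (p + r) = map_poly h p + map_poly h r"
  by (simp add: poly_eq_iff coeff_map_poly homs)

lemma map_poly_mult': "map_poly h (p * r) = map_poly h p * map_poly h r"
  by (simp add: poly_eq_iff coeff_map_poly homs coeff_mult hom_sum)

lemma map_poly_1'': "map_poly h 1 = 1"
  by (simp add: one_pCons map_poly_pCons hom_0 hom_1)

lemma type_ring_hom_map: "type_ring_hom (map_poly h)"
  by unfold_locales (simp_all add: map_poly_add' map_poly_mult' map_poly_1'')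

lemmas map_homs = type_ring_hom.homs[OF type_ring_hom_map]

lemma map_poly_pCons': "map_poly h (pCons a p) = pCons (h a) (map_poly h p)"
  by (simp add: map_poly_pCons hom_0)

lemma poly_map_poly_hom: "poly (map_poly h p) (h x) = h (poly p x)"
  by (induction p) (simp_all add: homs map_poly_pCons')

lemma poly_map_poly_sum: "degree p < N \<Longrightarrow> poly (map_poly h p) y = (\<Sum>i<N. h (coeff p i) * y ^ i)"
proof -
  assume N: "degree p < N"
  have dm: "degree (map_poly h p) \<le> degree p"
    by (intro degree_le) (simp add: coeff_map_poly hom_0 coeff_eq_0)
  have "poly (map_poly h p) y = (\<Sum>i\<le>degree (map_poly h p). coeff (map_poly h p) i * y ^ i)" by (rule poly_altdef)
  also have "\<dots> = (\<Sum>i<N. coeff (map_poly h p) i * y ^ i)"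
    using N dm
    by (intro sum.mono_neutral_left) (auto simp: coeff_eq_0)
  finally show ?thesis by (simp add: coeff_map_poly hom_0)
qed

end

lemma pderiv_map_poly:
  fixes h :: "'a::idom \<Rightarrow> 'b::idom"
  assumes "type_ring_hom h"
  shows "pderiv (map_poly h p) = map_poly h (pderiv p)"
proof -
  interpret type_ring_hom h by fact
  have "h (1 + of_nat i) = 1 + of_nat i" for i by (simp add: homs hom_of_nat)
  then show ?thesis by (simp add: poly_eq_iff coeff_map_poly coeff_pderiv homs)
qed

lemma type_ring_hom_comp:
  "type_ring_hom h \<Longrightarrow> type_ring_hom k \<Longrightarrow> type_ring_hom (\<lambda>x. k (h x))"
  by (simp add: type_ring_hom_def)

locale inj_type_ring_hom = type_ring_hom h for h :: "'a::comm_ring_1 \<Rightarrow> 'b::comm_ring_1" +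
  assumes hom_eq_0: "h x = 0 \<Longrightarrow> x = 0"
begin

lemma hom_eq_0_iff [simp]: "h x = 0 \<longleftrightarrow> x = 0"
  using hom_eq_0 hom_0 by auto

lemma hom_eq_iff: "h x = h y \<longleftrightarrow> x = y"
  using hom_eq_0_iff[of "x - y"] by (simp add: hom_diff)

lemma inj_type_ring_hom_map: "inj_type_ring_hom (map_poly h)"
  using type_ring_hom_map
  by (simp add: inj_type_ring_hom_def inj_type_ring_hom_axioms_def poly_eq_iff coeff_map_poly hom_0)

lemma degree_map_poly_hom [simp]: "degree (map_poly h p) = degree p"
  by (intro degree_map_poly) auto

end

lemma inj_type_ring_hom_to_ac: "inj_type_ring_hom to_ac"
  by unfold_locales auto

lemma inj_type_ring_hom_to_fract: "inj_type_ring_hom (to_fract :: 'a::idom \<Rightarrow> 'a fract)"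
  by unfold_locales auto

lemma inj_type_ring_hom_comp:
  "inj_type_ring_hom h \<Longrightarrow> inj_type_ring_hom k \<Longrightarrow> inj_type_ring_hom (\<lambda>x. k (h x))"
  by (simp add: inj_type_ring_hom_def inj_type_ring_hom_axioms_def type_ring_hom_comp)

lemma type_ring_hom_eval:
  assumes "type_ring_hom h"
  shows "type_ring_hom (\<lambda>p. poly (map_poly h p) y)"
proof -
  interpret type_ring_hom h by fact
  show ?thesis by unfold_locales (simp_all add: map_homs)
qed

lemma type_ring_hom_pcompose: "type_ring_hom (\<lambda>p. pcompose p r)"
  by unfold_locales (simp_all add: pcompose_add pcompose_mult pcompose_1)

lemma type_ring_hom_const: "type_ring_hom (\<lambda>c. [:c:])"
  by unfold_locales (simp_all add: one_pCons)

section \<open>Simple roots and square factors\<close>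

text \<open>Comaximality in place of a gcd: the identity survives ring homomorphisms, in particular
  the passage to the algebraic closure, and passes to powers and products.\<close>

definition bezout :: "'a::comm_ring_1 \<Rightarrow> 'a \<Rightarrow> bool" where
  "bezout p r \<longleftrightarrow> (\<exists>u v. u * p + v * r = 1)"

lemma bezout_sym: "bezout p r \<Longrightarrow> bezout r p"
  unfolding bezout_def by (metis add.commute)

lemma bezout_1 [simp]: "bezout p 1"
  unfolding bezout_def by (rule exI[of _ 0], rule exI[of _ 1]) simp

lemma bezout_mult:
  assumes "bezout p r" "bezout p s" shows "bezout p (r * s)"
proof -
  obtain u v u' v' where "u * p + v * r = 1" "u' * p + v' * s = 1"
    using assms unfolding bezout_def by blast
  then have "(u * p + v * r) * (u' * p + v' * s) = 1" by simp
  then have "(u * u' * p + u * v' * s + v * r * u') * p + (v * v') * (r * s) = 1"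
    by (simp add: algebra_simps)
  then show ?thesis unfolding bezout_def by blast
qed

lemma bezout_power: "bezout p r \<Longrightarrow> bezout p (r ^ i)"
  by (induction i) (simp_all add: bezout_mult)

lemma bezout_prod: "(\<And>a. a \<in> A \<Longrightarrow> bezout p (r a)) \<Longrightarrow> bezout p (prod r A)"
  by (induction A rule: infinite_finite_induct) (simp_all add: bezout_mult)

lemma bezout_dvd:
  assumes "bezout p r" "p dvd r * s" shows "p dvd s"
proof -
  obtain u v where "u * p + v * r = 1" using assms unfolding bezout_def by blast
  moreover have "u * s * p + v * (r * s) = (u * p + v * r) * s" by (simp add: algebra_simps)
  ultimately have "s = u * s * p + v * (r * s)" by simp
  moreover have "p dvd u * s * p + v * (r * s)"
    by (rule dvd_add[OF dvd_triv_right dvd_mult[OF assms(2)]])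
  ultimately show ?thesis by (rule ssubst[of s _ "\<lambda>t. p dvd t"])
qed

lemma bezout_mult_dvd:
  assumes "bezout p r" "p dvd s" "r dvd s" shows "p * r dvd s"
proof -
  obtain t where t: "s = r * t" using assms(3) by blast
  then have "p dvd t" using bezout_dvd assms by blast
  then show ?thesis unfolding t by (subst mult.commute) (rule mult_dvd_mono[OF dvd_refl])
qed

lemma bezout_linear:
  fixes g :: "'a::field poly"
  assumes "poly g a \<noteq> 0" shows "bezout g [:-a, 1:]"
proof -
  let ?c = "[:inverse (poly g a):]"
  have e: "[:-a, 1:] * synthetic_div g a + [:poly g a:] = g" by (rule synthetic_div_correct')
  have "?c * g + (- ?c * synthetic_div g a) * [:-a, 1:] = ?c * ([:-a, 1:] * synthetic_div g a + [:poly g a:]) + (- ?c * synthetic_div g a) * [:-a, 1:]"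
    by (simp only: e)
  also have "\<dots> = ?c * [:poly g a:]" by (simp only: distrib_left mult_minus_left mult.assoc mult.commute[of "synthetic_div g a"]) simp
  also have "\<dots> = 1" using assms by (simp add: one_pCons)
  finally show ?thesis unfolding bezout_def by blast
qed

lemma bezout_gcd:
  fixes p h :: "'a::field poly"
  shows "\<exists>e u v. e dvd p \<and> e dvd h \<and> e = u * p + v * h"
\<comment> \<open>Euclid's algorithm. The measure separates zero from the nonzero constants, all of
  which have degree 0.\<close>
proof (induction "if h = 0 then 0 else Suc (degree h)" arbitrary: p h rule: less_induct)
  case less
  show ?case
  proof (cases "h = 0")
    case True
    then show ?thesis by (intro exI[of _ p] exI[of _ 1] exI[of _ 0]) simp
  next
    case False
    then have "(if p mod h = 0 then 0 else Suc (degree (p mod h))) < (if h = 0 then 0 else Suc (degree h))"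
      using degree_mod_less[of h p] by auto
    from less[OF this, of h] obtain e u v where e: "e dvd h" "e dvd p mod h" "e = u * h + v * (p mod h)" by blast
    have p: "p = (p div h) * h + p mod h" by simp
    then have "e dvd p" using e(1,2) by (metis dvd_add dvd_mult)
    have "p mod h = p - (p div h) * h" using p by (simp add: minus_div_mult_eq_mod)
    moreover have "a = v * p + (u - v * c) * h" if "a = u * h + v * b" "b = p - c * h" for a b c
      using that by (simp add: algebra_simps)
    ultimately have "e = v * p + (u - v * (p div h)) * h" using e(3) by blast
    with \<open>e dvd p\<close> show ?thesis using e(1) by blast
  qed
qed

text \<open>A nonconstant divisor of least degree serves as an irreducible factor: a common divisor
  of p and h that is a combination of them is either constant or an associate of p.\<close>

lemma minimal_divisor:
  fixes f :: "'a::field poly"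
  assumes "degree f > 0"
  shows "\<exists>p. p dvd f \<and> degree p > 0 \<and> (\<forall>e. e dvd p \<longrightarrow> 0 < degree e \<longrightarrow> degree p \<le> degree e) \<and>
    (\<forall>h. bezout p h \<or> p dvd h)"
proof -
  have f0: "f \<noteq> 0" using assms by auto
  obtain p where p: "p dvd f" "degree p > 0" and min: "\<And>e. e dvd f \<Longrightarrow> 0 < degree e \<Longrightarrow> degree p \<le> degree e"
    using ex_has_least_nat[of "\<lambda>p. p dvd f \<and> degree p > 0" f degree] assms by auto
  have bz: "bezout p h \<or> p dvd h" for h
  proof -
    obtain e u v where e: "e dvd p" "e dvd h" "e = u * p + v * h" using bezout_gcd by blast
    have e0: "e \<noteq> 0" using e(1) p by auto
    show ?thesis
    proof (cases "degree e = 0")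
      case True
      then obtain c where c: "e = [:c:]" using degree_eq_zeroE by blast
      with e0 have "c \<noteq> 0" by auto
      then have "[:inverse c:] * e = 1" by (simp add: c one_pCons)
      then have "([:inverse c:] * u) * p + ([:inverse c:] * v) * h = 1"
        by (simp only: e(3) distrib_left mult.assoc)
      then show ?thesis unfolding bezout_def by blast
    next
      case False
      then have "degree p \<le> degree e" using e(1) p(1) min by (metis dvd_trans gr0I)
      obtain s where s: "p = e * s" using e(1) by blast
      with p have s0: "s \<noteq> 0" by auto
      with s e0 \<open>degree p \<le> degree e\<close> have "degree s = 0" by (simp add: degree_mult_eq)
      then obtain c where c: "s = [:c:]" using degree_eq_zeroE by blast
      with s0 have "c \<noteq> 0" by auto
      have "e = [:inverse c:] * p" using \<open>c \<noteq> 0\<close> by (simp add: s c)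
      then have "p dvd e" by (metis dvd_triv_right)
      then have "p dvd h" using e(2) by (rule dvd_trans)
      then show ?thesis ..
    qed
  qed
  have md: "degree p \<le> degree e" if "e dvd p" "0 < degree e" for e
    using min[OF dvd_trans[OF that(1) p(1)] that(2)] .
  show ?thesis using p(1) p(2) md bz by (intro exI[of _ p] conjI allI impI)
qed

lemma extract_power:
  fixes f p :: "'a::idom poly"
  assumes "f \<noteq> 0" "degree p > 0"
  shows "\<exists>e f1. f = p ^ e * f1 \<and> \<not> p dvd f1"
  using assms(1)
proof (induction "degree f" arbitrary: f rule: less_induct)
  case less
  show ?case
  proof (cases "p dvd f")
    case True
    then obtain f' where f': "f = p * f'" by blast
    with less.prems have "f' \<noteq> 0" "p \<noteq> 0" by auto
    with f' assms(2) have "degree f' < degree f" by (simp add: degree_mult_eq)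
    from less.hyps[OF this \<open>f' \<noteq> 0\<close>] obtain e f1 where "f' = p ^ e * f1" "\<not> p dvd f1" by blast
    with f' show ?thesis by (intro exI[of _ "Suc e"] exI[of _ f1]) simp
  qed (auto intro: exI[of _ 0])
qed

section \<open>Perfectness of the base field and the existence of simple roots\<close>

lemma frobenius_surj:
  fixes x :: "'a::{field,finite}"
  obtains y where "y ^ CHAR('a) = x"
proof -
  have pr: "Factorial_Ring.prime CHAR('a)" by (intro prime_CHAR_semidom finite_imp_CHAR_pos) simp
  have "inj (\<lambda>y::'a. y ^ CHAR('a))"
  proof (rule injI)
    fix y z :: 'a assume e: "y ^ CHAR('a) = z ^ CHAR('a)"
    have "(z + (y - z)) ^ CHAR('a) = z ^ CHAR('a) + (y - z) ^ CHAR('a)"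
      by (rule freshmans_dream[OF pr refl])
    with e have "(y - z) ^ CHAR('a) = 0" by simp
    then show "y = z" by simp
  qed
  then have "surj (\<lambda>y::'a. y ^ CHAR('a))" by (simp add: finite_UNIV_inj_surj)
  then show ?thesis using that by (metis surjD)
qed

text \<open>Only exponents divisible by the characteristic survive, and each coefficient is itself
  such a power by \<open>frobenius_surj\<close>; the root is then taken coefficientwise and
  recombined by additivity of Frobenius.\<close>

lemma pderiv_eq_0_imp_power:
  fixes p :: "'a::{field,finite} poly"
  assumes "pderiv p = 0"
  obtains r where "p = r ^ CHAR('a)"
proof -
  let ?P = "CHAR('a)"
  have pr: "Factorial_Ring.prime ?P" by (intro prime_CHAR_semidom finite_imp_CHAR_pos) simp
  have P0: "?P > 0" using pr by (simp add: prime_gt_0_nat)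
  have prp: "Factorial_Ring.prime CHAR('a poly)" using pr by simp
  have "\<exists>y. y ^ ?P = x" for x :: 'a by (rule frobenius_surj) blast
  then have "\<exists>b. \<forall>i. b i ^ ?P = coeff p (i * ?P)" by (intro choice allI)
  then obtain b where b: "\<And>i. b i ^ ?P = coeff p (i * ?P)" by blast
  define r where "r = (\<Sum>i\<le>degree p. monom (b i) i)"
  have "r ^ ?P = (\<Sum>i\<le>degree p. monom (b i) i ^ ?P)"
    unfolding r_def by (rule freshmans_dream_sum[OF prp]) simp
  also have "\<dots> = (\<Sum>i\<le>degree p. monom (coeff p (i * ?P)) (i * ?P))"
    by (simp add: monom_power b)
  also have "\<dots> = p"
  proof (rule poly_eqI)
    fix j
    have *: "coeff (\<Sum>i\<le>degree p. monom (coeff p (i * ?P)) (i * ?P)) j = (\<Sum>i\<le>degree p. if i * ?P = j then coeff p j else 0)"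
      unfolding coeff_sum by (intro sum.cong) auto
    show "coeff (\<Sum>i\<le>degree p. monom (coeff p (i * ?P)) (i * ?P)) j = coeff p j"
    proof (cases "?P dvd j")
      case True
      then obtain i where i: "j = i * ?P" by (metis dvd_def mult.commute)
      have "(\<Sum>i\<le>degree p. if i * ?P = j then coeff p j else 0) = (\<Sum>i'\<le>degree p. if i' = i then coeff p j else 0)"
        using P0 by (intro sum.cong) (auto simp: i)
      also have "\<dots> = coeff p j"
      proof (cases "i \<le> degree p")
        case False
        then have "degree p < j" using P0 unfolding i by (cases "?P") auto
        then show ?thesis by (simp add: coeff_eq_0)
      qed simp
      finally show ?thesis unfolding * .
    next
      case False
      then have "j \<noteq> 0" by (metis dvd_0_right)
      then obtain j' where j': "j = Suc j'" using not0_implies_Suc by blast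
      have "of_nat j * coeff p j = coeff (pderiv p) j'" by (simp add: coeff_pderiv j')
      also have "\<dots> = 0" using assms by simp
      finally have "coeff p j = 0" using False by (simp add: of_nat_eq_0_iff_char_dvd)
      moreover have "(\<Sum>i\<le>degree p. if i * ?P = j then coeff p j else 0) = 0"
        using False by (intro sum.neutral) auto
      ultimately show ?thesis unfolding * by simp
    qed
  qed
  finally show ?thesis using that by metis
qed

text \<open>The generic condition under which everything about the curve is proved. It fails for
  instance for f = g^m with m > 1, where y - g is a proper factor of y^m - f.\<close>

definition has_simple_root :: "'a::field poly \<Rightarrow> bool" where
  "has_simple_root f \<longleftrightarrow>
     (\<exists>c::'a alg_closure. poly (map_poly to_ac f) c = 0 \<and> poly (pderiv (map_poly to_ac f)) c \<noteq> 0)"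

interpretation to_ac: inj_type_ring_hom to_ac by (rule inj_type_ring_hom_to_ac)

lemma bezout_no_common_root:
  assumes "bezout p r" "poly (map_poly to_ac p) c = 0" shows "poly (map_poly to_ac r) c \<noteq> 0"
proof
  assume *: "poly (map_poly to_ac r) c = 0"
  obtain u v where "u * p + v * r = 1" using assms unfolding bezout_def by blast
  then have "poly (map_poly to_ac (u * p + v * r)) c = 1" by (simp add: to_ac.map_homs)
  then show False using assms * by (simp add: to_ac.map_homs)
qed

text \<open>An irreducible factor p of exponent 1 is separable because the field is perfect, and its
  roots are then simple roots of f. If there is no such factor, every p^e has e \<ge> 2 and
  contributes p^(e div 2) to g.\<close>

lemma simple_root_or_square_factor:
  fixes f :: "'a::{field,finite} poly"
  assumes "f \<noteq> 0"
  shows "has_simple_root f \<or> (\<exists>g. g ^ 2 dvd f \<and> degree f \<le> 3 * degree g)"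
  using assms
proof (induction "degree f" arbitrary: f rule: less_induct)
  case less
  show ?case
  proof (cases "degree f = 0")
    case True
    then show ?thesis by (intro disjI2 exI[of _ 1]) simp
  next
    case False
    then have d: "degree f > 0" by simp
    from minimal_divisor[OF d] obtain p where p: "p dvd f" "degree p > 0"
      "\<forall>e. e dvd p \<longrightarrow> 0 < degree e \<longrightarrow> degree p \<le> degree e" "\<forall>h. bezout p h \<or> p dvd h"
      by (elim exE conjE) (rule that)
    have p0: "p \<noteq> 0" using p(2) by auto
    obtain e f1 where f: "f = p ^ e * f1" and nd: "\<not> p dvd f1" using extract_power[OF less.prems p(2)] by blast
    with p(4) have bez: "bezout p f1" by blast
    have f1: "f1 \<noteq> 0" using less.prems f by auto
    have e0: "e \<noteq> 0"
    proof
      assume "e = 0"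
      then show False using f p(1) nd by simp
    qed
    have deg: "degree f = e * degree p + degree f1" using p0 f1 unfolding f by (simp add: degree_mult_eq degree_power_eq)
    consider "e = 1" | "e \<ge> 2" using e0 by linarith
    then show ?thesis
    proof cases
      case 1
      \<comment> \<open>Otherwise p is a power of some r, which would be a nonconstant divisor of p
        of smaller degree.\<close>
      have "pderiv p \<noteq> 0"
      proof
        assume "pderiv p = 0"
        then obtain r where r: "p = r ^ CHAR('a)" by (rule pderiv_eq_0_imp_power)
        have pr: "Factorial_Ring.prime CHAR('a)" by (intro prime_CHAR_semidom finite_imp_CHAR_pos) simp
        have r0: "r \<noteq> 0" using p0 r pr by (auto simp: power_0_left prime_gt_0_nat)
        have dr: "degree p = CHAR('a) * degree r" using r r0 by (metis degree_power_eq)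
        with p(2) have "degree r > 0" by simp
        moreover have "r dvd p" using pr prime_gt_0_nat[OF pr] unfolding r by (intro dvd_power) auto
        ultimately have "degree p \<le> degree r" using p(3) by blast
        with dr \<open>degree r > 0\<close> show False using prime_gt_1_nat[OF pr] by simp
      qed
      have "degree (pderiv p) \<le> degree p - 1"
        by (rule degree_le) (simp add: coeff_pderiv coeff_eq_0)
      then have "degree (pderiv p) < degree p" using p(2) by linarith
      then have "\<not> p dvd pderiv p"
        using dvd_imp_degree_le[of p "pderiv p"] \<open>pderiv p \<noteq> 0\<close> by linarith
      with p(4) have bd: "bezout p (pderiv p)" by blast
      obtain c where c: "poly (map_poly to_ac p) c = 0"
        using alg_closed_imp_poly_has_root[of "map_poly to_ac p"] p(2) by auto
      have "poly (pderiv (map_poly to_ac f)) c = poly (map_poly to_ac (pderiv p)) c * poly (map_poly to_ac f1) c"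
        using c by (simp add: f 1 to_ac.map_homs pderiv_mult pderiv_map_poly[OF to_ac.type_ring_hom_axioms])
      with c bezout_no_common_root[OF bd c] bezout_no_common_root[OF bez c] have "has_simple_root f"
        unfolding has_simple_root_def by (intro exI[of _ c]) (simp add: f 1 to_ac.map_homs)
      then show ?thesis ..
    next
      case 2
      have "degree f1 < degree f" using deg p(2) 2 by simp
      from less.hyps[OF this f1] show ?thesis
      proof
        assume "has_simple_root f1"
        then obtain c where c: "poly (map_poly to_ac f1) c = 0" "poly (pderiv (map_poly to_ac f1)) c \<noteq> 0"
          unfolding has_simple_root_def by blast
        have "poly (map_poly to_ac p) c \<noteq> 0" using bezout_no_common_root[OF bezout_sym[OF bez] c(1)] .
        with c have "has_simple_root f"
          unfolding has_simple_root_def by (intro exI[of _ c]) (simp add: f to_ac.map_homs pderiv_mult)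
        then show ?thesis ..
      next
        assume "\<exists>g. g ^ 2 dvd f1 \<and> degree f1 \<le> 3 * degree g"
        then obtain g where g: "g ^ 2 dvd f1" "degree f1 \<le> 3 * degree g" by blast
        have "g \<noteq> 0" using g f1 by auto
        have "(p ^ (e div 2) * g) ^ 2 dvd f"
          unfolding f power_mult_distrib using g(1) by (intro mult_dvd_mono) (auto simp: le_imp_power_dvd simp flip: power_mult)
        moreover have "degree (p ^ (e div 2) * g) = (e div 2) * degree p + degree g"
          using p0 \<open>g \<noteq> 0\<close> by (simp add: degree_mult_eq degree_power_eq)
        \<comment> \<open>The constant 3 is forced by e = 3, where rounding down loses most.\<close>
        moreover have "e \<le> 3 * (e div 2)" using 2 by linarith
        then have "e * degree p \<le> 3 * (e div 2) * degree p" by (rule mult_le_mono1)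
        then have "e * degree p \<le> 3 * (e div 2 * degree p)" by (simp only: mult.assoc)
        then have "degree f \<le> 3 * (e div 2 * degree p + degree g)"
          unfolding deg distrib_left using g(2) by (rule add_mono)
        ultimately show ?thesis by (intro disjI2 exI[of _ "p ^ (e div 2) * g"]) simp
      qed
    qed
  qed
qed

section \<open>Residue classes of power-free polynomials\<close>

lemma dvd_power_mono: "g ^ i dvd f \<Longrightarrow> j \<le> i \<Longrightarrow> g ^ j dvd f" for f g :: "'a::comm_semiring_1"
  using le_imp_power_dvd dvd_trans by blast

lemma power_free_not_0: "power_free n f \<Longrightarrow> f \<noteq> 0"
  unfolding power_free_def by (metis degree_pCons_eq_if dvd_0_right one_neq_zero one_pCons zero_less_Suc)

lemma power_free_polys_subset: "power_free_polys n d \<subseteq> polys_of_degree d"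
  using power_free_not_0 by (auto simp: power_free_polys_def polys_of_degree_def)

lemma finite_power_free_polys [simp]: "finite (power_free_polys n d :: 'a::{field,finite} poly set)"
  by (rule finite_subset[OF power_free_polys_subset]) simp

lemma squarefree_subset_power_free:
  assumes "n \<ge> 2"
  shows "polys_of_degree d - square_multiples 0 d \<subseteq> power_free_polys n d"
  using assms by (auto simp: polys_of_degree_def square_multiples_def power_free_polys_def power_free_def dest: dvd_power_mono[where j = 2])

text \<open>Squarefree polynomials are power-free for every n \<ge> 2. What matters is only that the
  proportion stays away from 0 as d grows, so that errors relative to q^d are also small relative to
  this cardinality.\<close>

lemma card_power_free_polys_ge:
  assumes "n \<ge> 2" "d \<ge> 4"
  shows "real (card (power_free_polys n d :: 'a::{field,finite} poly set)) \<ge> real CARD('a) ^ d / real CARD('a) ^ 4"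
proof -
  let ?q = "real CARD('a)"
  have q: "?q \<ge> 2" using card_UNIV_field_ge2[where 'a='a] by simp
  have "?q ^ d / ?q ^ 4 \<le> (?q - 1) * ?q ^ d / ?q ^ 4"
    using q by (intro divide_right_mono) (auto simp: mult_le_cancel_right1)
  also have "\<dots> \<le> real (card (polys_of_degree d - square_multiples 0 d :: 'a poly set))"
    by (rule card_squarefree_ge[OF assms(2)])
  also have "\<dots> \<le> real (card (power_free_polys n d :: 'a poly set))"
    by (intro of_nat_mono card_mono squarefree_subset_power_free assms(1)) simp
  finally show ?thesis .
qed

section \<open>Residue classes modulo the product of all (x - a)^n, which is (x^q - x)^n\<close>

definition local_modulus :: "nat \<Rightarrow> 'a::{field,finite} poly" where
  "local_modulus n = (\<Prod>a\<in>UNIV. [:- a, 1:] ^ n)"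

lemma linear_power_dvd_local_modulus: "[:- a, 1:] ^ n dvd local_modulus n"
  unfolding local_modulus_def by (rule dvd_prodI) auto

lemma local_modulus_nonzero [simp]: "local_modulus n \<noteq> 0"
  by (simp add: local_modulus_def)

lemma degree_local_modulus: "degree (local_modulus n :: 'a::{field,finite} poly) = n * CARD('a)"
  unfolding local_modulus_def by (subst degree_prod_eq_sum_degree) (auto simp: degree_power_eq)

lemma local_modulus_dvd_iff:
  fixes f :: "'a::{field,finite} poly"
  shows "local_modulus n dvd f \<longleftrightarrow> (\<forall>a. [:- a, 1:] ^ n dvd f)"
proof
  assume *: "\<forall>a. [:- a, 1:] ^ n dvd f"
  have "(\<Prod>a\<in>A. [:- a, 1:] ^ n) dvd f" if "finite A" for A :: "'a set"
    using that
  proof (induction A rule: finite_induct)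
    case (insert a A)
    have "bezout ([:- a, 1:] ^ n) (\<Prod>b\<in>A. [:- b, 1:] ^ n)"
    proof (intro bezout_prod bezout_power)
      fix b assume "b \<in> A"
      with insert have "poly [:- a, 1:] b \<noteq> 0" by auto
      then show "bezout ([:- a, 1:] ^ n) [:- b, 1:]"
        by (intro bezout_sym[OF bezout_power] bezout_sym[OF bezout_linear])
    qed
    then show ?case using insert * by (simp add: bezout_mult_dvd)
  qed simp
  then show "local_modulus n dvd f" unfolding local_modulus_def by simp
qed (use linear_power_dvd_local_modulus dvd_trans in blast)

text \<open>Divisibility by (x - a)^n depends only on the residue, as (x - a)^n divides the modulus;
  by \<open>mod_local_modulus_admissible\<close> a power-free polynomial leaves no other
  residue.\<close>

definition admissible :: "nat \<Rightarrow> 'a::{field,finite} poly set" where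
  "admissible n = {r \<in> polys_below (n * CARD('a)). \<forall>a. \<not> [:- a, 1:] ^ n dvd r}"

lemma finite_admissible [simp]: "finite (admissible n)"
  by (simp add: admissible_def)

definition residue_class :: "nat \<Rightarrow> nat \<Rightarrow> 'a::{field,finite} poly \<Rightarrow> 'a poly set" where
  "residue_class n d r = {f \<in> power_free_polys n d. local_modulus n dvd f - r}"

text \<open>These are the divisors about which the residue says nothing: a g with a root a would
  make (x - a)^n divide f, which an admissible residue excludes. The bound \<open>J\<close> makes
  the set finite.\<close>

definition rootless_monic :: "nat \<Rightarrow> 'a::{field,finite} poly set" where
  "rootless_monic J = {g. lead_coeff g = 1 \<and> 0 < degree g \<and> degree g \<le> J \<and> (\<forall>a. poly g a \<noteq> 0)}"

lemma finite_rootless_monic [simp]: "finite (rootless_monic J :: 'a::{field,finite} poly set)"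
proof (rule finite_subset)
  show "rootless_monic J \<subseteq> (\<Union>j\<in>{..J}. monic_polys j :: 'a poly set)"
    by (auto simp: rootless_monic_def monic_polys_def)
qed simp

definition sieved_class :: "nat \<Rightarrow> nat \<Rightarrow> nat \<Rightarrow> 'a::{field,finite} poly \<Rightarrow> 'a poly set" where
  "sieved_class n J d r = {f \<in> polys_of_degree d. local_modulus n dvd f - r \<and> (\<forall>g\<in>rootless_monic J. \<not> g ^ n dvd f)}"

lemma finite_sieved_class [simp]: "finite (sieved_class n J d r)"
  by (simp add: sieved_class_def)

lemma finite_residue_class [simp]: "finite (residue_class n d r)"
  by (simp add: residue_class_def)

text \<open>By the Chinese remainder theorem there is a translation by a polynomial of bounded degree
  which moves the class of \<open>r\<close> to that of \<open>r'\<close> and respects divisibility by all the \<open>g ^ n\<close>.\<close>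

lemma card_sieved_class_le:
  fixes r r' :: "'a::{field,finite} poly"
  assumes "d \<ge> degree (local_modulus n * (\<Prod>g\<in>rootless_monic J. g ^ n) :: 'a poly)"
  shows "card (sieved_class n J d r) \<le> card (sieved_class n J d r')"
proof -
  define H :: "'a poly" where "H = local_modulus n"
  define G :: "'a poly" where "G = (\<Prod>g\<in>rootless_monic J. g ^ n)"
  have H0: "H \<noteq> 0" by (simp add: H_def)
  have rl: "poly g a \<noteq> 0" if "g \<in> rootless_monic J" for g and a :: 'a using that by (simp add: rootless_monic_def)
  then have Ga: "poly G a \<noteq> 0" for a by (simp add: G_def poly_prod)
  then have G0: "G \<noteq> 0" by auto
  have "bezout G H"
    unfolding H_def local_modulus_def
  proof (intro bezout_prod bezout_power)
    fix a :: 'a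
    show "bezout G [:- a, 1:]" using Ga by (rule bezout_linear)
  qed
  then obtain u v where uv: "u * G + v * H = 1" unfolding bezout_def by blast
  \<comment> \<open>\<open>u * G\<close> is 0 modulo \<open>G\<close> and 1 modulo \<open>H\<close>,
    so \<open>s0\<close> is congruent to r' - r modulo \<open>H\<close> and to 0 modulo
    \<open>G\<close>.\<close>
  define s0 where "s0 = (r' - r) * (u * G)"
  \<comment> \<open>Reduction makes the degree smaller than d, so that adding \<open>s\<close> does
    not change the degree of f.\<close>
  define s where "s = s0 mod (H * G)"
  have "H * G \<noteq> 0" using H0 G0 by simp
  then have "s \<in> polys_below (degree (H * G))"
    unfolding s_def using degree_mod_less[of "H * G" s0] by (auto simp: polys_below_iff)
  then have sd: "s \<in> polys_below d" using assms polys_below_mono unfolding H_def G_def by blast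
  have HG: "H * G dvd s0 - s" unfolding s_def by (simp add: minus_mod_eq_mult_div)
  have "s0 - (r' - r) = (r' - r) * (u * G + v * H) - (r' - r) - (r' - r) * v * H"
    unfolding s0_def by (simp add: algebra_simps)
  then have "H dvd s0 - (r' - r)" unfolding uv by simp
  moreover have "H dvd s0 - s" using HG dvd_mult_left by blast
  ultimately have "H dvd (s0 - (r' - r)) - (s0 - s)" by (rule dvd_diff)
  moreover have "(s0 - (r' - r)) - (s0 - s) = s - (r' - r)" by simp
  ultimately have Hs: "H dvd s - (r' - r)" by (simp only:)
  have gs: "g ^ n dvd s" if "g \<in> rootless_monic J" for g
  proof -
    have "g ^ n dvd G" unfolding G_def using that by (intro dvd_prodI) auto
    then have "g ^ n dvd s0" "g ^ n dvd s0 - s"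
      using HG unfolding s0_def by (simp_all add: dvd_mult) (metis dvd_mult_right dvd_trans)
    then have "g ^ n dvd s0 - (s0 - s)" by (rule dvd_diff)
    then show ?thesis by simp
  qed
  have "(\<lambda>f. f + s) ` sieved_class n J d r \<subseteq> sieved_class n J d r'"
  proof clarify
    fix f assume f: "f \<in> sieved_class n J d r"
    have "H dvd (f - r) + (s - (r' - r))" using f Hs unfolding sieved_class_def H_def by (intro dvd_add) auto
    then have "H dvd f + s - r'" by (simp add: algebra_simps)
    moreover have "\<not> g ^ n dvd f + s" if "g \<in> rootless_monic J" for g
      using f gs[OF that] that unfolding sieved_class_def by (simp add: dvd_add_left_iff)
    ultimately show "f + s \<in> sieved_class n J d r'"
      using f sd unfolding sieved_class_def H_def by (simp add: polys_of_degree_add)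
  qed
  then have "card ((\<lambda>f. f + s) ` sieved_class n J d r) \<le> card (sieved_class n J d r')"
    by (rule card_mono[OF finite_sieved_class])
  then show ?thesis by (simp add: card_image)
qed

lemma residue_class_subset: "residue_class n d r \<subseteq> sieved_class n J d r"
proof
  fix f assume f: "f \<in> residue_class n d r"
  then have pf: "power_free n f" by (simp add: residue_class_def power_free_polys_def)
  have "\<not> g ^ n dvd f" if "g \<in> rootless_monic J" for g
    using pf that unfolding power_free_def rootless_monic_def by blast
  then show "f \<in> sieved_class n J d r"
    using f power_free_polys_subset[of n d] by (auto simp: residue_class_def sieved_class_def)
qed

text \<open>If g^n divides an f that survived the sieve, g has no root because the residue is
  admissible, so its degree exceeds J; and n \<ge> 2 gives the square g^2.\<close>

lemma sieved_class_subset: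
  assumes "n \<ge> 2" "r \<in> admissible n"
  shows "sieved_class n J d r \<subseteq> residue_class n d r \<union> square_multiples J d"
proof
  fix f assume f: "f \<in> sieved_class n J d r"
  then have fd: "f \<in> polys_of_degree d" and Hr: "local_modulus n dvd f - r"
    and sv: "\<And>g. g \<in> rootless_monic J \<Longrightarrow> \<not> g ^ n dvd f" by (auto simp: sieved_class_def)
  show "f \<in> residue_class n d r \<union> square_multiples J d"
  proof (cases "power_free n f")
    case True
    with fd Hr show ?thesis by (auto simp: residue_class_def power_free_polys_def polys_of_degree_def)
  next
    case False
    then obtain g where g: "degree g > 0" "g ^ n dvd f" by (auto simp: power_free_def)
    have nr: "poly g a \<noteq> 0" for a
    proof
      assume "poly g a = 0"
      then have "[:- a, 1:] ^ n dvd g ^ n" by (intro dvd_power_same) (simp add: poly_eq_0_iff_dvd)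
      then have 1: "[:- a, 1:] ^ n dvd f" using g(2) dvd_trans by blast
      have "[:- a, 1:] ^ n dvd f - r" using Hr linear_power_dvd_local_modulus dvd_trans by blast
      from dvd_diff[OF 1 this] have "[:- a, 1:] ^ n dvd r" by simp
      with assms(2) show False by (auto simp: admissible_def)
    qed
    from g(1) have "g \<noteq> 0" by auto
    then obtain g' where g': "lead_coeff g' = 1" "degree g' = degree g" "g' ^ n dvd f" "\<forall>c. poly g' c \<noteq> 0"
      using g(2) nr by (elim monic_multiple) blast
    have "\<not> degree g \<le> J"
    proof
      assume "degree g \<le> J"
      with g g' have "g' \<in> rootless_monic J" by (simp add: rootless_monic_def)
      with sv g'(3) show False by blast
    qed
    moreover have "g ^ 2 dvd f" using g(2) assms(1) by (rule dvd_power_mono)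
    ultimately show ?thesis using fd by (auto simp: square_multiples_def)
  qed
qed

text \<open>The sieved classes of r and r' have the same size, by translating in both directions. A
  residue class differs from its sieved class only inside \<open>square_multiples\<close>.\<close>

lemma card_residue_class_diff:
  fixes r r' :: "'a::{field,finite} poly"
  assumes "n \<ge> 2" "r \<in> admissible n" "r' \<in> admissible n"
    and "d \<ge> degree (local_modulus n * (\<Prod>g\<in>rootless_monic J. g ^ n) :: 'a poly)"
  shows "\<bar>real (card (residue_class n d r)) - real (card (residue_class n d r'))\<bar> \<le> real CARD('a) ^ d / real CARD('a) ^ J"
proof -
  have *: "real (card (residue_class n d r)) \<le> real (card (residue_class n d r')) + real CARD('a) ^ d / real CARD('a) ^ J"
    if "r' \<in> admissible n" for r r' :: "'a poly"
  proof -
    have "card (residue_class n d r) \<le> card (sieved_class n J d r)"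
      by (intro card_mono residue_class_subset) simp
    also have "\<dots> \<le> card (sieved_class n J d r')" by (rule card_sieved_class_le[OF assms(4)])
    also have "\<dots> \<le> card (residue_class n d r' \<union> square_multiples J d)"
      by (intro card_mono sieved_class_subset assms that) simp
    also have "\<dots> \<le> card (residue_class n d r') + card (square_multiples J d :: 'a poly set)" by (rule card_Un_le)
    finally have "real (card (residue_class n d r)) \<le> real (card (residue_class n d r')) + real (card (square_multiples J d :: 'a poly set))"
      by (simp flip: of_nat_add)
    moreover have "real (card (square_multiples J d :: 'a poly set)) \<le> real CARD('a) ^ d / real CARD('a) ^ J"
      using card_square_multiples[of J d, where 'a='a] by simp
    ultimately show ?thesis by linarith
  qed
  from *[OF assms(2), of r'] *[OF assms(3), of r] show ?thesis by linarith
qed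

lemma mod_local_modulus_admissible:
  fixes f :: "'a::{field,finite} poly"
  assumes "power_free n f" "n > 0" shows "f mod local_modulus n \<in> admissible n"
proof -
  have "\<not> [:- a, 1:] ^ n dvd f mod local_modulus n" for a
  proof
    assume 1: "[:- a, 1:] ^ n dvd f mod local_modulus n"
    have "[:- a, 1:] ^ n dvd f" using 1 linear_power_dvd_local_modulus[of a n]
      by (metis dvd_mod_imp_dvd)
    with assms show False by (auto simp: power_free_def dest!: spec[of _ "[:- a, 1:]"])
  qed
  moreover have "f mod local_modulus n \<in> polys_below (n * CARD('a))"
    using degree_mod_less[of "local_modulus n :: 'a poly" f] by (auto simp: polys_below_iff degree_local_modulus)
  ultimately show ?thesis by (simp add: admissible_def)
qed

lemma residue_class_eq:
  assumes "r \<in> admissible n"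
  shows "residue_class n d r = {f \<in> power_free_polys n d. f mod local_modulus n = r}"
proof -
  have "local_modulus n dvd f - r \<longleftrightarrow> f mod local_modulus n = r" for f
  proof -
    have "r mod local_modulus n = r"
      using assms by (cases "r = 0") (auto simp: admissible_def polys_below_iff degree_local_modulus intro!: mod_poly_less)
    then show ?thesis by (simp add: mod_eq_dvd_iff[symmetric])
  qed
  then show ?thesis by (simp add: residue_class_def)
qed

lemma card_admissible_classes:
  fixes S :: "'a::{field,finite} poly \<Rightarrow> bool"
  assumes "n > 0"
  shows "card {f \<in> power_free_polys n d. S (f mod local_modulus n)} = (\<Sum>r\<in>{r \<in> admissible n. S r}. card (residue_class n d r))"
proof -
  have "{f \<in> power_free_polys n d. S (f mod local_modulus n)} = (\<Union>r\<in>{r \<in> admissible n. S r}. residue_class n d r)"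
    using mod_local_modulus_admissible[OF _ assms]
    by (auto simp: residue_class_eq) (auto simp: power_free_polys_def)
  also have "card \<dots> = (\<Sum>r\<in>{r \<in> admissible n. S r}. card (residue_class n d r))"
    by (rule card_UN_disjoint) (auto simp: residue_class_eq)
  finally show ?thesis .
qed

text \<open>Averaging: all power-free polynomials are distributed over the admissible classes, so if
  the class sizes differ pairwise by at most q^(d-J), each is close to the mean.\<close>

lemma residue_class_density:
  fixes r :: "'a::{field,finite} poly"
  assumes "n \<ge> 2" "r \<in> admissible n"
  shows "(\<lambda>d. real (card (residue_class n d r)) / real (card (power_free_polys n d :: 'a poly set)))
    \<longlonglongrightarrow> 1 / real (card (admissible n :: 'a poly set))"
proof (rule LIMSEQ_I)
  fix e :: real assume e: "e > 0"
  define q where "q = real CARD('a)"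
  have q: "q \<ge> 2" using card_UNIV_field_ge2[where 'a='a] by (simp add: q_def)
  define A where "A = (admissible n :: 'a poly set)"
  have A0: "real (card A) > 0" unfolding A_def using assms(2) card_gt_0_iff by fastforce
  \<comment> \<open>Here q^4 is the loss in \<open>card_power_free_polys_ge\<close> and q^J the gain
    from the tail estimate. \<open>J\<close> depends on \<open>e\<close> alone; d is chosen large
    afterwards.\<close>
  obtain J where J: "q ^ 4 / e < q ^ J" using real_arch_pow[of q] q by auto
  have J': "q ^ 4 / q ^ J < e" using J e q by (simp add: field_simps)
  define d0 where "d0 = max 4 (degree (local_modulus n * (\<Prod>g\<in>rootless_monic J. g ^ n) :: 'a poly))"
  show "\<exists>d0. \<forall>d\<ge>d0. norm (real (card (residue_class n d r)) / real (card (power_free_polys n d :: 'a poly set)) - 1 / real (card (admissible n :: 'a poly set))) < e"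
  proof (intro exI[of _ d0] allI impI)
    fix d assume d: "d \<ge> d0"
    define c where "c r' = real (card (residue_class n d r'))" for r' :: "'a poly"
    define F where "F = real (card (power_free_polys n d :: 'a poly set))"
    have F: "F = (\<Sum>r'\<in>A. c r')"
      using card_admissible_classes[of n d "\<lambda>_::'a poly. True"] assms(1) by (simp add: F_def A_def c_def)
    have Fge: "F \<ge> q ^ d / q ^ 4"
      unfolding F_def q_def using d by (intro card_power_free_polys_ge assms(1)) (auto simp: d0_def)
    then have F0: "F > 0" using q by (smt (verit) divide_pos_pos zero_less_power)
    have "\<bar>real (card A) * c r - F\<bar> = \<bar>\<Sum>r'\<in>A. (c r - c r')\<bar>" by (simp add: F sum_subtractf)
    also have "\<dots> \<le> (\<Sum>r'\<in>A. \<bar>c r - c r'\<bar>)" by (rule sum_abs)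
    also have "\<dots> \<le> (\<Sum>r'\<in>A. q ^ d / q ^ J)"
      unfolding c_def q_def using d by (intro sum_mono card_residue_class_diff assms) (auto simp: A_def d0_def)
    also have "\<dots> = real (card A) * (q ^ d / q ^ 4) * (q ^ 4 / q ^ J)" using q by simp
    also have "\<dots> \<le> real (card A) * F * (q ^ 4 / q ^ J)"
      using Fge A0 q by (intro mult_right_mono mult_left_mono) auto
    also have "\<dots> < real (card A) * F * e" using J' A0 F0 by (intro mult_strict_left_mono mult_pos_pos)
    finally have *: "\<bar>real (card A) * c r - F\<bar> < real (card A) * F * e" .
    have "c r / F - 1 / real (card A) = (real (card A) * c r - F) / (real (card A) * F)"
      using A0 F0 by (simp add: diff_divide_distrib)
    then have "\<bar>c r / F - 1 / real (card A)\<bar> = \<bar>real (card A) * c r - F\<bar> / (real (card A) * F)"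
      using A0 F0 by (simp add: abs_divide abs_mult)
    also have "\<dots> < e" using * A0 F0 by (simp add: pos_divide_less_eq mult.commute)
    finally show "norm (real (card (residue_class n d r)) / real (card (power_free_polys n d :: 'a poly set)) - 1 / real (card (admissible n :: 'a poly set))) < e"
      unfolding c_def F_def A_def by simp
  qed
qed

text \<open>Without a simple root there is a square factor g^2 with d \<le> 3 deg g, hence deg g >
  (d - 1) div 3. The subtraction of 1 yields the strict inequality demanded by
  \<open>square_multiples\<close>.\<close>

lemma no_simple_root_density:
  assumes "n \<ge> 2"
  shows "(\<lambda>d. real (card {f \<in> power_free_polys n d. \<not> has_simple_root (f :: 'a::{field,finite} poly)}) / real (card (power_free_polys n d :: 'a poly set))) \<longlonglongrightarrow> 0"
proof (rule tendsto_sandwich[OF always_eventually _ tendsto_const])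
  define q where "q = real CARD('a)"
  have q: "q \<ge> 2" using card_UNIV_field_ge2[where 'a='a] by (simp add: q_def)
  show "\<forall>d. 0 \<le> real (card {f \<in> power_free_polys n d. \<not> has_simple_root (f :: 'a poly)}) / real (card (power_free_polys n d :: 'a poly set))" by simp
  have "filterlim (\<lambda>d::nat. (d - 1) div 3) sequentially sequentially"
    by (rule filterlim_compose[OF filterlim_at_top_div_const_nat filterlim_minus_const_nat_at_top]) simp
  moreover have "(\<lambda>k. q ^ 4 * (1 / q) ^ k) \<longlonglongrightarrow> q ^ 4 * 0"
    using q by (intro tendsto_mult_left LIMSEQ_power_zero) auto
  ultimately show "(\<lambda>d. q ^ 4 * (1 / q) ^ ((d - 1) div 3)) \<longlonglongrightarrow> 0"
    using filterlim_compose by fastforce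
  show "\<forall>\<^sub>F d in sequentially. real (card {f \<in> power_free_polys n d. \<not> has_simple_root (f :: 'a poly)}) / real (card (power_free_polys n d :: 'a poly set)) \<le> q ^ 4 * (1 / q) ^ ((d - 1) div 3)"
    using eventually_ge_at_top[of 4]
  proof eventually_elim
    case (elim d)
    have "{f \<in> power_free_polys n d. \<not> has_simple_root (f :: 'a poly)} \<subseteq> (square_multiples ((d - 1) div 3) d :: 'a poly set)"
    proof
      fix f :: "'a poly" assume f: "f \<in> {f \<in> power_free_polys n d. \<not> has_simple_root (f :: 'a poly)}"
      then have fd: "f \<noteq> 0" "degree f = d" using power_free_polys_subset[of n d] by (auto simp: polys_of_degree_def)
      with f simple_root_or_square_factor[of f] obtain g where "g ^ 2 dvd f" "degree f \<le> 3 * degree g" by auto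
      moreover from this fd elim have "degree g > (d - 1) div 3" by linarith
      ultimately show "f \<in> square_multiples ((d - 1) div 3) d" using fd by (auto simp: square_multiples_def polys_of_degree_def)
    qed
    then have "real (card {f \<in> power_free_polys n d. \<not> has_simple_root (f :: 'a poly)}) \<le> real (card (square_multiples ((d - 1) div 3) d :: 'a poly set))"
      by (intro of_nat_mono card_mono) auto
    also have "\<dots> \<le> q ^ d / q ^ ((d - 1) div 3)" unfolding q_def using card_square_multiples[where 'a='a] by simp
    finally have 1: "real (card {f \<in> power_free_polys n d. \<not> has_simple_root (f :: 'a poly)}) \<le> q ^ d / q ^ ((d - 1) div 3)" .
    have 2: "q ^ d / q ^ 4 \<le> real (card (power_free_polys n d :: 'a poly set))"
      unfolding q_def by (rule card_power_free_polys_ge[OF assms elim])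
    have "real (card {f \<in> power_free_polys n d. \<not> has_simple_root (f :: 'a poly)}) / real (card (power_free_polys n d :: 'a poly set))
        \<le> (q ^ d / q ^ ((d - 1) div 3)) / (q ^ d / q ^ 4)"
      by (rule frac_le[OF _ 1 _ 2]) (use q in auto)
    also have "\<dots> = q ^ 4 * (1 / q) ^ ((d - 1) div 3)" using q by (simp add: power_divide)
    finally show ?case .
  qed
qed

text \<open>Replacing \<open>Q \<and> C\<close> by a condition on the residue, and \<open>Q\<close>
  by truth, changes the counts only on polynomials without a simple root. So a global condition like
  irreducibility leaves the limit unaffected.\<close>

theorem power_free_local_density:
  fixes Q C S :: "'a::{field,finite} poly \<Rightarrow> bool"
  assumes n: "n \<ge> 2"
    and Q: "\<And>f. f \<noteq> 0 \<Longrightarrow> has_simple_root f \<Longrightarrow> Q f"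
    and C: "\<And>f. power_free n f \<Longrightarrow> has_simple_root f \<Longrightarrow> C f \<longleftrightarrow> S (f mod local_modulus n)"
  shows "(\<lambda>d. real (card {f \<in> power_free_polys n d. Q f \<and> C f}) / real (card {f \<in> power_free_polys n d. Q f}))
    \<longlonglongrightarrow> real (card {r \<in> admissible n. S r}) / real (card (admissible n :: 'a poly set))"
proof -
  define F where "F d = (power_free_polys n d :: 'a poly set)" for d
  define B where "B d = {f \<in> F d. \<not> has_simple_root f}" for d
  have finF [simp]: "finite (F d)" for d by (simp add: F_def)
  have B0: "(\<lambda>d. real (card (B d)) / real (card (F d))) \<longlonglongrightarrow> 0"
    unfolding B_def F_def by (rule no_simple_root_density[OF n])
  have approx: "(\<lambda>d. real (card {f \<in> F d. P f}) / real (card (F d))) \<longlonglongrightarrow> L"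
    if "\<And>f. power_free n f \<Longrightarrow> has_simple_root f \<Longrightarrow> P f \<longleftrightarrow> P' f"
      "(\<lambda>d. real (card {f \<in> F d. P' f}) / real (card (F d))) \<longlonglongrightarrow> L" for P P' L
  proof -
    have le: "card {f \<in> F d. P f} \<le> card {f \<in> F d. P' f} + card (B d)" if "\<And>f. power_free n f \<Longrightarrow> has_simple_root f \<Longrightarrow> P f \<longleftrightarrow> P' f" for P P' d
    proof -
      have "{f \<in> F d. P f} \<subseteq> {f \<in> F d. P' f} \<union> B d" using that by (auto simp: B_def F_def power_free_polys_def)
      then have "card {f \<in> F d. P f} \<le> card ({f \<in> F d. P' f} \<union> B d)" by (rule card_mono[rotated]) (simp add: B_def)
      also have "\<dots> \<le> card {f \<in> F d. P' f} + card (B d)" by (rule card_Un_le)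
      finally show ?thesis .
    qed
    have "(\<lambda>d. real (card {f \<in> F d. P f}) / real (card (F d)) - real (card {f \<in> F d. P' f}) / real (card (F d))) \<longlonglongrightarrow> 0"
    proof (rule Lim_null_comparison[OF always_eventually B0], rule allI)
      fix d
      have "\<bar>real (card {f \<in> F d. P f}) - real (card {f \<in> F d. P' f})\<bar> \<le> real (card (B d))"
        using le[of P P' d] le[of P' P d] that(1) by (force simp: abs_le_iff)
      then show "norm (real (card {f \<in> F d. P f}) / real (card (F d)) - real (card {f \<in> F d. P' f}) / real (card (F d))) \<le> real (card (B d)) / real (card (F d))"
        by (simp add: divide_right_mono abs_divide flip: diff_divide_distrib)
    qed
    from tendsto_add[OF this that(2)] show ?thesis by simp
  qed
  have S: "(\<lambda>d. real (card {f \<in> F d. S (f mod local_modulus n)}) / real (card (F d)))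
      \<longlonglongrightarrow> (\<Sum>r\<in>{r \<in> admissible n. S r}. 1 / real (card (admissible n :: 'a poly set)))"
    unfolding F_def using n
    by (simp add: card_admissible_classes sum_divide_distrib del: sum_constant)
       (intro tendsto_sum residue_class_density, auto)
  have N: "(\<lambda>d. real (card {f \<in> F d. Q f \<and> C f}) / real (card (F d)))
      \<longlonglongrightarrow> real (card {r \<in> admissible n. S r}) / real (card (admissible n :: 'a poly set))"
  proof (rule approx)
    show "(\<lambda>d. real (card {f \<in> F d. S (f mod local_modulus n)}) / real (card (F d)))
      \<longlonglongrightarrow> real (card {r \<in> admissible n. S r}) / real (card (admissible n :: 'a poly set))"
      using S by simp
    show "(Q f \<and> C f) = S (f mod local_modulus n)" if "power_free n f" "has_simple_root f" for f
      using Q[OF power_free_not_0] C that by blast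
  qed
  have Fpos: "\<forall>\<^sub>F d in sequentially. card (F d) > 0"
    using eventually_ge_at_top[of 4]
  proof eventually_elim
    case (elim d)
    have "real CARD('a) ^ d / real CARD('a) ^ 4 > 0" using card_UNIV_field_ge2[where 'a='a] by simp
    also have "\<dots> \<le> real (card (F d))" unfolding F_def by (rule card_power_free_polys_ge[OF n elim])
    finally show ?case by simp
  qed
  have one: "(\<lambda>d. real (card {f \<in> F d. True}) / real (card (F d))) \<longlonglongrightarrow> 1"
    by (rule tendsto_eventually) (use Fpos in eventually_elim, auto simp: card_gt_0_iff)
  have D: "(\<lambda>d. real (card {f \<in> F d. Q f}) / real (card (F d))) \<longlonglongrightarrow> 1"
    using approx[OF _ one, of Q] Q power_free_not_0 by blast
  \<comment> \<open>Both counts are measured against all of \<open>F d\<close>, which cancels as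
    soon as it is nonempty.\<close>
  have "(\<lambda>d. (real (card {f \<in> F d. Q f \<and> C f}) / real (card (F d))) / (real (card {f \<in> F d. Q f}) / real (card (F d))))
      \<longlonglongrightarrow> real (card {r \<in> admissible n. S r}) / real (card (admissible n :: 'a poly set)) / 1"
    by (rule tendsto_divide[OF N D]) simp
  then show ?thesis
    unfolding div_by_1
    by (rule Lim_transform_eventually) (use Fpos in eventually_elim, simp add: F_def)
qed

section \<open>Jets at the rational points: truncated Taylor expansions, moved to the origin\<close>

definition jet :: "nat \<Rightarrow> 'a::comm_ring_1 \<Rightarrow> 'a poly \<Rightarrow> 'a poly" where
  "jet n a f = poly_cutoff n (pcompose f [:a, 1:])"

lemma jet_mem: "jet n a f \<in> polys_below n"
  by (simp add: jet_def polys_below_def coeff_poly_cutoff)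

lemma jet_diff: "jet n a (f - g) = jet n a f - jet n a g"
  by (simp add: jet_def poly_eq_iff coeff_poly_cutoff pcompose_diff)

lemma pcompose_shift_inverse: "pcompose (pcompose f [:a, 1:]) [:- a, 1:] = (f :: 'a::comm_ring_1 poly)"
  by (simp add: pcompose_pCons flip: pcompose_assoc)

lemma pcompose_linear_power: "pcompose ([:- a, 1:] ^ n) [:a, 1:] = monom 1 n"
  for a :: "'a::comm_ring_1"
proof -
  have "pcompose ([:- a, 1:] ^ n) [:a, 1:] = (pcompose [:- a, 1:] [:a, 1:]) ^ n"
    by (rule type_ring_hom.hom_power[OF type_ring_hom_pcompose])
  also have "pcompose [:- a, 1:] [:a, 1:] = monom 1 1" by (simp add: pcompose_pCons monom_Suc)
  finally show ?thesis by (simp add: monom_power)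
qed

lemma linear_power_dvd_iff_monom_dvd:
  fixes f :: "'a::comm_ring_1 poly"
  shows "[:- a, 1:] ^ n dvd f \<longleftrightarrow> monom 1 n dvd pcompose f [:a, 1:]"
proof
  assume "[:- a, 1:] ^ n dvd f"
  then show "monom 1 n dvd pcompose f [:a, 1:]"
    using type_ring_hom.hom_dvd[OF type_ring_hom_pcompose] pcompose_linear_power by metis
next
  assume "monom 1 n dvd pcompose f [:a, 1:]"
  then have "pcompose (monom 1 n) [:- a, 1:] dvd pcompose (pcompose f [:a, 1:]) [:- a, 1:]"
    by (rule type_ring_hom.hom_dvd[OF type_ring_hom_pcompose])
  then have "pcompose (pcompose ([:- a, 1:] ^ n) [:a, 1:]) [:- a, 1:] dvd f"
    by (simp only: pcompose_linear_power pcompose_shift_inverse)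
  then show "[:- a, 1:] ^ n dvd f" by (simp only: pcompose_shift_inverse)
qed

lemma linear_power_dvd_iff_jet:
  fixes f :: "'a::comm_ring_1 poly"
  shows "[:- a, 1:] ^ n dvd f \<longleftrightarrow> jet n a f = 0"
  unfolding linear_power_dvd_iff_monom_dvd monom_1_dvd_iff' jet_def
  by (simp add: poly_eq_iff coeff_poly_cutoff)

lemma jet_mod_local_modulus: "jet n a (f mod local_modulus n) = jet n a f"
proof -
  have "local_modulus n dvd f - f mod local_modulus n" by (simp add: minus_mod_eq_mult_div)
  then have "jet n a (f - f mod local_modulus n) = 0"
    using linear_power_dvd_local_modulus dvd_trans linear_power_dvd_iff_jet by blast
  then show ?thesis by (simp add: jet_diff)
qed

text \<open>The Chinese remainder theorem without interpolation: the degree bound gives injectivity,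
  and both sides have q^(n q) elements.\<close>

lemma bij_betw_jets:
  "bij_betw (\<lambda>r a. jet n a r) (polys_below (n * CARD('a))) ((UNIV :: 'a set) \<rightarrow>\<^sub>E (polys_below n :: 'a::{field,finite} poly set))"
proof -
  let ?f = "\<lambda>r a. jet n a r :: 'a poly"
  have inj: "inj_on ?f (polys_below (n * CARD('a)))"
  proof (rule inj_onI)
    fix r s :: "'a poly" assume rs: "r \<in> polys_below (n * CARD('a))" "s \<in> polys_below (n * CARD('a))" "?f r = ?f s"
    then have "jet n a (r - s) = 0" for a by (simp add: jet_diff fun_eq_iff)
    then have "local_modulus n dvd r - s"
      unfolding local_modulus_dvd_iff linear_power_dvd_iff_jet by blast
    moreover have "r - s = 0 \<or> degree (r - s) < degree (local_modulus n :: 'a poly)"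
      using polys_below_diff[OF rs(1,2)] by (simp add: polys_below_iff degree_local_modulus)
    ultimately show "r = s" using dvd_imp_degree_le by (metis eq_iff_diff_eq_0 not_le)
  qed
  have sub: "?f ` polys_below (n * CARD('a)) \<subseteq> (UNIV :: 'a set) \<rightarrow>\<^sub>E polys_below n" by (auto simp: jet_mem)
  have "card (?f ` polys_below (n * CARD('a))) = card ((UNIV :: 'a set) \<rightarrow>\<^sub>E (polys_below n :: 'a poly set))"
    unfolding card_image[OF inj] by (subst card_PiE) (simp_all add: card_polys_below power_mult)
  then have "?f ` polys_below (n * CARD('a)) = (UNIV :: 'a set) \<rightarrow>\<^sub>E polys_below n"
    using sub by (intro card_subset_eq) (auto intro: finite_PiE)
  with inj show ?thesis by (simp add: bij_betw_def)
qed

text \<open>Independence in its counting form: conditions imposed at each point separately multiply,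
  because jets can be prescribed independently.\<close>

lemma card_admissible_local:
  fixes C :: "'a::{field,finite} \<Rightarrow> 'a poly \<Rightarrow> bool"
  shows "card {r \<in> admissible n. \<forall>a. C a (jet n a r)} = (\<Prod>a\<in>UNIV. card {v \<in> polys_below n. v \<noteq> 0 \<and> C a v})"
proof -
  let ?f = "\<lambda>r a. jet n a r :: 'a poly"
  have "{r \<in> admissible n. \<forall>a. C a (jet n a r)} = {r \<in> polys_below (n * CARD('a)). ?f r \<in> (\<Pi>\<^sub>E a\<in>UNIV. {v \<in> polys_below n. v \<noteq> 0 \<and> C a v})}"
    by (auto simp: admissible_def linear_power_dvd_iff_jet jet_mem PiE_iff)
  also have "bij_betw ?f \<dots> (\<Pi>\<^sub>E a\<in>UNIV. {v \<in> polys_below n. v \<noteq> 0 \<and> C a v})"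
  proof (rule bij_betw_subset[OF bij_betw_jets])
    show "?f ` {r \<in> polys_below (n * CARD('a)). ?f r \<in> (\<Pi>\<^sub>E a\<in>UNIV. {v \<in> polys_below n. v \<noteq> 0 \<and> C a v})} = (\<Pi>\<^sub>E a\<in>UNIV. {v \<in> polys_below n. v \<noteq> 0 \<and> C a v})"
    proof (intro equalityI subsetI)
      fix \<phi> assume \<phi>: "\<phi> \<in> (\<Pi>\<^sub>E a\<in>UNIV. {v \<in> polys_below n. v \<noteq> 0 \<and> C a v})"
      then have "\<phi> \<in> UNIV \<rightarrow>\<^sub>E polys_below n" by (auto simp: PiE_iff)
      then obtain r where "r \<in> polys_below (n * CARD('a))" "\<phi> = ?f r"
        using bij_betw_imp_surj_on[OF bij_betw_jets[where n=n and 'a='a]] by (metis (no_types, lifting) imageE)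
      with \<phi> show "\<phi> \<in> ?f ` {r \<in> polys_below (n * CARD('a)). ?f r \<in> (\<Pi>\<^sub>E a\<in>UNIV. {v \<in> polys_below n. v \<noteq> 0 \<and> C a v})}" by blast
    qed blast
  qed auto
  ultimately show ?thesis by (simp add: bij_betw_same_card card_PiE)
qed

text \<open>A nonzero jet is uniquely x^s (u + x w) with u \<noteq> 0, and w has n - 1 - s free
  coefficients.\<close>

lemma card_jets_by_order:
  fixes P :: "nat \<Rightarrow> 'a::{field,finite} \<Rightarrow> bool"
  shows "card {v \<in> polys_below n. v \<noteq> 0 \<and> P (order 0 v) (coeff v (order 0 v))}
    = (\<Sum>s<n. CARD('a) ^ (n - 1 - s) * card {u. u \<noteq> 0 \<and> P s u})"
proof -
  note mult_pCons_right [simp del]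
  let ?I = "SIGMA s:{..<n}. {u. u \<noteq> 0 \<and> P s u} \<times> (polys_below (n - 1 - s) :: 'a poly set)"
  let ?g = "\<lambda>(s, u, w). monom 1 s * pCons u w :: 'a poly"
  have ord: "order 0 (monom 1 s * pCons u w) = s" if "u \<noteq> 0" for s and u :: 'a and w
  proof -
    have "monom 1 s * pCons u w \<noteq> 0"
      using that by (simp only: mult_eq_0_iff monom_eq_0_iff pCons_eq_0_iff) simp
    then have "order 0 (monom 1 s * pCons u w) = order 0 (monom (1 :: 'a) s) + order 0 (pCons u w)"
      by (rule order_mult)
    then show ?thesis using that by (simp add: order_0I)
  qed
  have cf: "coeff (monom 1 s * pCons u w) s = u" for s and u :: 'a and w
    by (simp add: coeff_monom_mult)
  have "{v \<in> polys_below n. v \<noteq> 0 \<and> P (order 0 v) (coeff v (order 0 v))} = ?g ` ?I"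
  proof (intro equalityI subsetI)
    fix v assume v: "v \<in> {v \<in> polys_below n. v \<noteq> 0 \<and> P (order 0 v) (coeff v (order 0 v))}"
    define s where "s = order 0 v"
    have "monom 1 s dvd v" using v monom_1_dvd_iff[of v s] by (simp add: s_def)
    then obtain w' where w': "v = monom 1 s * w'" by blast
    obtain u w where uw: "w' = pCons u w" by (cases w')
    have cu: "coeff v s = u" unfolding w' uw by (rule cf)
    have "u \<noteq> 0"
    proof
      assume "u = 0"
      then have "v = monom 1 (Suc s) * w" unfolding w' uw
        by (simp add: monom_Suc mult_pCons_right)
      then have "monom 1 (Suc s) dvd v" by simp
      then show False using v monom_1_dvd_iff[of v "Suc s"] by (simp add: s_def)
    qed
    have w0: "coeff w i = coeff v (s + Suc i)" for i unfolding w' uw by (simp add: coeff_monom_mult)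
    have sn: "s < n"
      using v \<open>u \<noteq> 0\<close> cu by (auto simp: polys_below_def) (metis not_le)
    have wn: "w \<in> polys_below (n - 1 - s)"
      using v by (auto simp: polys_below_def w0)
    have "P s u" using v cu by (simp add: s_def)
    with sn wn \<open>u \<noteq> 0\<close> have 2: "(s, u, w) \<in> ?I" by simp
    have 1: "v = ?g (s, u, w)" by (simp only: w' uw prod.case)
    show "v \<in> ?g ` ?I" by (subst 1) (rule imageI[OF 2])
  next
    fix v assume "v \<in> ?g ` ?I"
    then obtain s u w where v: "v = monom 1 s * pCons u w" "s < n" "u \<noteq> 0" "P s u" "w \<in> polys_below (n - 1 - s)" by auto
    then have "v \<in> polys_below n"
      by (auto simp: polys_below_def coeff_monom_mult coeff_pCons split: nat.split)
    with v show "v \<in> {v \<in> polys_below n. v \<noteq> 0 \<and> P (order 0 v) (coeff v (order 0 v))}"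
      by (simp add: ord cf)
  qed
  moreover have "inj_on ?g ?I"
  proof (rule inj_onI)
    fix t t' assume t: "t \<in> ?I" "t' \<in> ?I" and e: "?g t = ?g t'"
    obtain s u w where 1: "t = (s, u, w)" "u \<noteq> 0" using t(1) by auto
    obtain s' u' w' where 2: "t' = (s', u', w')" "u' \<noteq> 0" using t(2) by auto
    have e': "monom 1 s * pCons u w = monom 1 s' * pCons u' w'" using e by (simp only: 1(1) 2(1) prod.case)
    then have "s = s'" using ord[OF 1(2), of s w] ord[OF 2(2), of s' w'] by simp
    with e' have "pCons u w = pCons u' w'" by (simp add: monom_eq_0_iff)
    then show "t = t'" using \<open>s = s'\<close> by (simp add: 1 2)
  qed
  ultimately have "card {v \<in> polys_below n. v \<noteq> 0 \<and> P (order 0 v) (coeff v (order 0 v))} = card ?I"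
    by (simp add: card_image)
  also have "\<dots> = (\<Sum>s<n. card ({u. u \<noteq> 0 \<and> P s u} \<times> (polys_below (n - 1 - s) :: 'a poly set)))"
    by (subst card_SigmaI) auto
  finally show ?thesis by (simp add: card_cartesian_product card_polys_below mult.commute)
qed

lemma jet_order:
  fixes f u :: "'a::{field,finite} poly"
  assumes "f = [:- a, 1:] ^ s * u" "poly u a \<noteq> 0" "s < n"
  shows "jet n a f \<noteq> 0" "order 0 (jet n a f) = s" "coeff (jet n a f) s = poly u a"
proof -
  define w where "w = pcompose u [:a, 1:]"
  have f: "pcompose f [:a, 1:] = monom 1 s * w"
    unfolding assms(1) w_def pcompose_mult pcompose_linear_power ..
  have w0: "coeff w 0 = poly u a" unfolding w_def by (simp add: poly_0_coeff_0[symmetric] poly_pcompose)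
  have c: "coeff (jet n a f) i = (if i < n \<and> s \<le> i then coeff w (i - s) else 0)" for i
    by (auto simp: jet_def coeff_poly_cutoff f coeff_monom_mult)
  show cs: "coeff (jet n a f) s = poly u a" using assms(3) by (simp add: c w0)
  with assms(2) show nz: "jet n a f \<noteq> 0" by auto
  have "monom 1 s dvd jet n a f" unfolding monom_1_dvd_iff' by (simp add: c)
  moreover have "\<not> monom 1 (Suc s) dvd jet n a f" unfolding monom_1_dvd_iff' using cs assms(2) by auto
  ultimately show "order 0 (jet n a f) = s"
    using nz monom_1_dvd_iff[of "jet n a f"] by (metis le_antisym not_less_eq_eq)
qed

section \<open>The number of roots of a constant\<close>

definition root_count :: "nat \<Rightarrow> 'a::{field,finite} \<Rightarrow> nat" where
  "root_count e c = card {z. z ^ e = c}"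

lemma power_card_minus_one:
  fixes z :: "'a::{field,finite}"
  assumes "z \<noteq> 0" shows "z ^ (CARD('a) - 1) = 1"
proof -
  have "(\<Prod>y\<in>UNIV - {0}. z * y) = z ^ (CARD('a) - 1) * (\<Prod>y\<in>UNIV - {0}. y)"
    by (simp add: prod.distrib card_Diff_singleton)
  moreover have "(\<Prod>y\<in>UNIV - {0}. z * y) = (\<Prod>y\<in>UNIV - {0}. y)"
    by (rule prod.reindex_bij_witness[of _ "\<lambda>y. y / z" "\<lambda>y. z * y"]) (use assms in auto)
  ultimately show ?thesis by simp
qed

lemma power_eq_1_gcd:
  fixes z :: "'a::{field,finite}"
  assumes "e > 0"
  shows "z ^ e = 1 \<longleftrightarrow> z ^ gcd e (CARD('a) - 1) = 1"
proof
  assume z: "z ^ e = 1"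
  then have "z \<noteq> 0" using assms by (auto simp: power_0_left)
  obtain x y where "e * x = (CARD('a) - 1) * y + gcd e (CARD('a) - 1)"
    using bezout_nat[of e "CARD('a) - 1"] assms by auto
  then have "z ^ (e * x) = z ^ ((CARD('a) - 1) * y) * z ^ gcd e (CARD('a) - 1)"
    by (simp add: power_add)
  then show "z ^ gcd e (CARD('a) - 1) = 1"
    unfolding power_mult z power_card_minus_one[OF \<open>z \<noteq> 0\<close>] by simp
next
  assume "z ^ gcd e (CARD('a) - 1) = 1"
  then show "z ^ e = 1" by (metis dvd_def gcd_dvd1 power_mult power_one)
qed

lemma card_roots_of_unity_le:
  assumes "e > 0" shows "card {z::'a::field. z ^ e = 1} \<le> e"
proof -
  let ?p = "monom 1 e + (- 1) :: 'a poly"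
  have d: "degree ?p = e" using assms by (subst degree_add_eq_left) (auto simp: degree_monom_eq)
  then have "?p \<noteq> 0" using assms by auto
  then have "card {z. poly ?p z = 0} \<le> degree ?p" by (rule card_poly_roots_bound)
  then show ?thesis unfolding d by (simp add: poly_monom)
qed

text \<open>Write q - 1 = e' l with e' the gcd. A unit that is not an e'th root of unity is a root
  of 1 + X^e' + ... + X^(e' (l-1)). The two degree bounds e' and e' (l - 1) add up to q - 1, so both
  are attained; no generator of the unit group is required.\<close>

lemma card_roots_of_unity:
  assumes "e > 0"
  shows "card {z::'a::{field,finite}. z ^ e = 1} = gcd e (CARD('a) - 1)"
proof -
  let ?N = "CARD('a) - 1"
  have N0: "?N > 0" using card_UNIV_field_ge2[where 'a='a] by simp
  define e' where "e' = gcd e ?N"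
  have e'0: "e' > 0" using assms by (simp add: e'_def)
  obtain l where l: "?N = e' * l" unfolding e'_def by (meson dvdE gcd_dvd2)
  have l0: "l > 0" using l N0 by (cases l) auto
  let ?R = "{z::'a. z ^ e' = 1}"
  let ?p = "\<Sum>i<l. monom 1 (e' * i) :: 'a poly"
  have "UNIV - {0} - ?R \<subseteq> {z. poly ?p z = 0}"
  proof
    fix z assume z: "z \<in> UNIV - {0} - ?R"
    have "(z ^ e' - 1) * (\<Sum>i<l. (z ^ e') ^ i) = (z ^ e') ^ l - 1"
      by (simp add: power_diff_1_eq)
    also have "\<dots> = 0" using power_card_minus_one[of z] z unfolding l power_mult by simp
    finally have "(\<Sum>i<l. (z ^ e') ^ i) = 0" using z by simp
    then show "z \<in> {z. poly ?p z = 0}" by (simp add: poly_sum poly_monom power_mult)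
  qed
  moreover have "card {z. poly ?p z = 0} \<le> e' * (l - 1)"
  proof -
    have "coeff ?p 0 = (\<Sum>i<l. if i = 0 then 1 else 0)"
      unfolding coeff_sum using e'0 by (intro sum.cong) auto
    also have "\<dots> = 1" using l0 by simp
    finally have "?p \<noteq> 0" by auto
    then have "card {z. poly ?p z = 0} \<le> degree ?p" by (rule card_poly_roots_bound)
    also have "degree ?p \<le> e' * (l - 1)"
    proof (rule degree_sum_le)
      fix i assume "i \<in> {..<l}"
      then have "e' * i \<le> e' * (l - 1)" by auto
      then show "degree (monom 1 (e' * i) :: 'a poly) \<le> e' * (l - 1)" by (simp add: degree_monom_eq)
    qed simp
    finally show ?thesis .
  qed
  ultimately have "card (UNIV - {0} - ?R) \<le> e' * (l - 1)"
    by (meson card_mono finite le_trans)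
  moreover have "card (UNIV - {0} - ?R) = ?N - card ?R"
    using e'0 by (subst card_Diff_subset) (auto simp: card_Diff_singleton power_0_left)
  moreover have "card ?R \<le> e'" by (rule card_roots_of_unity_le[OF e'0])
  ultimately have "card ?R = e'" using l l0 by (cases l) auto
  then show ?thesis using power_eq_1_gcd[OF assms, where 'a='a] by (simp add: e'_def)
qed

lemma root_count_unit:
  fixes y :: "'a::{field,finite}"
  assumes "e > 0" "y \<noteq> 0"
  shows "root_count e (y ^ e) = gcd e (CARD('a) - 1)"
proof -
  have "bij_betw (\<lambda>z. y * z) {z. z ^ e = 1} {z. z ^ e = y ^ e}"
    by (rule bij_betw_byWitness[of _ "\<lambda>z. z / y"]) (use assms in \<open>auto simp: power_mult_distrib power_divide\<close>)
  then show ?thesis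
    by (simp add: root_count_def bij_betw_same_card[symmetric] card_roots_of_unity assms)
qed

lemma root_count_values:
  fixes u :: "'a::{field,finite}"
  assumes "e > 0" "u \<noteq> 0"
  shows "root_count e u = (if u \<in> (\<lambda>z. z ^ e) ` (UNIV - {0}) then gcd e (CARD('a) - 1) else 0)"
proof (cases "u \<in> (\<lambda>z. z ^ e) ` (UNIV - {0})")
  case True
  then show ?thesis using root_count_unit[OF assms(1)] by auto
next
  case False
  then have "{z. z ^ e = u} = {}" using assms by (auto simp: zero_power)
  with False show ?thesis by (simp add: root_count_def)
qed

lemma card_unit_powers:
  assumes "e > 0"
  shows "gcd e (CARD('a) - 1) * card ((\<lambda>z. z ^ e) ` (UNIV - {0}) :: 'a::{field,finite} set) = CARD('a) - 1"
proof -
  let ?V = "(\<lambda>z. z ^ e) ` (UNIV - {0}) :: 'a set"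
  have "UNIV - {0 :: 'a} = (\<Union>v\<in>?V. {z. z ^ e = v})" using assms by (auto simp: power_0_left)
  then have "card (UNIV - {0 :: 'a}) = card (\<Union>v\<in>?V. {z. z ^ e = v})" by simp
  also have "\<dots> = (\<Sum>v\<in>?V. card {z. z ^ e = v})" by (rule card_UN_disjoint) auto
  also have "\<dots> = (\<Sum>v\<in>?V. gcd e (CARD('a) - 1))"
  proof (rule sum.cong[OF refl])
    fix v assume "v \<in> ?V"
    then show "card {z. z ^ e = v} = gcd e (CARD('a) - 1)"
      using root_count_unit[OF assms] unfolding root_count_def by blast
  qed
  finally show ?thesis by (simp add: card_Diff_singleton mult.commute)
qed

text \<open>A share 1/g of the units are eth powers with g roots each, and the others have none. The
  values 0 and g never coincide, since g > 0.\<close>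

lemma card_root_count:
  assumes "e > 0"
  defines "g \<equiv> real (gcd e (CARD('a::{field,finite}) - 1))"
  shows "real (card {u::'a. u \<noteq> 0 \<and> int (root_count e u) = k}) =
    (real CARD('a) - 1) * ((if k = 0 then 1 - 1 / g else 0) + (if real_of_int k = g then 1 / g else 0))"
proof -
  let ?V = "(\<lambda>z. z ^ e) ` (UNIV - {0}) :: 'a set"
  have g0: "g > 0" unfolding g_def using assms by simp
  have q: "real (CARD('a) - 1) = real CARD('a) - 1" using card_UNIV_field_ge2[where 'a='a] by (simp add: of_nat_diff)
  have "g * real (card ?V) = real CARD('a) - 1"
    unfolding g_def q[symmetric] of_nat_mult[symmetric] card_unit_powers[OF assms(1)] ..
  then have V: "real (card ?V) = (real CARD('a) - 1) / g" using g0 by (simp add: field_simps)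
  have sub: "?V \<subseteq> UNIV - {0}" by auto
  have cU: "card (UNIV - {0 :: 'a}) = CARD('a) - 1" by (simp add: card_Diff_singleton)
  have rc: "root_count e u = (if u \<in> ?V then gcd e (CARD('a) - 1) else 0)" if "u \<noteq> 0" for u :: 'a
    by (rule root_count_values[OF assms(1) that])
  consider "k = 0" | "real_of_int k = g" "k \<noteq> 0" | "k \<noteq> 0" "real_of_int k \<noteq> g" by blast
  then show ?thesis
  proof cases
    case 1
    have "{u::'a. u \<noteq> 0 \<and> int (root_count e u) = k} = UNIV - {0} - ?V"
      using assms(1) by (auto simp: rc 1 split: if_splits)
    then have "real (card {u::'a. u \<noteq> 0 \<and> int (root_count e u) = k}) = real (CARD('a) - 1) - real (card ?V)"
      using card_mono[OF _ sub] by (simp only: card_Diff_subset[OF finite sub] cU of_nat_diff finite)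
    then show ?thesis using g0 1 unfolding V q by (simp add: right_diff_distrib)
  next
    case 2
    have "{u::'a. u \<noteq> 0 \<and> int (root_count e u) = k} = ?V"
      using 2 sub by (auto simp: rc g_def split: if_splits)
    then show ?thesis using 2 V by simp
  next
    case 3
    have "{u::'a. u \<noteq> 0 \<and> int (root_count e u) = k} = {}"
      using 3 by (auto simp: rc g_def split: if_splits)
    then show ?thesis using 3 by simp
  qed
qed

lemma iid_with_law_prob:
  assumes "iid_with_law M I U law" "finite I" "I \<noteq> {}"
  shows "measure M {w \<in> space M. \<forall>i\<in>I. U i w = k i} = (\<Prod>i\<in>I. law (k i))"
proof -
  interpret prob_space M using assms(1) by (simp add: iid_with_law_def)
  have ind: "indep_vars (\<lambda>_. count_space UNIV) U I" and law: "\<And>j v. j \<in> I \<Longrightarrow> prob {w \<in> space M. U j w = v} = law v"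
    using assms(1) by (auto simp: iid_with_law_def)
  have "{w \<in> space M. \<forall>i\<in>I. U i w = k i} = (\<Inter>i\<in>I. U i -` {k i} \<inter> space M)"
    using assms(3) by auto
  also have "prob \<dots> = (\<Prod>i\<in>I. prob (U i -` {k i} \<inter> space M))"
    by (rule indep_varsD[OF ind assms(3,2) order_refl]) auto
  also have "\<dots> = (\<Prod>i\<in>I. law (k i))"
  proof (rule prod.cong[OF refl])
    fix i assume "i \<in> I"
    have "U i -` {k i} \<inter> space M = {w \<in> space M. U i w = k i}" by auto
    then show "prob (U i -` {k i} \<inter> space M) = law (k i)" using law[OF \<open>i \<in> I\<close>] by simp
  qed
  finally show ?thesis .
qed

section \<open>Integral elements of a field\<close>

text \<open>Counterpart of \<open>integral_over\<close> with polynomials instead of lists;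
  \<open>integral_over_\<phi>\<close> relates the two.\<close>

definition integral_elem :: "'o::field set \<Rightarrow> 'o \<Rightarrow> bool" where
  "integral_elem S b \<longleftrightarrow> (\<exists>p. lead_coeff p = 1 \<and> (\<forall>i. coeff p i \<in> S) \<and> poly p b = 0)"

locale field_subring =
  fixes S :: "'o::field set"
  assumes zero_mem: "0 \<in> S" and one_mem: "1 \<in> S" and add_mem: "a \<in> S \<Longrightarrow> b \<in> S \<Longrightarrow> a + b \<in> S"
    and mult_mem: "a \<in> S \<Longrightarrow> b \<in> S \<Longrightarrow> a * b \<in> S" and uminus_mem: "a \<in> S \<Longrightarrow> - a \<in> S"
begin

lemma diff_mem: "a \<in> S \<Longrightarrow> b \<in> S \<Longrightarrow> a - b \<in> S"
  using add_mem[of a "- b"] uminus_mem by simp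

lemma sum_mem: "(\<And>x. x \<in> A \<Longrightarrow> f x \<in> S) \<Longrightarrow> sum f A \<in> S"
  by (induction A rule: infinite_finite_induct) (simp_all add: zero_mem add_mem)

lemma power_mem: "a \<in> S \<Longrightarrow> a ^ i \<in> S"
  by (induction i) (simp_all add: one_mem mult_mem)

lemma poly_mem: "(\<And>i. coeff p i \<in> S) \<Longrightarrow> a \<in> S \<Longrightarrow> poly p a \<in> S"
  unfolding poly_altdef by (intro sum_mem mult_mem power_mem)

text \<open>Gaussian elimination on a matrix of polynomials with monic diagonal entries of degree \<open>D\<close> and
  off-diagonal entries of smaller degree preserves this shape, with \<open>2 * D\<close> in place of \<open>D\<close>.
  This replaces the determinant in the usual proof.\<close>

lemma integral_elem_eliminate:
  fixes P :: "'i \<Rightarrow> 'i \<Rightarrow> 'o poly" and v :: "'i \<Rightarrow> 'o"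
  assumes "finite I" "I \<noteq> {}" "D > 0"
    and "\<And>i j l. i \<in> I \<Longrightarrow> j \<in> I \<Longrightarrow> coeff (P i j) l \<in> S"
    and "\<And>i. i \<in> I \<Longrightarrow> degree (P i i) = D \<and> coeff (P i i) D = 1"
    and "\<And>i j. i \<in> I \<Longrightarrow> j \<in> I \<Longrightarrow> i \<noteq> j \<Longrightarrow> degree (P i j) < D"
    and "\<And>i. i \<in> I \<Longrightarrow> (\<Sum>j\<in>I. poly (P i j) z * v j) = 0"
    and "\<exists>j\<in>I. v j \<noteq> 0"
  shows "integral_elem S z"
  using assms
proof (induction I arbitrary: P D rule: finite_ne_induct)
  case (singleton n)
  then have "poly (P n n) z = 0" by simp
  with singleton show ?case unfolding integral_elem_def by (intro exI[of _ "P n n"]) auto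
next
  case (insert n I)
  note D = insert.prems(1) and cS = insert.prems(2) and diag = insert.prems(3) and off = insert.prems(4)
    and eq = insert.prems(5) and nz = insert.prems(6)
  show ?case
  proof (cases "\<forall>j\<in>I. v j = 0")
    case True
    with nz have "v n \<noteq> 0" by auto
    have "poly (P n n) z * v n = 0" using eq[of n] insert.hyps True by simp
    with \<open>v n \<noteq> 0\<close> have "poly (P n n) z = 0" by simp
    with cS diag[of n] show ?thesis unfolding integral_elem_def by (intro exI[of _ "P n n"]) auto
  next
    case False
    \<comment> \<open>Cross multiplication removes \<open>v n\<close> without division. The diagonal
      product is monic of degree \<open>2 * D\<close>, and the subtracted product stays below it
      because each of its factors is off the diagonal.\<close>
    define Q where "Q i j = P n n * P i j - P i n * P n j" for i j
    show ?thesis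
    proof (rule insert.IH[of "2 * D" Q])
      show "2 * D > 0" using D by simp
      show "coeff (Q i j) l \<in> S" if "i \<in> I" "j \<in> I" for i j l
        unfolding Q_def coeff_diff coeff_mult using that
        by (intro diff_mem sum_mem mult_mem cS) auto
      show "degree (Q i i) = 2 * D \<and> coeff (Q i i) (2 * D) = 1" if i: "i \<in> I" for i
      proof -
        have ni: "n \<noteq> i" using i insert.hyps by auto
        have lt: "degree (P i n * P n i) < 2 * D"
          using degree_mult_le[of "P i n" "P n i"] off[of i n] off[of n i] i ni by force
        have "P n n \<noteq> 0" "P i i \<noteq> 0" using diag[of n] diag[of i] i by auto
        then have c: "degree (P n n * P i i) = 2 * D" "coeff (P n n * P i i) (2 * D) = 1"
          using diag[of n] diag[of i] i D coeff_mult_degree_sum[of "P n n" "P i i"]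
          by (auto simp: degree_mult_eq mult_2)
        have "degree (Q i i) = 2 * D"
          unfolding Q_def using degree_add_eq_left[of "- (P i n * P n i)" "P n n * P i i"] lt c by simp
        moreover have "coeff (Q i i) (2 * D) = 1"
          unfolding Q_def coeff_diff c(2) using lt by (simp add: coeff_eq_0)
        ultimately show ?thesis ..
      qed
      show "degree (Q i j) < 2 * D" if ij: "i \<in> I" "j \<in> I" "i \<noteq> j" for i j
      proof -
        have "n \<noteq> i" "n \<noteq> j" using ij insert.hyps by auto
        then have "degree (P n n * P i j) < 2 * D" "degree (P i n * P n j) < 2 * D"
          using degree_mult_le[of "P i n" "P n j"] degree_mult_le[of "P n n" "P i j"]
            off[of i n] off[of n j] off[of i j] diag[of n] ij by force+
        then show ?thesis unfolding Q_def by (rule degree_diff_less)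
      qed
      show "(\<Sum>j\<in>I. poly (Q i j) z * v j) = 0" if i: "i \<in> I" for i
      proof -
        have e: "(\<Sum>j\<in>I. poly (P i' j) z * v j) = - (poly (P i' n) z * v n)" if "i' \<in> insert n I" for i'
          using eq[OF that] insert.hyps by (simp add: eq_neg_iff_add_eq_0 add.commute)
        have "(\<Sum>j\<in>I. poly (Q i j) z * v j) =
          poly (P n n) z * (\<Sum>j\<in>I. poly (P i j) z * v j) - poly (P i n) z * (\<Sum>j\<in>I. poly (P n j) z * v j)"
          unfolding Q_def by (simp add: sum_distrib_left sum_subtractf[symmetric] algebra_simps)
        also have "\<dots> = 0" using i by (simp add: e)
        finally show ?thesis .
      qed
      show "\<exists>j\<in>I. v j \<noteq> 0" using False by auto
    qed
  qed
qed

section \<open>Finitely generated modules; sums and products of integral elements\<close>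

definition lin_span :: "'i set \<Rightarrow> ('i \<Rightarrow> 'o) \<Rightarrow> 'o set" where
  "lin_span I e = {\<Sum>i\<in>I. c i * e i | c. \<forall>i. c i \<in> S}"

lemma lin_span_0: "0 \<in> lin_span I e"
  unfolding lin_span_def by (auto intro!: exI[of _ "\<lambda>_. 0"] simp: zero_mem)

lemma lin_span_add:
  fixes e :: "'i \<Rightarrow> 'o"
  shows "x \<in> lin_span I e \<Longrightarrow> y \<in> lin_span I e \<Longrightarrow> x + y \<in> lin_span I e"
  unfolding lin_span_def
proof clarsimp
  fix c c' :: "'i \<Rightarrow> 'o" assume "\<forall>i. c i \<in> S" "\<forall>i. c' i \<in> S"
  then show "\<exists>ca. (\<Sum>i\<in>I. c i * e i) + (\<Sum>i\<in>I. c' i * e i) = (\<Sum>i\<in>I. ca i * e i) \<and> (\<forall>i. ca i \<in> S)"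
    by (intro exI[of _ "\<lambda>i. c i + c' i"]) (simp add: add_mem distrib_right sum.distrib)
qed

lemma lin_span_smult:
  fixes e :: "'i \<Rightarrow> 'o"
  shows "s \<in> S \<Longrightarrow> x \<in> lin_span I e \<Longrightarrow> s * x \<in> lin_span I e"
  unfolding lin_span_def
proof clarsimp
  fix c :: "'i \<Rightarrow> 'o" assume "\<forall>i. c i \<in> S" "s \<in> S"
  then show "\<exists>ca. s * (\<Sum>i\<in>I. c i * e i) = (\<Sum>i\<in>I. ca i * e i) \<and> (\<forall>i. ca i \<in> S)"
    by (intro exI[of _ "\<lambda>i. s * c i"]) (simp add: mult_mem sum_distrib_left mult.assoc)
qed

lemma lin_span_sum: "(\<And>x. x \<in> A \<Longrightarrow> f x \<in> lin_span I e) \<Longrightarrow> sum f A \<in> lin_span I e"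
  by (induction A rule: infinite_finite_induct) (simp_all add: lin_span_0 lin_span_add)

lemma lin_span_base: "finite I \<Longrightarrow> i \<in> I \<Longrightarrow> e i \<in> lin_span I e"
  unfolding lin_span_def
  by (auto intro!: exI[of _ "\<lambda>j. if j = i then 1 else 0"] simp: zero_mem one_mem if_distrib[of "\<lambda>x. x * _"] cong: if_cong)

text \<open>If c is the matrix of multiplication by z, then z - c kills the nonzero vector e. As a
  matrix of polynomials evaluated at z it has monic linear diagonal entries and constants elsewhere:
  the case \<open>D = 1\<close> of the elimination.\<close>

lemma integral_elem_stable:
  assumes "finite I" "\<exists>i\<in>I. e i \<noteq> 0" "\<And>i. i \<in> I \<Longrightarrow> z * e i \<in> lin_span I e"
  shows "integral_elem S z"
proof -
  have "\<exists>c. (\<forall>j. c j \<in> S) \<and> z * e i = (\<Sum>j\<in>I. c j * e j)" if "i \<in> I" for i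
    using assms(3)[OF that] unfolding lin_span_def by auto
  then obtain c where cS: "\<And>i j. i \<in> I \<Longrightarrow> c i j \<in> S" and c: "\<And>i. i \<in> I \<Longrightarrow> z * e i = (\<Sum>j\<in>I. c i j * e j)"
    by metis
  show ?thesis
  proof (rule integral_elem_eliminate[of I 1 "\<lambda>i j. if i = j then [:- c i i, 1:] else [:- c i j:]" z e])
    show "I \<noteq> {}" using assms by auto
    show "coeff (if i = j then [:- c i i, 1:] else [:- c i j:]) l \<in> S" if "i \<in> I" "j \<in> I" for i j l
      using that cS by (auto simp: coeff_pCons uminus_mem one_mem zero_mem split: nat.split)
    show "(\<Sum>j\<in>I. poly (if i = j then [:- c i i, 1:] else [:- c i j:]) z * e j) = 0" if i: "i \<in> I" for i
    proof -
      have "(\<Sum>j\<in>I. poly (if i = j then [:- c i i, 1:] else [:- c i j:]) z * e j)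
          = (\<Sum>j\<in>I. (if j = i then z * e j else 0) - c i j * e j)"
        by (intro sum.cong) (auto simp: algebra_simps)
      also have "\<dots> = z * e i - (\<Sum>j\<in>I. c i j * e j)"
        using i assms(1) by (simp only: sum_subtractf sum.delta) simp
      finally show ?thesis using c[OF i] by simp
    qed
  qed (use assms in auto)
qed

lemma integral_elem_power_span:
  assumes "integral_elem S z"
  obtains a where "a > 0" "\<And>i. i < a \<Longrightarrow> z * z ^ i \<in> lin_span {..<a} (\<lambda>i. z ^ i)"
proof -
  obtain p where p: "lead_coeff p = 1" "\<And>i. coeff p i \<in> S" "poly p z = 0"
    using assms unfolding integral_elem_def by blast
  let ?a = "degree p"
  have a: "?a > 0"
  proof (rule ccontr)
    assume "\<not> ?a > 0"
    then obtain c where "p = [:c:]" by (meson degree_eq_zeroE gr0I)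
    with p show False by simp
  qed
  have "(\<Sum>i\<le>?a. coeff p i * z ^ i) = 0" using p(3) by (simp add: poly_altdef)
  then have "z ^ ?a = (\<Sum>i<?a. (- coeff p i) * z ^ i)"
    using p(1) by (simp add: lessThan_Suc_atMost[symmetric] sum_negf eq_neg_iff_add_eq_0 add.commute)
  then have top: "z ^ ?a \<in> lin_span {..<?a} (\<lambda>i. z ^ i)"
    unfolding lin_span_def using p(2) by (auto intro!: exI[of _ "\<lambda>i. - coeff p i"] simp: uminus_mem)
  have "z * z ^ i \<in> lin_span {..<?a} (\<lambda>i. z ^ i)" if "i < ?a" for i
  proof (cases "Suc i = ?a")
    case True
    with top show ?thesis by (metis power_Suc)
  next
    case False
    with that have "Suc i \<in> {..<?a}" by auto
    from lin_span_base[OF _ this, of "\<lambda>i. z ^ i"] show ?thesis by simp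
  qed
  with a that show ?thesis by blast
qed

lemma lin_span_stable_left:
  assumes "\<And>i. i < a \<Longrightarrow> z * z ^ i \<in> lin_span {..<a} (\<lambda>i. z ^ i)"
    and "x \<in> lin_span ({..<a} \<times> {..<b}) (\<lambda>(i, j). z ^ i * w ^ j)"
  shows "z * x \<in> lin_span ({..<a} \<times> {..<b}) (\<lambda>(i, j). z ^ i * w ^ j)"
proof -
  let ?M = "lin_span ({..<a} \<times> {..<b}) (\<lambda>(i, j). z ^ i * w ^ j)"
  have gen: "z * (z ^ i * w ^ j) \<in> ?M" if ij: "i < a" "j < b" for i j
  proof -
    obtain c where c: "\<forall>i. c i \<in> S" "z * z ^ i = (\<Sum>i<a. c i * z ^ i)"
      using assms(1)[OF ij(1)] unfolding lin_span_def by auto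
    have base: "z ^ i * w ^ j \<in> ?M" if "i < a" for i
      using lin_span_base[of "{..<a} \<times> {..<b}" "(i, j)" "\<lambda>(i, j). z ^ i * w ^ j"] that ij by simp
    have "z * (z ^ i * w ^ j) = (z * z ^ i) * w ^ j" by (simp only: mult.assoc)
    also have "\<dots> = (\<Sum>i<a. c i * (z ^ i * w ^ j))"
      unfolding c(2) by (simp add: sum_distrib_right mult.assoc)
    also have "\<dots> \<in> ?M"
      by (rule lin_span_sum, rule lin_span_smult) (use base c(1) in auto)
    finally show ?thesis .
  qed
  obtain c where c: "\<forall>i. c i \<in> S" "x = (\<Sum>i\<in>{..<a} \<times> {..<b}. c i * (case i of (i, j) \<Rightarrow> z ^ i * w ^ j))"
    using assms(2) unfolding lin_span_def by auto
  have "z * x = (\<Sum>i\<in>{..<a} \<times> {..<b}. c i * (z * (case i of (i, j) \<Rightarrow> z ^ i * w ^ j)))"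
    unfolding c(2) by (simp add: sum_distrib_left mult.left_commute)
  also have "\<dots> \<in> ?M"
    by (rule lin_span_sum, rule lin_span_smult) (use gen c(1) in auto)
  finally show ?thesis .
qed

text \<open>The products z^i w^j with i < a, j < b span a module that contains 1 and is stable under
  z and under w, hence under z + w and z w.\<close>

lemma integral_elem_add_mult:
  assumes "integral_elem S z" "integral_elem S w"
  shows "integral_elem S (z + w)" "integral_elem S (z * w)"
proof -
  obtain a where a: "a > 0" "\<And>i. i < a \<Longrightarrow> z * z ^ i \<in> lin_span {..<a} (\<lambda>i. z ^ i)"
    using integral_elem_power_span[OF assms(1)] by blast
  obtain b where b: "b > 0" "\<And>i. i < b \<Longrightarrow> w * w ^ i \<in> lin_span {..<b} (\<lambda>i. w ^ i)"
    using integral_elem_power_span[OF assms(2)] by blast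
  let ?I = "{..<a} \<times> {..<b}" and ?e = "\<lambda>(i, j). z ^ i * w ^ j"
  have z: "z * x \<in> lin_span ?I ?e" if "x \<in> lin_span ?I ?e" for x
    using lin_span_stable_left[OF a(2) that] .
  have swap: "lin_span ({..<b} \<times> {..<a}) (\<lambda>(j, i). w ^ j * z ^ i) = lin_span ?I ?e"
  proof -
    have "(\<Sum>i\<in>{..<b} \<times> {..<a}. c i * (case i of (j, i) \<Rightarrow> w ^ j * z ^ i)) =
      (\<Sum>i\<in>?I. c (prod.swap i) * (case i of (i, j) \<Rightarrow> z ^ i * w ^ j))" for c
      by (rule sum.reindex_bij_witness[of _ prod.swap prod.swap]) (auto simp: mult.commute)
    moreover have "(\<Sum>i\<in>?I. c i * (case i of (i, j) \<Rightarrow> z ^ i * w ^ j)) =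
      (\<Sum>i\<in>{..<b} \<times> {..<a}. c (prod.swap i) * (case i of (j, i) \<Rightarrow> w ^ j * z ^ i))" for c
      by (rule sum.reindex_bij_witness[of _ prod.swap prod.swap]) (auto simp: mult.commute)
    ultimately show ?thesis unfolding lin_span_def
      apply (intro equalityI subsetI)
       apply clarify
       apply (rule_tac x="\<lambda>i. c (prod.swap i)" in exI, blast)
      apply clarify
      apply (rule_tac x="\<lambda>i. c (prod.swap i)" in exI, blast)
      done
  qed
  have w: "w * x \<in> lin_span ?I ?e" if "x \<in> lin_span ?I ?e" for x
    using lin_span_stable_left[OF b(2), of x a z] that unfolding swap by blast
  have nz: "\<exists>i\<in>?I. ?e i \<noteq> 0" using a(1) b(1) by (intro bexI[of _ "(0, 0)"]) auto
  have base: "?e i \<in> lin_span ?I ?e" if "i \<in> ?I" for i using lin_span_base[OF _ that, of ?e] by simp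
  show "integral_elem S (z + w)"
    by (rule integral_elem_stable[OF _ nz]) (use base z w in \<open>auto simp only: distrib_right intro!: lin_span_add\<close>)
  show "integral_elem S (z * w)"
    by (rule integral_elem_stable[OF _ nz]) (use base z w in \<open>auto simp only: mult.assoc\<close>)
qed

lemma integral_elem_mem: "s \<in> S \<Longrightarrow> integral_elem S s"
  unfolding integral_elem_def
  by (intro exI[of _ "[:- s, 1:]"]) (auto simp: coeff_pCons uminus_mem one_mem zero_mem split: nat.split)

lemma integral_elem_root:
  assumes "z ^ n \<in> S" "n > 0" shows "integral_elem S z"
  unfolding integral_elem_def
proof (intro exI[of _ "monom 1 n + [:- (z ^ n):]"] conjI allI)
  have d: "degree (monom 1 n + [:- (z ^ n):]) = n"
    using assms(2) by (subst degree_add_eq_left) (auto simp: degree_monom_eq)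
  show "lead_coeff (monom 1 n + [:- (z ^ n):]) = 1" using assms(2) unfolding d by (simp add: coeff_pCons split: nat.split)
  show "coeff (monom 1 n + [:- (z ^ n):]) i \<in> S" for i
    using assms by (auto simp: coeff_pCons uminus_mem one_mem zero_mem add_mem split: nat.split)
  show "poly (monom 1 n + [:- (z ^ n):]) z = 0" by (simp add: poly_monom)
qed

lemma field_subring_integral: "field_subring {z. integral_elem S z}"
proof
  show "- a \<in> {z. integral_elem S z}" if "a \<in> {z. integral_elem S z}" for a
    using integral_elem_add_mult(2)[OF integral_elem_mem[OF uminus_mem[OF one_mem]], of a] that by simp
qed (auto simp: integral_elem_add_mult integral_elem_mem zero_mem one_mem)

end

section \<open>The function field of the curve\<close>

lemma field_subring_range:
  fixes h :: "'r::comm_ring_1 \<Rightarrow> 'o::field"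
  assumes "type_ring_hom h" shows "field_subring (range h)"
proof -
  interpret type_ring_hom h by fact
  show ?thesis
  proof
    show "0 \<in> range h" "1 \<in> range h" by (metis hom_0 rangeI) (metis hom_1 rangeI)
    fix a b assume "a \<in> range h" "b \<in> range h"
    then obtain r s where "a = h r" "b = h s" by blast
    then show "a + b \<in> range h" "a * b \<in> range h" "- a \<in> range h"
      by (metis hom_add rangeI) (metis hom_mult rangeI \<open>a = h r\<close> \<open>b = h s\<close>, metis hom_uminus rangeI \<open>a = h r\<close>)
  qed
qed

lemma (in field_subring) integral_elem_ev:
  assumes "type_ring_hom h" "\<And>r. integral_elem S (h r)" "integral_elem S y"
  shows "integral_elem S (poly (map_poly h p) y)"
proof -
  interpret type_ring_hom h by fact
  interpret I: field_subring "{z. integral_elem S z}" by (rule field_subring_integral)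
  have "poly (map_poly h p) y \<in> {z. integral_elem S z}"
    using assms by (intro I.poly_mem) (auto simp: coeff_map_poly hom_0)
  then show ?thesis by simp
qed

text \<open>Dividing the equation of b by a power of b leaves a nonzero constant term, which is then
  a multiple of b. This is how denominators are rationalized without norms.\<close>

lemma (in field_subring) root_constant_coeff:
  assumes "p \<noteq> 0" "\<And>i. coeff p i \<in> S" "poly p b = 0" "b \<noteq> 0"
  shows "\<exists>a\<in>S. \<exists>p'. a \<noteq> 0 \<and> (\<forall>i. coeff p' i \<in> S) \<and> a + b * poly p' b = 0"
  using assms(1-3)
proof (induction p)
  case (pCons a p)
  have c: "a \<in> S" "\<And>i. coeff p i \<in> S"
    using pCons.prems(2)[of 0] pCons.prems(2)[of "Suc _"] by simp_all
  show ?case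
  proof (cases "a = 0")
    case True
    with pCons.prems have "p \<noteq> 0" "poly p b = 0" using assms(4) by auto
    then show ?thesis using pCons.IH c by blast
  next
    case False
    with c pCons.prems(3) show ?thesis by auto
  qed
qed simp

lemma monic_division:
  fixes f :: "'r::idom"
  assumes "m > 0"
  shows "\<exists>q r. p = (monom 1 m - [:f:]) * q + r \<and> degree r < m"
proof (induction "degree p" arbitrary: p rule: less_induct)
  case less
  show ?case
  proof (cases "degree p < m")
    case True
    then show ?thesis by (intro exI[of _ 0] exI[of _ p]) simp
  next
    case False
    define t where "t = monom (lead_coeff p) (degree p - m)"
    define p' where "p' = p - (monom 1 m - [:f:]) * t"
    have e: "p' = p - monom (lead_coeff p) (degree p) + [:f:] * t"
      using False by (simp add: p'_def t_def left_diff_distrib mult_monom)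
    have "degree p' < degree p"
    proof (cases "p' = 0")
      case True
      then show ?thesis using False assms by simp
    next
      case False
      have "coeff p' i = 0" if "i \<ge> degree p" for i
        using that \<open>\<not> degree p < m\<close> assms
        by (auto simp: e t_def coeff_eq_0)
      then show ?thesis using False by (metis leading_coeff_0_iff not_le)
    qed
    from less[OF this] obtain q r where "p' = (monom 1 m - [:f:]) * q + r" "degree r < m" by blast
    moreover have "p = p' + (monom 1 m - [:f:]) * t" by (simp only: p'_def diff_add_cancel)
    ultimately have "p = (monom 1 m - [:f:]) * (q + t) + r" by (simp only: distrib_left add.assoc add.commute add.left_commute)
    with \<open>degree r < m\<close> show ?thesis by blast
  qed
qed

text \<open>Everything happens inside the field \<open>'o\<close>, which contains the polynomials
  over the larger constant field \<open>'k\<close> and an mth root \<open>y\<close> of f.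
  Polynomials over \<open>'a\<close> enter by way of \<open>'k\<close>, so linear disjointness from
  the constants becomes a statement about elements of one field. The simple root \<open>c\<close>
  lives in \<open>'k\<close>.\<close>

locale curve_model = e: inj_type_ring_hom e + \<iota>: inj_type_ring_hom \<iota>
  for e :: "'a::field \<Rightarrow> 'k::field" and \<iota> :: "'k poly \<Rightarrow> 'o::field" +
  fixes f :: "'a poly" and m :: nat and y :: 'o and c :: 'k
  assumes m: "m > 0" and y: "y ^ m = \<iota> (map_poly e f)"
    and root: "poly (map_poly e f) c = 0" and simple: "poly (pderiv (map_poly e f)) c \<noteq> 0"
begin

definition evK :: "'k poly poly \<Rightarrow> 'o" where "evK P = poly (map_poly \<iota> P) y"
definition j :: "'a poly \<Rightarrow> 'o" where "j p = \<iota> (map_poly e p)"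
definition ev :: "'a poly poly \<Rightarrow> 'o" where "ev p = poly (map_poly j p) y"

sublocale j: inj_type_ring_hom j
  unfolding j_def using inj_type_ring_hom_comp[OF e.inj_type_ring_hom_map \<iota>.inj_type_ring_hom_axioms] .

sublocale evK: type_ring_hom evK
  unfolding evK_def using type_ring_hom_eval[OF \<iota>.type_ring_hom_axioms] .

sublocale ev: type_ring_hom ev
  unfolding ev_def using type_ring_hom_eval[OF j.type_ring_hom_axioms] .

lemma ev_eq_evK: "ev p = evK (map_poly (map_poly e) p)"
proof -
  have "map_poly j p = map_poly \<iota> (map_poly (map_poly e) p)"
    by (simp add: poly_eq_iff coeff_map_poly j_def \<iota>.hom_0)
  then show ?thesis by (simp add: ev_def evK_def)
qed

lemma ev_const [simp]: "ev [:p:] = j p" and evK_const [simp]: "evK [:P:] = \<iota> P"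
  by (simp_all add: ev_def evK_def j.map_poly_pCons' \<iota>.map_poly_pCons')

lemma ev_y [simp]: "ev (monom 1 i) = y ^ i"
  by (simp add: ev_def map_poly_monom j.hom_0 j.hom_1 poly_monom)

lemma y_nonzero: "y \<noteq> 0"
proof
  assume "y = 0"
  then have "map_poly e f = 0" using y m by (simp add: power_0_left)
  then show False using simple by simp
qed

lemma y_power: "y ^ m = j f"
  by (simp add: y j_def)

lemma simple_factor: obtains u where "map_poly e f = [:- c, 1:] * u" "poly u c \<noteq> 0"
proof -
  obtain u where u: "map_poly e f = [:- c, 1:] * u" using root by (auto simp: poly_eq_0_iff_dvd)
  have "pderiv (map_poly e f) = [:- c, 1:] * pderiv u + u * pderiv [:- c, 1:]"
    unfolding u by (rule pderiv_mult)
  then have "poly (pderiv (map_poly e f)) c = poly u c" by (simp add: pderiv_pCons)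
  with u simple that show ?thesis by simp
qed

lemma integral_y: "integral_elem (range \<iota>) y" "integral_elem (range j) y"
proof -
  interpret I: field_subring "range \<iota>" by (rule field_subring_range[OF \<iota>.type_ring_hom_axioms])
  interpret J: field_subring "range j" by (rule field_subring_range[OF j.type_ring_hom_axioms])
  show "integral_elem (range \<iota>) y" using m by (intro I.integral_elem_root[of _ m]) (simp_all add: y)
  show "integral_elem (range j) y" using m by (intro J.integral_elem_root[of _ m]) (simp_all add: y_power)
qed

lemma integral_ev: "integral_elem (range j) (ev p)"
proof -
  interpret J: field_subring "range j" by (rule field_subring_range[OF j.type_ring_hom_axioms])
  show ?thesis unfolding ev_def
    by (intro J.integral_elem_ev j.type_ring_hom_axioms integral_y J.integral_elem_mem) simp
qed

text \<open>From r^m = f b^m, the monic equation of b^m times f^N becomes an equation between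
  polynomials in x. At c every term with a factor f vanishes and only r(c)^(m N) remains.\<close>

lemma multiple_of_y_vanishes:
  assumes "\<iota> r = y * b" "integral_elem (range \<iota>) (b ^ m)"
  shows "poly r c = 0"
proof -
  obtain p where p: "lead_coeff p = 1" "\<forall>i. coeff p i \<in> range \<iota>" "poly p (b ^ m) = 0"
    using assms(2) unfolding integral_elem_def by blast
  then have "\<exists>a. \<forall>i. coeff p i = \<iota> (a i)" by (intro choice) auto
  then obtain a where a: "\<And>i. coeff p i = \<iota> (a i)" by blast
  let ?N = "degree p" and ?F = "map_poly e f"
  have rm: "\<iota> r ^ m = \<iota> ?F * b ^ m" unfolding assms(1) by (simp add: power_mult_distrib y)
  have "\<iota> (\<Sum>i\<le>?N. a i * r ^ (m * i) * ?F ^ (?N - i)) = (\<Sum>i\<le>?N. coeff p i * (b ^ m) ^ i * \<iota> ?F ^ ?N)"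
    unfolding \<iota>.hom_sum
  proof (rule sum.cong[OF refl])
    fix i assume i: "i \<in> {..?N}"
    have "\<iota> (a i * r ^ (m * i) * ?F ^ (?N - i)) = \<iota> (a i) * (\<iota> r ^ m) ^ i * \<iota> ?F ^ (?N - i)"
      by (simp add: \<iota>.homs power_mult)
    also have "\<dots> = coeff p i * (b ^ m) ^ i * (\<iota> ?F ^ i * \<iota> ?F ^ (?N - i))"
      unfolding rm a by (simp add: power_mult_distrib)
    also have "\<iota> ?F ^ i * \<iota> ?F ^ (?N - i) = \<iota> ?F ^ ?N" using i by (simp flip: power_add)
    finally show "\<iota> (a i * r ^ (m * i) * ?F ^ (?N - i)) = coeff p i * (b ^ m) ^ i * \<iota> ?F ^ ?N" .
  qed
  also have "\<dots> = poly p (b ^ m) * \<iota> ?F ^ ?N" by (simp add: poly_altdef sum_distrib_right)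
  finally have "(\<Sum>i\<le>?N. a i * r ^ (m * i) * ?F ^ (?N - i)) = 0" using p(3) by simp
  then have "poly (\<Sum>i\<le>?N. a i * r ^ (m * i) * ?F ^ (?N - i)) c = 0" by simp
  also have "poly (\<Sum>i\<le>?N. a i * r ^ (m * i) * ?F ^ (?N - i)) c = (\<Sum>i\<le>?N. if i = ?N then poly (a ?N) c * poly r c ^ (m * ?N) else 0)"
    unfolding poly_sum by (intro sum.cong) (auto simp: root power_0_left)
  also have "\<dots> = poly (a ?N) c * poly r c ^ (m * ?N)" by simp
  also have "a ?N = 1" using p(1) a[of ?N] by (metis \<iota>.hom_1 \<iota>.hom_eq_iff)
  finally show ?thesis by auto
qed

text \<open>With f = (x - c) u, multiply the relation by u. Lower coefficients are already multiples
  of x - c and turn into multiples of y^m; the higher terms contain y^(l+1) anyway. So u times the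
  lth coefficient is y times an integral element and vanishes at c, where u does not.\<close>

lemma coeffs_vanish:
  assumes "evK P = 0" "degree P < m" "l < m"
  shows "[:- c, 1:] dvd coeff P l"
  using assms(3)
proof (induction l rule: less_induct)
  case (less l)
  interpret I: field_subring "range \<iota>" by (rule field_subring_range[OF \<iota>.type_ring_hom_axioms])
  interpret II: field_subring "{z. integral_elem (range \<iota>) z}" by (rule I.field_subring_integral)
  obtain u where u: "map_poly e f = [:- c, 1:] * u" "poly u c \<noteq> 0" by (rule simple_factor)
  have "\<forall>i. \<exists>q. i < l \<longrightarrow> coeff P i = [:- c, 1:] * q" using less by (auto simp: dvd_def)
  then obtain P' where P': "\<And>i. i < l \<Longrightarrow> coeff P i = [:- c, 1:] * P' i" by metis
  \<comment> \<open>The remaining terms of the relation times u, divided by y^(l+1). For i < l the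
    factor (x - c) u = y^m makes the exponent m + i - (l + 1), which is not negative.\<close>
  define b where "b = (\<Sum>i<l. \<iota> (P' i) * y ^ (m - Suc l + i)) + (\<Sum>i\<in>{l<..<m}. \<iota> (u * coeff P i) * y ^ (i - Suc l))"
  have ib: "b \<in> {z. integral_elem (range \<iota>) z}"
    unfolding b_def using integral_y(1)
    by (intro II.add_mem II.sum_mem II.mult_mem II.power_mem) (auto intro: I.integral_elem_mem)
  have s1: "\<iota> u * (\<iota> (coeff P i) * y ^ i) = y ^ l * (y * (\<iota> (P' i) * y ^ (m - Suc l + i)))" if "i < l" for i
  proof -
    have "\<iota> u * (\<iota> (coeff P i) * y ^ i) = \<iota> ([:- c, 1:] * u) * \<iota> (P' i) * y ^ i"
      unfolding P'[OF that] by (simp only: \<iota>.hom_mult mult_ac)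
    also have "\<dots> = y ^ m * \<iota> (P' i) * y ^ i" unfolding u(1)[symmetric] y[symmetric] ..
    also have "\<dots> = y ^ m * y ^ i * \<iota> (P' i)" by (simp only: mult_ac)
    also have "y ^ m * y ^ i = y ^ (l + 1 + (m - Suc l + i))"
      using less.prems by (simp flip: power_add)
    finally show ?thesis by (simp only: power_add power_one_right mult_ac)
  qed
  have s2: "\<iota> u * (\<iota> (coeff P i) * y ^ i) = y ^ l * (y * (\<iota> (u * coeff P i) * y ^ (i - Suc l)))" if "i \<in> {l<..<m}" for i
  proof -
    have "i = l + 1 + (i - Suc l)" using that by auto
    then have "y ^ i = y ^ l * y * y ^ (i - Suc l)" by (metis power_add power_one_right)
    then show ?thesis by (simp only: \<iota>.hom_mult mult_ac)
  qed
  have "0 = \<iota> u * (\<Sum>i<m. \<iota> (coeff P i) * y ^ i)"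
    using assms(1,2) by (simp add: evK_def \<iota>.poly_map_poly_sum)
  also have "{..<m} = insert l ({..<l} \<union> {l<..<m})" using less.prems by auto
  also have "\<iota> u * (\<Sum>i\<in>insert l ({..<l} \<union> {l<..<m}). \<iota> (coeff P i) * y ^ i) =
      \<iota> u * (\<iota> (coeff P l) * y ^ l) + ((\<Sum>i<l. \<iota> u * (\<iota> (coeff P i) * y ^ i)) + (\<Sum>i\<in>{l<..<m}. \<iota> u * (\<iota> (coeff P i) * y ^ i)))"
    by (subst sum.insert, simp, simp, subst sum.union_disjoint) (auto simp: distrib_left sum_distrib_left)
  also have "(\<Sum>i<l. \<iota> u * (\<iota> (coeff P i) * y ^ i)) = y ^ l * (y * (\<Sum>i<l. \<iota> (P' i) * y ^ (m - Suc l + i)))"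
    by (simp add: s1 sum_distrib_left)
  also have "(\<Sum>i\<in>{l<..<m}. \<iota> u * (\<iota> (coeff P i) * y ^ i)) = y ^ l * (y * (\<Sum>i\<in>{l<..<m}. \<iota> (u * coeff P i) * y ^ (i - Suc l)))"
    by (simp only: s2 sum_distrib_left cong: sum.cong)
  finally have "y ^ l * (\<iota> (u * coeff P l) + y * b) = 0"
    unfolding b_def by (simp add: \<iota>.hom_mult algebra_simps)
  then have "\<iota> (u * coeff P l) = y * (- b)" using y_nonzero by (simp add: eq_neg_iff_add_eq_0)
  moreover have "integral_elem (range \<iota>) ((- b) ^ m)"
    using II.power_mem[OF II.uminus_mem[OF ib]] by simp
  ultimately have "poly (u * coeff P l) c = 0" by (rule multiple_of_y_vanishes)
  then show ?case using u(2) by (simp add: poly_eq_0_iff_dvd)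
qed

text \<open>This is Eisenstein's criterion for \<open>y ^ m - f\<close> at the simple root \<open>c\<close> of \<open>f\<close>.\<close>

lemma evK_eq_0_imp:
  assumes "evK P = 0" "degree P < m"
  shows "P = 0"
proof (rule ccontr)
  assume "P \<noteq> 0"
  \<comment> \<open>Each round removes a factor x - c from all coefficients and keeps the relation,
    so the leading coefficient would be divisible by arbitrarily high powers.\<close>
  have "\<exists>P'. P = smult ([:- c, 1:] ^ r) P' \<and> evK P' = 0" for r
  proof (induction r)
    case (Suc r)
    then obtain P' where P': "P = smult ([:- c, 1:] ^ r) P'" "evK P' = 0" by blast
    have "degree P' < m" using assms(2) unfolding P'(1) by simp
    then have "[:- c, 1:] dvd coeff P' l" for l
      using coeffs_vanish[OF P'(2)] by (cases "l < m") (auto simp: coeff_eq_0)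
    then have "[:[:- c, 1:]:] dvd P'" by (simp add: const_poly_dvd_iff)
    then obtain P'' where P'': "P' = smult [:- c, 1:] P''" by (auto simp: dvd_def)
    have "evK P' = \<iota> [:- c, 1:] * evK P''"
      unfolding P'' using evK.hom_mult[of "[:[:- c, 1:]:]" P''] by simp
    then have "evK P'' = 0" using P'(2) by simp
    moreover have "P = smult ([:- c, 1:] ^ Suc r) P''" unfolding P'(1) P'' by (simp add: mult.commute)
    ultimately show ?case by blast
  qed (use assms in auto)
  then obtain P' where P': "P = smult ([:- c, 1:] ^ Suc (degree (lead_coeff P))) P'" by blast
  then have "[:- c, 1:] ^ Suc (degree (lead_coeff P)) dvd lead_coeff P" by (metis coeff_smult dvd_triv_left)
  then have "degree ([:- c, 1:] ^ Suc (degree (lead_coeff P))) \<le> degree (lead_coeff P)"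
    using \<open>P \<noteq> 0\<close> by (intro dvd_imp_degree_le) auto
  then show False by (simp add: degree_power_eq del: power_Suc)
qed

lemma ev_eq_0_imp:
  assumes "ev p = 0" "degree p < m" shows "p = 0"
proof -
  interpret ee: inj_type_ring_hom "map_poly e" by (rule e.inj_type_ring_hom_map)
  interpret eee: inj_type_ring_hom "map_poly (map_poly e)" by (rule ee.inj_type_ring_hom_map)
  show ?thesis using evK_eq_0_imp[of "map_poly (map_poly e) p"] assms by (simp add: ev_eq_evK)
qed

lemma ev_relation: "ev (monom 1 m - [:f:]) = 0"
  by (simp add: ev.hom_diff y_power)

text \<open>Reduce by the monic y^m - f and apply Eisenstein to the remainder. The kernel of
  \<open>ev\<close> is therefore the curve ideal, and the coordinate ring can be identified with
  \<open>range ev\<close>.\<close>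

lemma ev_eq_0_iff: "ev p = 0 \<longleftrightarrow> (monom 1 m - [:f:]) dvd p"
proof
  assume p: "ev p = 0"
  obtain q r where qr: "p = (monom 1 m - [:f:]) * q + r" "degree r < m" using monic_division[OF m] by blast
  then have "ev r = 0" using p by (simp add: ev.hom_add ev.hom_mult ev_relation)
  from ev_eq_0_imp[OF this qr(2)] show "(monom 1 m - [:f:]) dvd p" unfolding qr(1) by simp
qed (auto simp: ev.hom_mult ev_relation elim!: dvdE)

lemma ev_reduce: obtains r where "ev p = ev r" "degree r < m"
proof -
  obtain q r where qr: "p = (monom 1 m - [:f:]) * q + r" "degree r < m" using monic_division[OF m] by blast
  then show ?thesis using that by (simp add: ev.hom_add ev.hom_mult ev_relation)
qed

text \<open>Allows all denominators in the function field to be polynomials in x alone, so that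
  fractions can be brought to a common denominator coefficientwise.\<close>

lemma rationalize:
  assumes "ev q \<noteq> 0"
  obtains q' d where "d \<noteq> 0" "ev q * ev q' = j d"
proof -
  interpret J: field_subring "range j" by (rule field_subring_range[OF j.type_ring_hom_axioms])
  interpret E: field_subring "range ev" by (rule field_subring_range[OF ev.type_ring_hom_axioms])
  obtain p where p: "lead_coeff p = 1" "\<And>i. coeff p i \<in> range j" "poly p (ev q) = 0"
    using integral_ev[of q] unfolding integral_elem_def by blast
  from p(1) have "p \<noteq> 0" by auto
  from J.root_constant_coeff[OF this p(2,3) assms] obtain a p' where
    ap: "a \<in> range j" "a \<noteq> 0" "\<forall>i. coeff p' i \<in> range j" "a + ev q * poly p' (ev q) = 0" by blast
  obtain d where d: "a = j d" using ap(1) by blast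
  have "range j \<subseteq> range ev" by (metis ev_const image_subsetI rangeI)
  then have "poly p' (ev q) \<in> range ev" using ap(3) by (intro E.poly_mem) auto
  then obtain q' where q': "poly p' (ev q) = ev q'" by blast
  have "ev q * ev (- q') = j d" using ap(4) by (simp add: q' d ev.hom_uminus eq_neg_iff_add_eq_0 neg_eq_iff_add_eq_0 add.commute)
  moreover have "d \<noteq> 0" using ap(2) d by auto
  ultimately show ?thesis using that by blast
qed

section \<open>The function field and the integral closure inside it\<close>

definition function_field :: "'o set" where
  "function_field = {ev p / ev q | p q. ev q \<noteq> 0}"

lemma function_fieldE:
  assumes "b \<in> function_field"
  obtains p d where "degree p < m" "d \<noteq> 0" "b = ev p / j d"
proof -
  obtain p q where b: "b = ev p / ev q" "ev q \<noteq> 0" using assms by (auto simp: function_field_def)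
  obtain q' d where d: "d \<noteq> 0" "ev q * ev q' = j d" using rationalize[OF b(2)] by blast
  obtain r where r: "ev (p * q') = ev r" "degree r < m" by (rule ev_reduce)
  have "ev q' \<noteq> 0" using d by auto
  then have "b = (ev p * ev q') / (ev q * ev q')" using b by simp
  also have "\<dots> = ev r / j d" by (simp only: d(2) flip: r(1)) (simp add: ev.hom_mult)
  finally show ?thesis using that r d by blast
qed

lemma function_fieldI: "d \<noteq> 0 \<Longrightarrow> ev p / j d \<in> function_field"
  unfolding function_field_def by (intro CollectI exI[of _ p] exI[of _ "[:d:]"]) simp

lemma field_subring_function_field: "field_subring function_field"
proof
  show "0 \<in> function_field" "1 \<in> function_field"
    using function_fieldI[of 1 0] function_fieldI[of 1 1] by (simp_all add: j.hom_1 ev.hom_0 ev.hom_1)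
next
  fix a b assume "a \<in> function_field" "b \<in> function_field"
  then obtain p d p' d' where *: "d \<noteq> 0" "a = ev p / j d" "d' \<noteq> 0" "b = ev p' / j d'"
    by (meson function_fieldE)
  have "a + b = ev (p * [:d':] + p' * [:d:]) / j (d * d')"
    using * by (simp only: ev.homs ev_const j.hom_mult) (simp add: add_frac_eq)
  then show "a + b \<in> function_field" using * function_fieldI[of "d * d'"] by simp
  have "a * b = ev (p * p') / j (d * d')" using * by (simp add: ev.homs j.hom_mult)
  then show "a * b \<in> function_field" using * function_fieldI[of "d * d'"] by simp
  have "- a = ev (- p) / j d" using * by (simp add: ev.homs)
  then show "- a \<in> function_field" using * function_fieldI[of d] by simp
qed

definition normal_closure :: "'o set" where
  "normal_closure = {b \<in> function_field. integral_elem (range ev) b}"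

lemma field_subring_normal_closure: "field_subring normal_closure"
proof -
  interpret L: field_subring function_field by (rule field_subring_function_field)
  interpret E: field_subring "range ev" by (rule field_subring_range[OF ev.type_ring_hom_axioms])
  interpret I: field_subring "{z. integral_elem (range ev) z}" by (rule E.field_subring_integral)
  show ?thesis
    using L.zero_mem L.one_mem L.add_mem L.mult_mem L.uminus_mem I.zero_mem I.one_mem I.add_mem I.mult_mem I.uminus_mem
    unfolding normal_closure_def by unfold_locales auto
qed

lemma ev_function_field: "ev p \<in> function_field"
  using function_fieldI[of 1 p] by (simp add: j.hom_1)

lemma ev_normal_closure: "ev p \<in> normal_closure"
proof -
  interpret E: field_subring "range ev" by (rule field_subring_range[OF ev.type_ring_hom_axioms])
  show ?thesis by (simp add: normal_closure_def ev_function_field E.integral_elem_mem)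
qed

text \<open>Over a common denominator the relation becomes \<open>evK P = 0\<close> with P of degree
  below m in y, so P = 0 by Eisenstein. Each coefficient of x^i y^l in P is then a relation among
  the elements of \<open>C\<close> over the small constant field.\<close>

lemma linearly_disjoint:
  fixes C :: "'k set" and b :: "'k \<Rightarrow> 'o"
  assumes C: "finite C" and indep: "\<And>l. (\<Sum>c\<in>C. e (l c) * c) = 0 \<Longrightarrow> \<forall>c\<in>C. l c = 0"
    and b: "\<And>c. c \<in> C \<Longrightarrow> b c \<in> function_field" and sum: "(\<Sum>c\<in>C. b c * \<iota> [:c:]) = 0"
  shows "\<forall>c\<in>C. b c = 0"
proof -
  have "\<forall>c. \<exists>p d. c \<in> C \<longrightarrow> degree p < m \<and> d \<noteq> 0 \<and> b c = ev p / j d"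
    using b by (metis function_fieldE)
  then obtain p d where pd: "\<And>c. c \<in> C \<Longrightarrow> degree (p c) < m" "\<And>c. c \<in> C \<Longrightarrow> d c \<noteq> 0"
    "\<And>c. c \<in> C \<Longrightarrow> b c = ev (p c) / j (d c)" by metis
  \<comment> \<open>The cofactor that brings the fraction with denominator \<open>d c\<close> to the
    common denominator.\<close>
  define D where "D c = (\<Prod>c'\<in>C - {c}. d c')" for c
  define p' where "p' c = smult (D c) (p c)" for c
  define P where "P = (\<Sum>c\<in>C. smult [:c:] (map_poly (map_poly e) (p' c)))"
  have Dc: "(\<Prod>c'\<in>C. d c') = d c * D c" if "c \<in> C" for c
    unfolding D_def using C that by (rule prod.remove)
  have evp': "ev (p' c) = j (\<Prod>c'\<in>C. d c') * b c" if "c \<in> C" for c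
    using pd(2,3)[OF that] ev.hom_mult[of "[:D c:]" "p c"] by (simp add: p'_def Dc[OF that] j.hom_mult)
  have deg: "degree (map_poly (map_poly e) (p' c)) < m" if "c \<in> C" for c
  proof -
    interpret ee: inj_type_ring_hom "map_poly e" by (rule e.inj_type_ring_hom_map)
    show ?thesis using pd(1)[OF that] degree_smult_le[of "D c" "p c"] by (simp add: p'_def)
  qed
  have "evK P = (\<Sum>c\<in>C. ev (p' c) * \<iota> [:c:])"
    unfolding P_def evK.hom_sum
  proof (rule sum.cong[OF refl])
    fix c
    show "evK (smult [:c:] (map_poly (map_poly e) (p' c))) = ev (p' c) * \<iota> [:c:]"
      using evK.hom_mult[of "[:[:c:]:]" "map_poly (map_poly e) (p' c)"] by (simp add: ev_eq_evK mult.commute)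
  qed
  also have "\<dots> = j (\<Prod>c'\<in>C. d c') * (\<Sum>c\<in>C. b c * \<iota> [:c:])"
    by (simp add: evp' sum_distrib_left mult.assoc)
  finally have "evK P = 0" using sum by simp
  moreover have "degree P < m"
  proof -
    have "degree P \<le> m - 1"
      unfolding P_def
    proof (rule degree_sum_le[OF C])
      fix c assume "c \<in> C"
      from deg[OF this] show "degree (smult [:c:] (map_poly (map_poly e) (p' c))) \<le> m - 1"
        using degree_smult_le[of "[:c:]" "map_poly (map_poly e) (p' c)"] by linarith
    qed
    with m show ?thesis by linarith
  qed
  ultimately have "P = 0" by (rule evK_eq_0_imp)
  have z: "p' c = 0" if c: "c \<in> C" for c
  proof (intro poly_eqI)
    fix l i
    have "0 = coeff (coeff P l) i" by (simp add: \<open>P = 0\<close>)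
    also have "\<dots> = (\<Sum>c\<in>C. e (coeff (coeff (p' c) l) i) * c)"
      unfolding P_def coeff_sum by (simp add: coeff_map_poly e.hom_0 mult.commute)
    finally show "coeff (coeff (p' c) l) i = coeff (coeff 0 l) i" using indep[of "\<lambda>c. coeff (coeff (p' c) l) i"] c by simp
  qed
  have "(\<Prod>c'\<in>C. d c') \<noteq> 0" using pd(2) C by simp
  then show ?thesis using evp' z by (metis ev.hom_0 j.hom_eq_0_iff mult_eq_0_iff)
qed

end

section \<open>The coordinate ring and the normalization\<close>

text \<open>The zero ideal is a generic point: a closed set containing it is the whole
  spectrum.\<close>

lemma (in domain) irreducible_spectrum: "irreducible_spectrum R"
proof -
  have z: "primeideal {\<zero>\<^bsub>R\<^esub>} R" by (rule zeroprimeideal)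
  have min: "Z = spectrum R" if "zariski_closed R Z" "{\<zero>\<^bsub>R\<^esub>} \<in> Z" for Z
  proof -
    from that(1) have "\<exists>S. Z = {P \<in> spectrum R. S \<subseteq> P}" unfolding zariski_closed_def by auto
    then obtain S where S: "Z = {P \<in> spectrum R. S \<subseteq> P}" ..
    with that(2) have "S \<subseteq> {\<zero>\<^bsub>R\<^esub>}" by blast
    moreover have "\<zero>\<^bsub>R\<^esub> \<in> P" if "P \<in> spectrum R" for P
      using that unfolding spectrum_def
      by (auto intro!: additive_subgroup.zero_closed ideal.axioms(1) primeideal.axioms(1))
    ultimately show ?thesis unfolding S by blast
  qed
  show ?thesis unfolding irreducible_spectrum_def
  proof (intro conjI allI impI)
    show "spectrum R \<noteq> {}" using z by (auto simp: spectrum_def)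
    fix Z W assume *: "zariski_closed R Z \<and> zariski_closed R W \<and> spectrum R = Z \<union> W"
    then have "{\<zero>\<^bsub>R\<^esub>} \<in> Z \<or> {\<zero>\<^bsub>R\<^esub>} \<in> W" using z by (auto simp: spectrum_def)
    then show "Z = spectrum R \<or> W = spectrum R" using min * by metis
  qed
qed

lemma (in field_subring) coeff_Poly_mem: "set xs \<subseteq> S \<Longrightarrow> coeff (Poly xs) i \<in> S"
  by (auto simp: nth_default_def zero_mem subset_iff)

text \<open>The coordinate ring and the normalization consist of cosets and of equivalence classes of
  fractions of cosets. Both are studied through their image \<open>L\<close> in one large field.\<close>

locale parametrized_ring = field_subring L
  for L :: "'o::field set" and R :: "('b, 'c) ring_scheme" and \<psi> :: "'o \<Rightarrow> 'b" +
  assumes inj_\<psi>: "inj_on \<psi> L" and carrier_eq: "carrier R = \<psi> ` L"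
    and mult_\<psi>: "v \<in> L \<Longrightarrow> w \<in> L \<Longrightarrow> \<psi> v \<otimes>\<^bsub>R\<^esub> \<psi> w = \<psi> (v * w)"
    and add_\<psi>: "v \<in> L \<Longrightarrow> w \<in> L \<Longrightarrow> \<psi> v \<oplus>\<^bsub>R\<^esub> \<psi> w = \<psi> (v + w)"
    and one_\<psi>: "\<one>\<^bsub>R\<^esub> = \<psi> 1" and zero_\<psi>: "\<zero>\<^bsub>R\<^esub> = \<psi> 0"
begin

lemma \<psi>_eq_iff: "v \<in> L \<Longrightarrow> w \<in> L \<Longrightarrow> \<psi> v = \<psi> w \<longleftrightarrow> v = w"
  using inj_\<psi> by (auto dest: inj_onD)

lemma \<psi>_closed: "v \<in> L \<Longrightarrow> \<psi> v \<in> carrier R"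
  by (simp add: carrier_eq)

lemma domain: "domain R"
proof -
  have "cring R"
  proof (rule cringI)
    show "abelian_group R"
    proof (rule abelian_groupI)
      fix x assume "x \<in> carrier R"
      then obtain v where "x = \<psi> v" "v \<in> L" unfolding carrier_eq by blast
      then show "\<exists>y\<in>carrier R. y \<oplus>\<^bsub>R\<^esub> x = \<zero>\<^bsub>R\<^esub>"
        by (intro bexI[of _ "\<psi> (- v)"]) (simp_all add: add_\<psi> uminus_mem zero_\<psi> \<psi>_closed)
    qed (auto simp: carrier_eq add_\<psi> zero_\<psi> add_mem zero_mem add_ac)
    show "comm_monoid R"
      by (rule comm_monoidI) (auto simp: carrier_eq mult_\<psi> one_\<psi> mult_mem one_mem mult_ac)
  qed (auto simp: carrier_eq add_\<psi> mult_\<psi> mult_mem add_mem distrib_right)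
  then show ?thesis
  proof (rule domainI)
    show "\<one>\<^bsub>R\<^esub> \<noteq> \<zero>\<^bsub>R\<^esub>" by (simp add: one_\<psi> zero_\<psi> \<psi>_eq_iff one_mem zero_mem)
    show "a = \<zero>\<^bsub>R\<^esub> \<or> b = \<zero>\<^bsub>R\<^esub>" if "a \<otimes>\<^bsub>R\<^esub> b = \<zero>\<^bsub>R\<^esub>" "a \<in> carrier R" "b \<in> carrier R" for a b
      using that by (auto simp: carrier_eq mult_\<psi> zero_\<psi> \<psi>_eq_iff mult_mem zero_mem)
  qed
qed

sublocale domain R by (rule domain)

lemma a_inv_\<psi>: "v \<in> L \<Longrightarrow> \<ominus>\<^bsub>R\<^esub> \<psi> v = \<psi> (- v)"
  by (rule minus_equality) (simp_all add: add_\<psi> uminus_mem zero_\<psi> \<psi>_closed)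

lemma minus_\<psi>: "v \<in> L \<Longrightarrow> w \<in> L \<Longrightarrow> \<psi> v \<ominus>\<^bsub>R\<^esub> \<psi> w = \<psi> (v - w)"
  by (simp add: a_minus_def a_inv_\<psi> add_\<psi> uminus_mem)

lemma pow_\<psi>: "v \<in> L \<Longrightarrow> \<psi> v [^]\<^bsub>R\<^esub> (n::nat) = \<psi> (v ^ n)"
  by (induction n) (simp_all add: one_\<psi> mult_\<psi> power_mem mult.commute)

lemma eval_\<psi>:
  assumes "set xs \<subseteq> L" "b \<in> L"
  shows "ring.eval R (map \<psi> xs) (\<psi> b) = \<psi> (poly (Poly (rev xs)) b)"
  using assms(1)
proof (induction xs)
  case Nil
  then show ?case by (simp add: zero_\<psi>)
next
  case (Cons x xs)
  have "poly (Poly (rev xs)) b \<in> L"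
    using Cons.prems assms(2) by (intro poly_mem coeff_Poly_mem) auto
  then show ?case using Cons assms(2)
    by (simp add: pow_\<psi> mult_\<psi> add_\<psi> power_mem mult_mem Poly_append poly_monom add.commute mult.commute)
qed

section \<open>Fractions and normalization of a parametrized ring\<close>

definition fraction_set :: "'o set" where
  "fraction_set = {v / d | v d. v \<in> L \<and> d \<in> L \<and> d \<noteq> 0}"

text \<open>Taking all pairs that represent x makes this literally the equivalence class returned by
  \<open>ring_frac\<close>, so it parametrizes the total fraction ring.\<close>

definition \<phi> :: "'o \<Rightarrow> ('b \<times> 'b) set" where
  "\<phi> x = {(\<psi> v, \<psi> d) | v d. v \<in> L \<and> d \<in> L \<and> d \<noteq> 0 \<and> v / d = x}"

lemma fraction_setI: "v \<in> L \<Longrightarrow> d \<in> L \<Longrightarrow> d \<noteq> 0 \<Longrightarrow> v / d \<in> fraction_set"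
  by (auto simp: fraction_set_def)

lemma L_subset_fraction_set: "L \<subseteq> fraction_set"
  using fraction_setI[OF _ one_mem] by auto

lemma nonzerodivisors_eq: "nonzerodivisors R = \<psi> ` (L - {0})"
proof -
  have "nonzerodivisors R = carrier R - {\<zero>\<^bsub>R\<^esub>}"
  proof (intro equalityI subsetI)
    fix d assume d: "d \<in> nonzerodivisors R"
    have "d \<noteq> \<zero>\<^bsub>R\<^esub>"
    proof
      assume "d = \<zero>\<^bsub>R\<^esub>"
      with d have "\<zero>\<^bsub>R\<^esub> \<otimes>\<^bsub>R\<^esub> \<one>\<^bsub>R\<^esub> = \<zero>\<^bsub>R\<^esub> \<longrightarrow> \<one>\<^bsub>R\<^esub> = \<zero>\<^bsub>R\<^esub>"
        unfolding nonzerodivisors_def using one_closed by blast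
      then show False using one_not_zero by simp
    qed
    with d show "d \<in> carrier R - {\<zero>\<^bsub>R\<^esub>}" by (simp add: nonzerodivisors_def)
  qed (auto simp: nonzerodivisors_def dest: integral)
  also have "\<dots> = \<psi> ` L - \<psi> ` {0}" by (simp add: carrier_eq zero_\<psi>)
  also have "\<dots> = \<psi> ` (L - {0})" using inj_\<psi> zero_mem by (intro inj_on_image_set_diff[symmetric]) auto
  finally show ?thesis .
qed

lemma mem_ring_frac:
  "(b, e) \<in> ring_frac R a d \<longleftrightarrow> a \<in> carrier R \<and> b \<in> carrier R \<and>
    d \<in> nonzerodivisors R \<and> e \<in> nonzerodivisors R \<and> a \<otimes>\<^bsub>R\<^esub> e = b \<otimes>\<^bsub>R\<^esub> d"
  by (simp add: ring_frac_def frac_rel_def)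

lemma ring_frac_\<psi>:
  assumes v: "v \<in> L" "d \<in> L" "d \<noteq> 0"
  shows "ring_frac R (\<psi> v) (\<psi> d) = \<phi> (v / d)"
proof (intro equalityI subsetI)
  fix z assume *: "z \<in> ring_frac R (\<psi> v) (\<psi> d)"
  obtain b e where z: "z = (b, e)" by (cases z)
  from * have b: "b \<in> carrier R" "e \<in> nonzerodivisors R" "\<psi> v \<otimes>\<^bsub>R\<^esub> e = b \<otimes>\<^bsub>R\<^esub> \<psi> d"
    unfolding z mem_ring_frac by simp_all
  obtain w where w: "b = \<psi> w" "w \<in> L" using b(1) unfolding carrier_eq by (rule imageE)
  obtain w' where w': "e = \<psi> w'" "w' \<in> L - {0}" using b(2) unfolding nonzerodivisors_eq by (rule imageE)
  have "v * w' = w * d"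
    using b(3) v w w' by (simp add: mult_\<psi> \<psi>_eq_iff mult_mem)
  with w' v have "w / w' = v / d" by (simp add: frac_eq_eq)
  with w w' z show "z \<in> \<phi> (v / d)"
    unfolding \<phi>_def by (intro CollectI exI[of _ w] exI[of _ w']) simp
next
  fix z assume "z \<in> \<phi> (v / d)"
  then obtain w w' where w: "z = (\<psi> w, \<psi> w')" "w \<in> L" "w' \<in> L" "w' \<noteq> 0" "w / w' = v / d"
    unfolding \<phi>_def by auto
  then have "v * w' = w * d" using v by (simp add: frac_eq_eq)
  then show "z \<in> ring_frac R (\<psi> v) (\<psi> d)"
    unfolding w(1) mem_ring_frac nonzerodivisors_eq using w v by (simp add: mult_\<psi> \<psi>_closed)
qed

lemma \<phi>_nonempty: "x \<in> fraction_set \<Longrightarrow> \<phi> x \<noteq> {}"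
  by (auto simp: fraction_set_def \<phi>_def)

text \<open>The operations on fractions are unions over representatives. When the result does not
  depend on the representatives, the union over nonempty classes collapses to that one
  value.\<close>

lemma Union_\<phi>:
  assumes "x \<in> fraction_set" "y \<in> fraction_set"
    and "\<And>v d w e. v \<in> L \<Longrightarrow> d \<in> L \<Longrightarrow> d \<noteq> 0 \<Longrightarrow> w \<in> L \<Longrightarrow> e \<in> L \<Longrightarrow> e \<noteq> 0 \<Longrightarrow> v / d = x \<Longrightarrow> w / e = y \<Longrightarrow>
      g (\<psi> v) (\<psi> d) (\<psi> w) (\<psi> e) = Y"
  shows "(\<Union>(a, d)\<in>\<phi> x. \<Union>(b, e)\<in>\<phi> y. g a d b e) = Y"
proof (intro equalityI subsetI)
  fix z assume "z \<in> (\<Union>(a, d)\<in>\<phi> x. \<Union>(b, e)\<in>\<phi> y. g a d b e)"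
  then show "z \<in> Y" using assms(3) unfolding \<phi>_def by blast
next
  fix z assume z: "z \<in> Y"
  obtain v d where v: "v \<in> L" "d \<in> L" "d \<noteq> 0" "v / d = x" using assms(1) unfolding fraction_set_def by blast
  obtain w e where w: "w \<in> L" "e \<in> L" "e \<noteq> 0" "w / e = y" using assms(2) unfolding fraction_set_def by blast
  have "(\<psi> v, \<psi> d) \<in> \<phi> x" "(\<psi> w, \<psi> e) \<in> \<phi> y" using v w unfolding \<phi>_def by blast+
  moreover have "z \<in> g (\<psi> v) (\<psi> d) (\<psi> w) (\<psi> e)" using assms(3)[of v d w e] v w z by blast
  ultimately show "z \<in> (\<Union>(a, d)\<in>\<phi> x. \<Union>(b, e)\<in>\<phi> y. g a d b e)" by blast
qed

lemma field_subring_fraction_set: "field_subring fraction_set"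
proof
  show "0 \<in> fraction_set" "1 \<in> fraction_set" using L_subset_fraction_set zero_mem one_mem by auto
next
  fix a b assume "a \<in> fraction_set" "b \<in> fraction_set"
  then obtain v d w e where *: "a = v / d" "v \<in> L" "d \<in> L" "d \<noteq> 0" "b = w / e" "w \<in> L" "e \<in> L" "e \<noteq> 0"
    unfolding fraction_set_def by blast
  have "a + b = (v * e + w * d) / (d * e)" using * by (simp add: add_frac_eq)
  then show "a + b \<in> fraction_set" using * by (simp add: fraction_setI add_mem mult_mem)
  have "a * b = (v * w) / (d * e)" using * by simp
  then show "a * b \<in> fraction_set" using * fraction_setI[of "v * w" "d * e"] by (simp add: mult_mem)
  have "- a = (- v) / d" using * by simp
  then show "- a \<in> fraction_set" using * fraction_setI[of "- v" d] by (simp add: uminus_mem)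
qed

lemma parametrized_fractions: "parametrized_ring fraction_set (total_fraction_ring R) \<phi>"
proof (rule parametrized_ring.intro[OF field_subring_fraction_set], unfold_locales)
  show "inj_on \<phi> fraction_set"
  proof (rule inj_onI)
    fix x y assume "x \<in> fraction_set" "y \<in> fraction_set" "\<phi> x = \<phi> y"
    moreover obtain z where "z \<in> \<phi> x" using \<phi>_nonempty[OF \<open>x \<in> fraction_set\<close>] by blast
    ultimately have "z \<in> \<phi> x" "z \<in> \<phi> y" by auto
    then show "x = y" unfolding \<phi>_def by (auto simp: \<psi>_eq_iff)
  qed
  show "carrier (total_fraction_ring R) = \<phi> ` fraction_set"
  proof -
    have "carrier (total_fraction_ring R) = {ring_frac R (\<psi> v) (\<psi> d) | v d. v \<in> L \<and> d \<in> L \<and> d \<noteq> 0}"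
      by (auto simp: total_fraction_ring_def carrier_eq nonzerodivisors_eq)
    also have "\<dots> = {\<phi> (v / d) | v d. v \<in> L \<and> d \<in> L \<and> d \<noteq> 0}" using ring_frac_\<psi> by blast
    finally show ?thesis unfolding fraction_set_def by blast
  qed
  show "\<one>\<^bsub>total_fraction_ring R\<^esub> = \<phi> 1" "\<zero>\<^bsub>total_fraction_ring R\<^esub> = \<phi> 0"
    using ring_frac_\<psi>[OF one_mem one_mem] ring_frac_\<psi>[OF zero_mem one_mem]
    by (simp_all add: total_fraction_ring_def one_\<psi> zero_\<psi>)
  fix x y assume xy: "x \<in> fraction_set" "y \<in> fraction_set"
  show "\<phi> x \<otimes>\<^bsub>total_fraction_ring R\<^esub> \<phi> y = \<phi> (x * y)"
    unfolding total_fraction_ring_def monoid.simps ring.simps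
    by (rule Union_\<phi>[OF xy]) (auto simp: mult_\<psi> ring_frac_\<psi> mult_mem)
  show "\<phi> x \<oplus>\<^bsub>total_fraction_ring R\<^esub> \<phi> y = \<phi> (x + y)"
    unfolding total_fraction_ring_def monoid.simps ring.simps
    by (rule Union_\<phi>[OF xy]) (auto simp: mult_\<psi> add_\<psi> ring_frac_\<psi> mult_mem add_mem add_frac_eq)
qed

definition integral_set :: "'o set" where
  "integral_set = {b \<in> fraction_set. integral_elem L b}"

text \<open>Lists carry the leading coefficient first while \<open>Poly\<close> expects the constant
  term first; hence the reversals in both directions.\<close>

lemma integral_over_\<phi>:
  assumes b: "b \<in> fraction_set"
  shows "integral_over (total_fraction_ring R) ((\<lambda>a. ring_frac R a \<one>\<^bsub>R\<^esub>) ` carrier R) (\<phi> b) \<longleftrightarrow> integral_elem L b"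
proof -
  interpret T: parametrized_ring fraction_set "total_fraction_ring R" \<phi> by (rule parametrized_fractions)
  have S: "(\<lambda>a. ring_frac R a \<one>\<^bsub>R\<^esub>) ` carrier R = \<phi> ` L"
    unfolding carrier_eq one_\<psi> image_image by (intro image_cong refl) (simp add: ring_frac_\<psi> one_mem)
  have L: "L \<subseteq> fraction_set" by (rule L_subset_fraction_set)
  show ?thesis
    unfolding S
  proof
    assume "integral_over (total_fraction_ring R) (\<phi> ` L) (\<phi> b)"
    then obtain p where p: "set p \<subseteq> \<phi> ` L" "p \<noteq> []" "hd p = \<phi> 1" "ring.eval (total_fraction_ring R) p (\<phi> b) = \<phi> 0"
      unfolding integral_over_def T.one_\<psi> T.zero_\<psi> by blast
    obtain xs where xs: "p = map \<phi> xs" "set xs \<subseteq> L"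
    proof -
      have "p \<in> lists (\<phi> ` L)" using p(1) by auto
      then show ?thesis using that by (auto simp: lists_image)
    qed
    obtain x xs' where xs': "xs = x # xs'" using p(2) xs(1) by (cases xs) auto
    have "x = 1" using p(3) xs L by (auto simp: xs' T.\<psi>_eq_iff T.one_mem subset_iff)
    have Pb: "poly (Poly (rev xs)) b = 0"
    proof -
      have "poly (Poly (rev xs)) b \<in> fraction_set"
        using xs(2) L b by (intro T.poly_mem T.coeff_Poly_mem) auto
      moreover have "\<phi> (poly (Poly (rev xs)) b) = \<phi> 0"
        using p(4) T.eval_\<psi>[of xs b] xs L b by auto
      ultimately show ?thesis by (simp add: T.\<psi>_eq_iff T.zero_mem)
    qed
    \<comment> \<open>The last entry of \<open>rev xs\<close> is 1, so no trailing zeros are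
      stripped and the leading coefficient remains visible.\<close>
    have cP: "coeffs (Poly (rev xs)) = rev xs"
      by (rule coeffs_Poly[THEN trans]) (simp add: xs' \<open>x = 1\<close> strip_while_def)
    have "Polynomial.lead_coeff (Poly (rev xs)) = last (coeffs (Poly (rev xs)))"
    proof (rule last_coeffs_eq_coeff_degree[symmetric], rule notI)
      assume "Poly (rev xs) = 0"
      then have "coeffs (Poly (rev xs)) = []" by simp
      with cP show False by (simp add: xs')
    qed
    also have "\<dots> = 1" unfolding cP by (simp add: xs' \<open>x = 1\<close>)
    finally show "integral_elem L b"
      unfolding integral_elem_def using Pb xs(2)
      by (intro exI[of _ "Poly (rev xs)"] conjI allI coeff_Poly_mem) auto
  next
    assume "integral_elem L b"
    then obtain p where p: "Polynomial.lead_coeff p = 1" "\<And>i. poly.coeff p i \<in> L" "poly p b = 0" unfolding integral_elem_def by blast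
    then have p0: "p \<noteq> 0" by auto
    let ?xs = "rev (coeffs p)"
    have sub: "set ?xs \<subseteq> L" using p(2) by (auto simp: set_coeffs_subset_singleton_0_iff coeffs_def)
    have "hd ?xs = 1" using p(1) p0 by (simp add: hd_rev last_coeffs_eq_coeff_degree)
    then have "hd (map \<phi> ?xs) = \<phi> 1" using p0 by (simp add: hd_map)
    moreover have "ring.eval (total_fraction_ring R) (map \<phi> ?xs) (\<phi> b) = \<phi> 0"
      using T.eval_\<psi>[of ?xs b] sub L b p(3) by auto
    ultimately show "integral_over (total_fraction_ring R) (\<phi> ` L) (\<phi> b)"
      unfolding integral_over_def T.one_\<psi> T.zero_\<psi> using sub p0
      by (intro exI[of _ "map \<phi> ?xs"]) auto
  qed
qed

lemma field_subring_integral_set: "field_subring integral_set"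
proof -
  interpret F: field_subring fraction_set by (rule field_subring_fraction_set)
  interpret I: field_subring "{z. integral_elem L z}" by (rule field_subring_integral)
  show ?thesis
    using F.zero_mem F.one_mem F.add_mem F.mult_mem F.uminus_mem I.zero_mem I.one_mem I.add_mem I.mult_mem I.uminus_mem
    unfolding integral_set_def by unfold_locales auto
qed

lemma parametrized_normalization: "parametrized_ring integral_set (normalization R) \<phi>"
proof -
  interpret T: parametrized_ring fraction_set "total_fraction_ring R" \<phi> by (rule parametrized_fractions)
  have sub: "integral_set \<subseteq> fraction_set" by (auto simp: integral_set_def)
  have c: "carrier (normalization R) = \<phi> ` integral_set"
    unfolding normalization_def Let_def integral_set_def
    using integral_over_\<phi> by (auto simp: T.carrier_eq)
  show ?thesis
  proof (rule parametrized_ring.intro[OF field_subring_integral_set], unfold_locales)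
    show "inj_on \<phi> integral_set" using T.inj_\<psi> sub by (rule inj_on_subset)
    show "carrier (normalization R) = \<phi> ` integral_set" by (rule c)
    show "\<one>\<^bsub>normalization R\<^esub> = \<phi> 1" "\<zero>\<^bsub>normalization R\<^esub> = \<phi> 0"
      using T.one_\<psi> T.zero_\<psi> by (simp_all add: normalization_def Let_def)
    fix x y assume "x \<in> integral_set" "y \<in> integral_set"
    then show "\<phi> x \<otimes>\<^bsub>normalization R\<^esub> \<phi> y = \<phi> (x * y)" "\<phi> x \<oplus>\<^bsub>normalization R\<^esub> \<phi> y = \<phi> (x + y)"
      using T.mult_\<psi>[of x y] T.add_\<psi>[of x y] sub by (auto simp: normalization_def Let_def)
  qed
qed

end

section \<open>Parametrizing the coordinate ring and the normalization of the curve\<close>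

context curve_model
begin

text \<open>A fibre of \<open>ev\<close>, which by \<open>coset_eq\<close> is a coset of the curve
  ideal.\<close>

definition \<psi> :: "'o \<Rightarrow> 'a poly poly set" where
  "\<psi> v = {p. ev p = v}"

lemma coset_eq: "curve_ideal m f +>\<^bsub>ring_of_type_algebra\<^esub> p = \<psi> (ev p)"
proof -
  have I: "curve_ideal m f = {p. ev p = 0}"
    unfolding curve_ideal_def cgenideal_def ev_eq_0_iff
    by (auto simp: ring_of_type_algebra_def dvd_def mult.commute)
  have "curve_ideal m f +>\<^bsub>ring_of_type_algebra\<^esub> p = {h + p | h. ev h = 0}"
    unfolding a_r_coset_def' I by (auto simp: ring_of_type_algebra_def)
  also have "\<dots> = \<psi> (ev p)"
  proof (intro equalityI subsetI)
    fix x assume "x \<in> \<psi> (ev p)"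
    then have "x = (x - p) + p" "ev (x - p) = 0" by (simp_all add: \<psi>_def ev.hom_diff)
    then show "x \<in> {h + p | h. ev h = 0}" by blast
  qed (auto simp: \<psi>_def ev.hom_add)
  finally show ?thesis .
qed

lemma parametrized_coord_ring: "parametrized_ring (range ev) (coord_ring m f) \<psi>"
proof (rule parametrized_ring.intro[OF field_subring_range[OF ev.type_ring_hom_axioms]], unfold_locales)
  show "inj_on \<psi> (range ev)" by (auto simp: inj_on_def \<psi>_def)
  show "carrier (coord_ring m f) = \<psi> ` range ev"
    by (auto simp: coord_ring_def FactRing_def A_RCOSETS_def' coset_eq) (auto simp: ring_of_type_algebra_def)
  show "\<one>\<^bsub>coord_ring m f\<^esub> = \<psi> 1"
    by (simp add: coord_ring_def FactRing_def coset_eq) (simp add: ring_of_type_algebra_def ev.hom_1)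
  show "\<zero>\<^bsub>coord_ring m f\<^esub> = \<psi> 0"
    by (auto simp: coord_ring_def FactRing_def \<psi>_def curve_ideal_def cgenideal_def ev_eq_0_iff ring_of_type_algebra_def dvd_def mult.commute)
  fix v w assume "v \<in> range ev" "w \<in> range ev"
  then obtain p r where pr: "v = ev p" "w = ev r" by blast
  have "\<psi> v \<otimes>\<^bsub>coord_ring m f\<^esub> \<psi> w = (\<Union>a\<in>\<psi> v. \<Union>b\<in>\<psi> w. \<psi> (v * w))"
    by (auto simp: coord_ring_def FactRing_def rcoset_mult_def coset_eq) (auto simp: ring_of_type_algebra_def \<psi>_def ev.hom_mult)
  also have "\<dots> = \<psi> (v * w)" using pr by (auto simp: \<psi>_def)
  finally show "\<psi> v \<otimes>\<^bsub>coord_ring m f\<^esub> \<psi> w = \<psi> (v * w)" .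
  have "\<psi> v \<oplus>\<^bsub>coord_ring m f\<^esub> \<psi> w = {a + b | a b. ev a = v \<and> ev b = w}"
    by (auto simp: coord_ring_def FactRing_def set_add_def' ring_of_type_algebra_def \<psi>_def)
  also have "\<dots> = \<psi> (v + w)"
  proof (intro equalityI subsetI)
    fix x assume "x \<in> \<psi> (v + w)"
    then have "x = p + (x - p)" "ev p = v" "ev (x - p) = w" by (simp_all add: \<psi>_def pr ev.hom_diff)
    then show "x \<in> {a + b | a b. ev a = v \<and> ev b = w}" by blast
  qed (auto simp: \<psi>_def ev.hom_add)
  finally show "\<psi> v \<oplus>\<^bsub>coord_ring m f\<^esub> \<psi> w = \<psi> (v + w)" .
qed

sublocale A: parametrized_ring "range ev" "coord_ring m f" \<psi>
  by (rule parametrized_coord_ring)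

lemma fraction_set_eq: "A.fraction_set = function_field"
  unfolding A.fraction_set_def function_field_def by blast

lemma integral_set_eq: "A.integral_set = normal_closure"
  unfolding A.integral_set_def normal_closure_def fraction_set_eq ..

lemma parametrized_norm_ring: "parametrized_ring normal_closure (norm_ring m f) A.\<phi>"
  using A.parametrized_normalization unfolding norm_ring_def integral_set_eq .

lemma coord_map_eq: "coord_map m f p = \<psi> (j p)"
  by (simp add: coord_map_def coset_eq)

lemma norm_map_eq: "norm_map m f p = A.\<phi> (j p)"
  using A.ring_frac_\<psi>[of "j p" 1] by (simp add: norm_map_def coord_map_eq A.one_\<psi> A.one_mem flip: ev_const)

end

section \<open>Geometric irreducibility\<close>

lemma frag_extend_fun_add: "frag_extend (\<lambda>z. F z + G z) u = frag_extend F u + frag_extend G u"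
  by (simp add: frag_extend_def frag_cmul_distrib2 sum.distrib)

lemma frag_extend_fun_diff: "frag_extend (\<lambda>z. F z - G z) u = frag_extend F u - frag_extend G u"
  using frag_extend_fun_add[of "\<lambda>z. F z - G z" G u] by simp

lemma frag_extend_fun_0: "frag_extend (\<lambda>z. 0) u = 0"
  by (simp add: frag_extend_def)

definition pair_mult :: "('r, 'x) ring_scheme \<Rightarrow> (('r \<times> 'k::field) \<Rightarrow>\<^sub>0 int) \<Rightarrow> (('r \<times> 'k) \<Rightarrow>\<^sub>0 int) \<Rightarrow> (('r \<times> 'k) \<Rightarrow>\<^sub>0 int)" where
  "pair_mult R u v = frag_extend (\<lambda>(a, b). frag_extend (\<lambda>(c, d). frag_of (a \<otimes>\<^bsub>R\<^esub> c, b * d)) v) u"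

lemma pair_mult_0 [simp]: "pair_mult R 0 v = 0" "pair_mult R u 0 = 0"
  by (simp_all add: pair_mult_def case_prod_beta' frag_extend_fun_0)

lemma pair_mult_diff:
  "pair_mult R (u - u') v = pair_mult R u v - pair_mult R u' v"
  "pair_mult R u (v - v') = pair_mult R u v - pair_mult R u v'"
  by (simp_all add: pair_mult_def frag_extend_diff case_prod_beta' frag_extend_fun_diff)

lemma pair_mult_add:
  "pair_mult R (u + u') v = pair_mult R u v + pair_mult R u' v"
  by (simp add: pair_mult_def frag_extend_add)

lemma pair_mult_of [simp]: "pair_mult R (frag_of (a, b)) (frag_of (c, d)) = frag_of (a \<otimes>\<^bsub>R\<^esub> c, b * d)"
  by (simp add: pair_mult_def)

lemma pair_ring_simps:
  fixes R :: "('r, 'x) ring_scheme"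
  defines "P \<equiv> pair_ring R (ring_of_type_algebra :: 'k::field ring)"
  shows "carrier P = {u. Poly_Mapping.keys u \<subseteq> carrier R \<times> UNIV}" "monoid.mult P = pair_mult R"
    "monoid.one P = frag_of (\<one>\<^bsub>R\<^esub>, 1)" "ring.zero P = 0" "ring.add P = (+)"
  by (simp_all add: P_def pair_ring_def ring_of_type_algebra_def pair_mult_def[abs_def])

text \<open>This and the ring laws below hold for generators and pass to differences since
  \<open>pair_mult\<close> is biadditive, which is the pattern of
  \<open>frag_induction\<close>.\<close>

lemma (in cring) keys_pair_mult:
  assumes "Poly_Mapping.keys u \<subseteq> carrier R \<times> UNIV" "Poly_Mapping.keys v \<subseteq> carrier R \<times> UNIV"
  shows "Poly_Mapping.keys (pair_mult R u v) \<subseteq> carrier R \<times> UNIV"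
  using assms(1)
proof (induction u rule: frag_induction)
  case (one x)
  show ?case
    using assms(2)
  proof (induction v rule: frag_induction)
    case (diff a b)
    then show ?case using keys_diff[of "pair_mult R (frag_of x) a" "pair_mult R (frag_of x) b"]
      by (auto simp: pair_mult_diff)
  qed (use one in \<open>auto split: prod.splits\<close>)
next
  case (diff a b)
  then show ?case using keys_diff[of "pair_mult R a v" "pair_mult R b v"] by (auto simp: pair_mult_diff)
qed auto

lemma (in cring) pair_mult_comm:
  assumes "Poly_Mapping.keys u \<subseteq> carrier R \<times> UNIV" "Poly_Mapping.keys v \<subseteq> carrier R \<times> UNIV"
  shows "pair_mult R u v = pair_mult R v u"
  using assms(1)
proof (induction u rule: frag_induction)
  case (one x)
  show ?case
    using assms(2) by (induction v rule: frag_induction) (use one in \<open>auto simp: pair_mult_diff m_comm mult.commute\<close>)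
qed (simp_all add: pair_mult_diff)

lemma (in cring) pair_mult_assoc:
  assumes "Poly_Mapping.keys u \<subseteq> carrier R \<times> UNIV" "Poly_Mapping.keys v \<subseteq> carrier R \<times> UNIV" "Poly_Mapping.keys w \<subseteq> carrier R \<times> UNIV"
  shows "pair_mult R (pair_mult R u v) w = pair_mult R u (pair_mult R v w)"
  using assms(1)
proof (induction u rule: frag_induction)
  case (one x)
  show ?case
    using assms(2)
  proof (induction v rule: frag_induction)
    case (one x')
    show ?case
      using assms(3) by (induction w rule: frag_induction)
        (use one \<open>x \<in> carrier R \<times> UNIV\<close> in \<open>auto simp: pair_mult_diff m_assoc mult.assoc\<close>)
  qed (simp_all add: pair_mult_diff)
qed (simp_all add: pair_mult_diff)

lemma (in cring) pair_mult_one: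
  assumes "Poly_Mapping.keys u \<subseteq> carrier R \<times> UNIV"
  shows "pair_mult R (frag_of (\<one>, 1)) u = u" "pair_mult R u (frag_of (\<one>, 1)) = u"
  using assms by (induction u rule: frag_induction) (auto simp: pair_mult_diff)

lemma (in cring) cring_pair_ring: "cring (pair_ring R (ring_of_type_algebra :: 'k::field ring))"
proof (rule cringI)
  let ?P = "pair_ring R (ring_of_type_algebra :: 'k ring)"
  show "abelian_group ?P"
  proof (rule abelian_groupI)
    show "\<exists>y\<in>carrier ?P. y \<oplus>\<^bsub>?P\<^esub> x = \<zero>\<^bsub>?P\<^esub>" if "x \<in> carrier ?P" for x
      using that by (intro bexI[of _ "- x"]) (auto simp: pair_ring_simps)
    show "x \<oplus>\<^bsub>?P\<^esub> y \<in> carrier ?P" if "x \<in> carrier ?P" "y \<in> carrier ?P" for x y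
      using that keys_add[of x y] by (auto simp: pair_ring_simps)
  qed (auto simp: pair_ring_simps add_ac)
  show "comm_monoid ?P"
    by (rule comm_monoidI) (auto simp: pair_ring_simps pair_mult_assoc pair_mult_one pair_mult_comm dest: keys_pair_mult[THEN subsetD, rotated 2])
qed (simp add: pair_ring_simps pair_mult_add)

section \<open>The tensor product realized inside a field\<close>

context parametrized_ring
begin

context
  fixes \<kappa> :: "'k::field \<Rightarrow> 'o"
  assumes \<kappa>: "type_ring_hom \<kappa>"
begin

interpretation \<kappa>: type_ring_hom \<kappa> by (rule \<kappa>)

definition pair_val :: "'b \<times> 'k \<Rightarrow> 'o" where
  "pair_val = (\<lambda>(a, b). inv_into L \<psi> a * \<kappa> b)"

text \<open>The additive extension of (\<open>\<psi> v\<close>, b) \<mapsto> v *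
  \<open>\<kappa> b\<close>. It induces the map from the tensor product to the field, and the point
  is that its kernel is exactly the ideal of tensor relations.\<close>

definition total_val :: "(('b \<times> 'k) \<Rightarrow>\<^sub>0 int) \<Rightarrow> 'o" where
  "total_val u = (\<Sum>z\<in>Poly_Mapping.keys u. of_int (Poly_Mapping.lookup u z) * pair_val z)"

lemma pair_val_\<psi> [simp]: "v \<in> L \<Longrightarrow> pair_val (\<psi> v, b) = v * \<kappa> b"
  by (simp add: pair_val_def inv_into_f_f[OF inj_\<psi>])

lemma total_val_superset:
  assumes "finite A" "Poly_Mapping.keys u \<subseteq> A"
  shows "total_val u = (\<Sum>z\<in>A. of_int (Poly_Mapping.lookup u z) * pair_val z)"
  unfolding total_val_def using assms by (intro sum.mono_neutral_left) (auto simp: in_keys_iff)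

lemma total_val_diff: "total_val (u - v) = total_val u - total_val v"
proof -
  let ?A = "Poly_Mapping.keys u \<union> Poly_Mapping.keys v"
  have "Poly_Mapping.keys (u - v) \<subseteq> ?A" by (rule keys_diff)
  then show ?thesis
    by (simp add: total_val_superset[of ?A] lookup_minus left_diff_distrib sum_subtractf)
qed

lemma total_val_of [simp]: "total_val (frag_of z) = pair_val z"
  by (simp add: total_val_def)

lemma total_val_0 [simp]: "total_val 0 = 0"
  by (simp add: total_val_def)

lemma total_val_add: "total_val (u + v) = total_val u + total_val v"
  using total_val_diff[of u "0 - v"] total_val_diff[of 0 v] by simp

lemma total_val_sum: "total_val (sum F A) = (\<Sum>x\<in>A. total_val (F x))"
  by (induction A rule: infinite_finite_induct) (simp_all add: total_val_add)

lemma total_val_mult: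
  assumes "Poly_Mapping.keys u \<subseteq> carrier R \<times> UNIV" "Poly_Mapping.keys v \<subseteq> carrier R \<times> UNIV"
  shows "total_val (pair_mult R u v) = total_val u * total_val v"
  using assms(1)
proof (induction u rule: frag_induction)
  case (one x)
  show ?case
    using assms(2)
  proof (induction v rule: frag_induction)
    case (one x')
    obtain v b v' b' where "x = (\<psi> v, b)" "x' = (\<psi> v', b')" "v \<in> L" "v' \<in> L"
      using one \<open>x \<in> carrier R \<times> UNIV\<close> unfolding carrier_eq by blast
    then show ?case by (simp add: mult_\<psi> mult_mem \<kappa>.hom_mult)
  qed (simp_all add: pair_mult_diff total_val_diff right_diff_distrib)
qed (simp_all add: pair_mult_diff total_val_diff left_diff_distrib)

text \<open>Since \<open>L\<close> and the image of \<open>\<kappa>\<close> are linearly disjoint, the tensor product embeds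
  into the field and is therefore a domain.\<close>

lemma tensor_irreducible_spectrum:
  fixes \<sigma> :: "'k0::field \<Rightarrow> 'k" and \<rho> :: "'k0 \<Rightarrow> 'o"
  assumes \<sigma>: "inj_type_ring_hom \<sigma>" and \<rho>: "\<And>c. \<rho> c \<in> L" and comp: "\<And>c. \<kappa> (\<sigma> c) = \<rho> c"
    and disj: "\<And>C b. finite C \<Longrightarrow> (\<And>l. (\<Sum>c\<in>C. \<sigma> (l c) * c) = 0 \<Longrightarrow> \<forall>c\<in>C. l c = 0) \<Longrightarrow>
      (\<And>c. c \<in> C \<Longrightarrow> b c \<in> L) \<Longrightarrow> (\<Sum>c\<in>C. b c * \<kappa> c) = 0 \<Longrightarrow> \<forall>c\<in>C. b c = 0"
  shows "irreducible_spectrum (tensor_ring R (\<lambda>c. \<psi> (\<rho> c)) (ring_of_type_algebra :: 'k ring) \<sigma>)"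
proof -
  interpret \<sigma>: inj_type_ring_hom \<sigma> by (rule \<sigma>)
  define K where "K = (ring_of_type_algebra :: 'k ring)"
  define P where "P = pair_ring R K"
  note Ps = pair_ring_simps[of R, where 'k='k, folded K_def, folded P_def]
  have Ks: "carrier K = UNIV" "monoid.mult K = (*)" "ring.add K = (+)"
    by (simp_all add: K_def ring_of_type_algebra_def)
  interpret P: cring P unfolding P_def K_def by (rule cring_pair_ring)
  define rel where "rel = tensor_relations R (\<lambda>c. \<psi> (\<rho> c)) K \<sigma>"
  define I where "I = Idl\<^bsub>P\<^esub> rel"
  have rel1: "frag_of (\<psi> (v + v'), b) - frag_of (\<psi> v, b) - frag_of (\<psi> v', b) \<in> rel" if "v \<in> L" "v' \<in> L" for v v' b
    unfolding rel_def tensor_relations_def using that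
    by (intro UnI1 CollectI exI[of _ "\<psi> v"] exI[of _ "\<psi> v'"] exI[of _ b]) (simp add: add_\<psi> \<psi>_closed Ks)
  have rel2: "frag_of (\<psi> v, b + b') - frag_of (\<psi> v, b) - frag_of (\<psi> v, b') \<in> rel" if "v \<in> L" for v b b'
    unfolding rel_def tensor_relations_def using that
    by (intro UnI1[OF UnI2] CollectI exI[of _ "\<psi> v"] exI[of _ b] exI[of _ b']) (simp add: \<psi>_closed Ks)
  have rel3: "frag_of (\<psi> (\<rho> c * v), b) - frag_of (\<psi> v, \<sigma> c * b) \<in> rel" if "v \<in> L" for v b c
    unfolding rel_def tensor_relations_def using that
    by (intro UnI2 CollectI exI[of _ "\<psi> v"] exI[of _ b] exI[of _ c]) (simp add: mult_\<psi> \<rho> \<psi>_closed Ks)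
  \<comment> \<open>The values lie in a field, so this kernel is prime; once it equals
    \<open>I\<close>, the quotient is a domain.\<close>
  define Ker where "Ker = {u \<in> carrier P. total_val u = 0}"
  have keys2: "Poly_Mapping.keys (u - v) \<subseteq> S" if "Poly_Mapping.keys u \<subseteq> S" "Poly_Mapping.keys v \<subseteq> S"
    for u v :: "('b \<times> 'k) \<Rightarrow>\<^sub>0 int" and S
    using that keys_diff[of u v] by blast
  have relKer: "rel \<subseteq> Ker"
  proof
    fix t assume "t \<in> rel"
    then consider v v' b where "t = frag_of (\<psi> v \<oplus>\<^bsub>R\<^esub> \<psi> v', b) - frag_of (\<psi> v, b) - frag_of (\<psi> v', b)" "v \<in> L" "v' \<in> L"
      | v b b' where "t = frag_of (\<psi> v, b + b') - frag_of (\<psi> v, b) - frag_of (\<psi> v, b')" "v \<in> L"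
      | v b c where "t = frag_of (\<psi> (\<rho> c) \<otimes>\<^bsub>R\<^esub> \<psi> v, b) - frag_of (\<psi> v, \<sigma> c * b)" "v \<in> L"
      unfolding rel_def tensor_relations_def carrier_eq Ks by auto
    then show "t \<in> Ker"
    proof cases
      case 1
      have "t \<in> carrier P" unfolding 1(1) Ps mem_Collect_eq by (intro keys2) (use 1 in \<open>auto simp: add_\<psi> \<psi>_closed add_mem\<close>)
      moreover have "total_val t = 0"
        unfolding 1(1) using 1 by (simp add: total_val_diff add_\<psi> add_mem distrib_right)
      ultimately show ?thesis by (simp add: Ker_def)
    next
      case 2
      have "t \<in> carrier P" unfolding 2(1) Ps mem_Collect_eq by (intro keys2) (use 2 in \<open>auto simp: \<psi>_closed\<close>)
      moreover have "total_val t = 0"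
        unfolding 2(1) using 2 by (simp add: total_val_diff \<kappa>.hom_add distrib_left)
      ultimately show ?thesis by (simp add: Ker_def)
    next
      case 3
      have "t \<in> carrier P" unfolding 3(1) Ps mem_Collect_eq by (intro keys2) (use 3 in \<open>auto simp: \<psi>_closed mult_\<psi> \<rho> mult_mem\<close>)
      moreover have "total_val t = 0"
        unfolding 3(1) using 3 by (simp add: total_val_diff mult_\<psi> \<rho> mult_mem \<kappa>.hom_mult comp mult_ac)
      ultimately show ?thesis by (simp add: Ker_def)
    qed
  qed
  have relP: "rel \<subseteq> carrier P" using relKer by (auto simp: Ker_def)
  have idI: "ideal I P" unfolding I_def by (rule P.genideal_ideal[OF relP])
  have relI: "t \<in> I" if "t \<in> rel" for t using P.genideal_self[OF relP] that unfolding I_def by blast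
  have idK: "ideal Ker P"
  proof -
    have "ring (ring_of_type_algebra :: 'o ring)" by (rule ring_from_type_algebra)
    then have "ring_hom_ring P (ring_of_type_algebra :: 'o ring) total_val"
      by (intro ring_hom_ringI P.ring_axioms)
         (auto simp: Ps ring_of_type_algebra_def total_val_mult total_val_add one_\<psi> one_mem \<kappa>.hom_1)
    then have "ideal (a_kernel P (ring_of_type_algebra :: 'o ring) total_val) P"
      by (rule ring_hom_ring.kernel_is_ideal)
    then show ?thesis by (simp add: a_kernel_def' Ker_def ring_of_type_algebra_def)
  qed
  have primeK: "primeideal Ker P"
  proof (rule primeidealI[OF idK P.is_cring])
    have "\<one>\<^bsub>P\<^esub> \<in> carrier P" "\<one>\<^bsub>P\<^esub> \<notin> Ker" by (auto simp: Ker_def Ps one_\<psi> one_mem \<psi>_closed \<kappa>.hom_1)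
    then show "carrier P \<noteq> Ker" by blast
    show "a \<in> Ker \<or> b \<in> Ker" if "a \<in> carrier P" "b \<in> carrier P" "a \<otimes>\<^bsub>P\<^esub> b \<in> Ker" for a b
      using that by (auto simp: Ker_def Ps total_val_mult)
  qed
  have IK: "I \<subseteq> Ker" unfolding I_def by (rule P.genideal_minimal[OF idK relKer])
  have I_carr: "u \<in> carrier P" if "u \<in> I" for u using ideal.Icarr[OF idI that] .
  have I_diff: "u - v \<in> I" if "u \<in> I" "v \<in> I" for u v
  proof -
    have "- v \<in> carrier P" using I_carr[OF that(2)] by (simp add: Ps)
    then have "\<ominus>\<^bsub>P\<^esub> v = - v" using I_carr[OF that(2)] by (intro P.minus_equality) (simp_all add: Ps)
    moreover have "\<ominus>\<^bsub>P\<^esub> v \<in> I"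
      using additive_subgroup.a_inv_closed[OF ideal.axioms(1)[OF idI] that(2)] .
    ultimately have "u \<oplus>\<^bsub>P\<^esub> (- v) \<in> I"
      using additive_subgroup.a_closed[OF ideal.axioms(1)[OF idI] that(1)] by simp
    then show ?thesis by (simp add: Ps)
  qed
  have I_0: "0 \<in> I" using additive_subgroup.zero_closed[OF ideal.axioms(1)[OF idI]] by (simp add: Ps)
  have I_uminus: "- u \<in> I" if "u \<in> I" for u using I_diff[OF I_0 that] by simp
  have I_add: "u + v \<in> I" if "u \<in> I" "v \<in> I" for u v using I_diff[OF that(1) I_uminus[OF that(2)]] by simp
  have I_sum: "sum F A \<in> I" if "\<And>x. x \<in> A \<Longrightarrow> F x \<in> I" for F and A :: "'k set"
    using that by (induction A rule: infinite_finite_induct) (simp_all add: I_0 I_add)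
  \<comment> \<open>The relation for the sum 0 + 0 is the negative of this generator.\<close>
  have rzero: "frag_of (\<psi> v, 0) \<in> I" if "v \<in> L" for v
    using I_uminus[OF relI[OF rel2[OF that, of 0 0]]] by simp
  have lzero: "frag_of (\<psi> 0, b) \<in> I" for b
    using I_uminus[OF relI[OF rel1[OF zero_mem zero_mem, of b]]] by simp
  have rsum: "frag_of (\<psi> v, \<Sum>c\<in>C. s c) - (\<Sum>c\<in>C. frag_of (\<psi> v, s c)) \<in> I" if "v \<in> L" for v C and s :: "'k \<Rightarrow> 'k"
  proof (induction C rule: infinite_finite_induct)
    case (insert c C)
    from I_add[OF relI[OF rel2[OF that, of "s c" "\<Sum>c\<in>C. s c"]] insert.IH] insert.hyps
    show ?case by (simp add: algebra_simps)
  qed (simp_all add: rzero that)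
  \<comment> \<open>The second components are expressed in a basis \<open>C\<close> of their span
    over the small field. Modulo \<open>I\<close> this turns u into a sum of generators
    (\<open>\<psi> (b c)\<close>, c), one for each c in \<open>C\<close>. Its value is 0, so
    disjointness makes every \<open>b c\<close> zero, and generators with first component zero lie
    in \<open>I\<close>.\<close>
  have "Ker \<subseteq> I"
  proof
    fix u assume u: "u \<in> Ker"
    interpret V: vector_space "\<lambda>c v. \<sigma> c * v"
      by unfold_locales (simp_all add: \<sigma>.homs algebra_simps)
    obtain C where C: "C \<subseteq> snd ` Poly_Mapping.keys u" "V.independent C" "snd ` Poly_Mapping.keys u \<subseteq> V.span C"
      by (rule V.maximal_independent_subset)
    have finC: "finite C" using C(1) by (rule finite_subset) simp
    have spanC: "V.span C = range (\<lambda>l. \<Sum>c\<in>C. \<sigma> (l c) * c)" by (rule V.span_finite[OF finC])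
    have ind: "\<forall>c\<in>C. l c = 0" if "(\<Sum>c\<in>C. \<sigma> (l c) * c) = 0" for l
      using V.independentD[OF C(2) finC order_refl that] by blast
    have "Poly_Mapping.keys u \<subseteq> carrier R \<times> V.span C"
      using u C(3) by (auto simp: Ker_def Ps)
    then have "\<exists>b. (\<forall>c. b c \<in> L) \<and> u - (\<Sum>c\<in>C. frag_of (\<psi> (b c), c)) \<in> I"
    proof (induction u rule: frag_induction)
      case zero
      have "- (\<Sum>c\<in>C. frag_of (\<psi> 0, c)) \<in> I" by (intro I_uminus I_sum lzero)
      then show ?case by (intro exI[of _ "\<lambda>_. 0"]) (simp add: zero_mem)
    next
      case (one x)
      then obtain v l where x: "x = (\<psi> v, \<Sum>c\<in>C. \<sigma> (l c) * c)" "v \<in> L" unfolding carrier_eq spanC by auto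
      have "(frag_of x - (\<Sum>c\<in>C. frag_of (\<psi> v, \<sigma> (l c) * c))) - (\<Sum>c\<in>C. frag_of (\<psi> (\<rho> (l c) * v), c) - frag_of (\<psi> v, \<sigma> (l c) * c)) \<in> I"
        unfolding x(1) by (intro I_diff rsum I_sum relI rel3 x(2))
      then have "frag_of x - (\<Sum>c\<in>C. frag_of (\<psi> (\<rho> (l c) * v), c)) \<in> I" by (simp add: sum_subtractf)
      then show ?case by (intro exI[of _ "\<lambda>c. \<rho> (l c) * v"]) (simp add: mult_mem \<rho> x(2))
    next
      case (diff u u')
      then obtain b b' where b: "\<And>c. b c \<in> L" "u - (\<Sum>c\<in>C. frag_of (\<psi> (b c), c)) \<in> I"
        "\<And>c. b' c \<in> L" "u' - (\<Sum>c\<in>C. frag_of (\<psi> (b' c), c)) \<in> I" by blast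
      have d: "b c - b' c \<in> L" for c using b by (simp add: diff_mem)
      have "(\<Sum>c\<in>C. frag_of (\<psi> (b c), c) - frag_of (\<psi> (b c - b' c), c) - frag_of (\<psi> (b' c), c)) \<in> I"
      proof (intro I_sum relI)
        fix c
        show "frag_of (\<psi> (b c), c) - frag_of (\<psi> (b c - b' c), c) - frag_of (\<psi> (b' c), c) \<in> rel"
          using rel1[OF d[of c] b(3)[of c], of c] by simp
      qed
      from I_add[OF this I_diff[OF b(2,4)]]
      have "(u - u') - (\<Sum>c\<in>C. frag_of (\<psi> (b c - b' c), c)) \<in> I" by (simp add: sum_subtractf sum.distrib algebra_simps)
      then show ?case using d by (intro exI[of _ "\<lambda>c. b c - b' c"]) simp
    qed
    then obtain b where b0: "\<forall>c. b c \<in> L" "u - (\<Sum>c\<in>C. frag_of (\<psi> (b c), c)) \<in> I"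
      by (elim exE conjE) (rule that)
    have b1: "b c \<in> L" for c using b0(1) by simp
    note b = b1 b0(2)
    have "total_val (u - (\<Sum>c\<in>C. frag_of (\<psi> (b c), c))) = 0" using b(2) IK by (auto simp: Ker_def)
    then have "(\<Sum>c\<in>C. b c * \<kappa> c) = 0" using u b(1) by (simp add: total_val_diff total_val_sum Ker_def)
    from disj[OF finC ind b(1) this] have "\<forall>c\<in>C. b c = 0" by blast
    then have "(\<Sum>c\<in>C. frag_of (\<psi> (b c), c)) \<in> I" using lzero by (intro I_sum) simp
    from I_add[OF b(2) this] show "u \<in> I" by simp
  qed
  with IK have "I = Ker" by blast
  with primeK have "domain (P Quot I)" by (simp add: primeideal.quotient_is_domain)
  then show ?thesis
    unfolding tensor_ring_def K_def[symmetric] P_def[symmetric] rel_def[symmetric] I_def[symmetric]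
    by (rule domain.irreducible_spectrum)
qed

end

end

text \<open>Linear disjointness holds for the whole function field, so one argument covers every
  subring of it: \<open>range ev\<close> gives the curve and \<open>normal_closure\<close> its
  normalization.\<close>

lemma (in curve_model) geom_irreducible:
  fixes B
  assumes "parametrized_ring B R \<theta>" "B \<subseteq> function_field" "\<And>p. j p \<in> B"
  shows "irreducible_spectrum (tensor_ring R (\<lambda>c. \<theta> (j [:c:])) (ring_of_type_algebra :: 'k ring) e)"
proof -
  interpret parametrized_ring B R \<theta> by fact
  show ?thesis
  proof (rule tensor_irreducible_spectrum[where \<kappa> = "\<lambda>c. \<iota> [:c:]"])
    show "type_ring_hom (\<lambda>c. \<iota> [:c:])"
      using type_ring_hom_comp[OF type_ring_hom_const \<iota>.type_ring_hom_axioms] .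
    show "inj_type_ring_hom e" by (rule e.inj_type_ring_hom_axioms)
    show "\<iota> [:e c:] = j [:c:]" for c by (simp add: j_def e.map_poly_pCons')
    show "\<forall>c\<in>C. b c = 0" if "finite C" "\<And>l. (\<Sum>c\<in>C. e (l c) * c) = 0 \<Longrightarrow> \<forall>c\<in>C. l c = 0"
      "\<And>c. c \<in> C \<Longrightarrow> b c \<in> B" "(\<Sum>c\<in>C. b c * \<iota> [:c:]) = 0" for C b
      using linearly_disjoint[OF that(1,2) _ that(4)] that(3) assms(2) by blast
  qed (use assms in auto)
qed

section \<open>Rational points of the normalization\<close>

text \<open>Q is a product of distinct linear factors; they are split off from Q and h one at a
  time.\<close>

lemma simple_roots_dvd:
  fixes Q h :: "'k::alg_closed_field poly"
  assumes "Q \<noteq> 0" "\<And>v. poly Q v = 0 \<Longrightarrow> poly (pderiv Q) v \<noteq> 0" "\<And>v. poly Q v = 0 \<Longrightarrow> poly h v = 0"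
  shows "Q dvd h"
  using assms
proof (induction "degree Q" arbitrary: Q h rule: less_induct)
  case less
  show ?case
  proof (cases "degree Q = 0")
    case True
    with less.prems(1) show ?thesis by (metis is_unit_iff_degree unit_imp_dvd)
  next
    case False
    then obtain v where v: "poly Q v = 0" using alg_closed_imp_poly_has_root[of Q] by auto
    obtain Q1 where Q1: "Q = [:- v, 1:] * Q1" using v by (auto simp: poly_eq_0_iff_dvd)
    obtain h1 where h1: "h = [:- v, 1:] * h1" using less.prems(3)[OF v] by (auto simp: poly_eq_0_iff_dvd)
    have Q1nz: "Q1 \<noteq> 0" using less.prems(1) Q1 by auto
    have pd: "poly (pderiv Q) w = (w - v) * poly (pderiv Q1) w + poly Q1 w" for w
    proof -
      have "pderiv Q = [:- v, 1:] * pderiv Q1 + Q1 * pderiv [:- v, 1:]" unfolding Q1 by (rule pderiv_mult)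
      then have "poly (pderiv Q) w = poly ([:- v, 1:] * pderiv Q1 + Q1 * pderiv [:- v, 1:]) w" by (simp only:)
      also have "\<dots> = (w - v) * poly (pderiv Q1) w + poly Q1 w"
        unfolding poly_add poly_mult by (simp add: pderiv_pCons)
      finally show ?thesis .
    qed
    have Q1v: "poly Q1 v \<noteq> 0" using less.prems(2)[OF v] by (simp add: pd)
    have "Q1 dvd h1"
    proof (rule less.hyps[OF _ Q1nz])
      have "degree Q = 1 + degree Q1" unfolding Q1 using Q1nz by (subst degree_mult_eq) auto
      then show "degree Q1 < degree Q" by simp
      fix w assume w: "poly Q1 w = 0"
      then have Qw: "poly Q w = 0" by (simp only: Q1 poly_mult) simp
      show "poly (pderiv Q1) w \<noteq> 0" using less.prems(2)[OF Qw] w by (simp add: pd)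
      have "w \<noteq> v" using w Q1v by auto
      moreover have "(w - v) * poly h1 w = 0"
        using less.prems(3)[OF Qw] by (simp only: h1 poly_mult) simp
      ultimately show "poly h1 w = 0" by simp
    qed
    then show ?thesis unfolding Q1 h1 by (intro mult_dvd_mono) auto
  qed
qed

text \<open>The characteristic does not divide m, so v^m - c is separable. It divides every h
  vanishing at its roots, which contradicts the degree unless h = 0.\<close>

lemma poly_eq_0_if_all_roots_of_unity_multiples:
  fixes h :: "'k::alg_closed_field poly"
  assumes "c \<noteq> 0" "of_nat m \<noteq> (0::'k)" "degree h < m" "\<And>v. v ^ m = c \<Longrightarrow> poly h v = 0"
  shows "h = 0"
proof (rule ccontr)
  assume "h \<noteq> 0"
  let ?Q = "monom 1 m + [:- c:] :: 'k poly"
  have m: "m > 0" using assms(3) by simp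
  have d: "degree ?Q = m" using m by (subst degree_add_eq_left) (auto simp: degree_monom_eq)
  have "?Q dvd h"
  proof (rule simple_roots_dvd)
    show "?Q \<noteq> 0" using d m by auto
    fix v assume v: "poly ?Q v = 0"
    then have vm: "v ^ m = c" by (simp add: poly_monom)
    then show "poly h v = 0" by (rule assms(4))
    have "v \<noteq> 0" using vm assms(1) m by (auto simp: power_0_left)
    then show "poly (pderiv ?Q) v \<noteq> 0"
      using assms(2) by (simp add: pderiv_add pderiv_monom poly_monom pderiv_pCons)
  qed
  then have "degree ?Q \<le> degree h" using \<open>h \<noteq> 0\<close> by (rule dvd_imp_degree_le)
  with d assms(3) show False by simp
qed

text \<open>The quotient by a polynomial monic in y is free over the coefficients and therefore
  torsion-free; concretely, the remainder of degree below m is multiplied by c.\<close>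

lemma monic_dvd_smult_cancel:
  fixes G :: "'k::idom poly"
  assumes "m > 0" "c \<noteq> 0" "(monom 1 m - [:f:]) dvd smult c G"
  shows "(monom 1 m - [:f:]) dvd G"
proof -
  let ?W = "monom 1 m - [:f:]"
  obtain q r where qr: "G = ?W * q + r" "degree r < m" using monic_division[OF assms(1)] by blast
  have "smult c G = ?W * smult c q + smult c r" unfolding qr(1) by (simp add: smult_add_right)
  with assms(3) have "?W dvd smult c r" by (metis dvd_add_right_iff dvd_triv_left)
  moreover have "degree ?W = m"
  proof -
    have "degree (monom 1 m + [:- f:]) = m"
      using assms(1) by (subst degree_add_eq_left) (auto simp: degree_monom_eq)
    then show ?thesis by (metis diff_conv_add_uminus minus_pCons minus_zero)
  qed
  ultimately have "smult c r = 0"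
    using dvd_imp_degree_le[of ?W "smult c r"] qr(2) degree_smult_le[of c r] by fastforce
  with assms(2) have "r = 0" by simp
  with qr(1) show ?thesis by simp
qed

locale curve_point_model = curve_model e \<iota> f m y c
  for e :: "'a::field \<Rightarrow> 'k::alg_closed_field" and \<iota> :: "'k poly \<Rightarrow> 'o::field" and f m y c +
  fixes a :: 'a and s :: nat and u :: "'a poly"
  assumes m_unit: "of_nat m \<noteq> (0 :: 'k)"
    and f_local: "f = [:- a, 1:] ^ s * u" and u_unit: "poly u a \<noteq> 0"
begin

text \<open>The substitution \<open>x = a + t ^ m\<close>, \<open>y = t ^ s * v\<close> turns \<open>y ^ m - f(x)\<close> into
  \<open>t ^ (m * s) * (v ^ m - u(a + t ^ m))\<close>, which is smooth over \<open>t = 0\<close>. The inner variable of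
  the target is \<open>t\<close>, the outer one is \<open>v\<close>.\<close>

definition tx :: "'a poly \<Rightarrow> 'k poly" where
  "tx p = pcompose (map_poly e p) (monom 1 m + [:e a:])"

definition tv :: "'a poly poly \<Rightarrow> 'k poly poly" where
  "tv p = pcompose (map_poly tx p) (monom (monom 1 s) 1)"

definition W :: "'k poly poly" where
  "W = monom 1 m - [:tx u:]"

definition at_zero :: "'k \<Rightarrow> 'k poly poly \<Rightarrow> 'k" where
  "at_zero v G = poly (map_poly (\<lambda>q. poly q 0) G) v"

sublocale tx: type_ring_hom tx
  unfolding tx_def using type_ring_hom_comp[OF e.type_ring_hom_map type_ring_hom_pcompose] .

sublocale tv: type_ring_hom tv
  unfolding tv_def using type_ring_hom_comp[OF tx.type_ring_hom_map type_ring_hom_pcompose] .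

lemma type_ring_hom_at_zero: "type_ring_hom (at_zero v)"
proof -
  have "type_ring_hom (\<lambda>q::'k poly. poly q 0)" by unfold_locales simp_all
  from type_ring_hom_eval[OF this] show ?thesis unfolding at_zero_def .
qed

lemmas at_zero_homs = type_ring_hom.homs[OF type_ring_hom_at_zero] type_ring_hom.hom_sum[OF type_ring_hom_at_zero]

lemma at_zero_const [simp]: "at_zero v [:q:] = poly q 0"
  by (simp add: at_zero_def map_poly_pCons)

lemma at_zero_monom [simp]: "at_zero v (monom 1 i) = v ^ i"
  by (simp add: at_zero_def map_poly_monom poly_monom)

lemma poly_tx_0 [simp]: "poly (tx p) 0 = e (poly p a)"
  using m by (simp add: tx_def poly_pcompose poly_monom power_0_left e.poly_map_poly_hom)

lemma tx_linear: "tx [:- a, 1:] = monom 1 m"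
  by (simp add: tx_def e.map_poly_pCons' e.homs pcompose_pCons)

lemma tx_linear_power: "tx ([:- a, 1:] ^ i) = monom 1 (m * i)"
  by (simp add: tx.hom_power tx_linear monom_power)

lemma coeff_tv: "coeff (tv p) l = tx (coeff p l) * monom 1 (s * l)"
  by (simp add: tv_def coeff_map_poly tx.hom_0 monom_power mult.commute)

lemma tv_const [simp]: "tv [:p:] = [:tx p:]"
  by (simp add: tv_def map_poly_pCons tx.hom_0)

lemma tv_y: "tv (monom 1 i) = monom (monom 1 (s * i)) i"
  by (rule poly_eqI) (auto simp: coeff_tv tx.hom_0 tx.hom_1)

lemma degree_tv: "degree p < m \<Longrightarrow> degree (tv p) < m"
  using m by (intro degree_lessI) (auto simp: coeff_tv coeff_eq_0 tx.hom_0)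

lemma tv_relation: "tv (monom 1 m - [:f:]) = smult (monom 1 (m * s)) W"
proof -
  have "tx f = monom 1 (m * s) * tx u" unfolding f_local by (simp add: tx.hom_mult tx_linear_power)
  then show ?thesis
    by (simp add: tv.hom_diff tv_y W_def smult_diff_right smult_monom mult.commute)
qed

lemma W_dvd_tv:
  assumes "ev p = 0" shows "W dvd tv p"
proof -
  have "tv (monom 1 m - [:f:]) dvd tv p" using assms unfolding ev_eq_0_iff by (rule tv.hom_dvd)
  then show ?thesis unfolding tv_relation by (metis dvd_smult dvd_refl dvd_trans)
qed

lemma W_dvd_smult_cancel: "q \<noteq> 0 \<Longrightarrow> W dvd smult q G \<Longrightarrow> W dvd G"
  unfolding W_def using monic_dvd_smult_cancel[OF m] by blast

lemma at_zero_W: "v ^ m = e (poly u a) \<Longrightarrow> W dvd G \<Longrightarrow> at_zero v G = 0"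
  by (auto simp: W_def at_zero_homs elim!: dvdE)

lemma degree_1_local:
  fixes d :: "'a poly"
  assumes "d \<noteq> 0"
  obtains \<nu> \<delta> where "d = [:- a, 1:] ^ \<nu> * \<delta>" "poly \<delta> a \<noteq> 0"
  using order_decomp[OF assms, of a] by (metis poly_eq_0_iff_dvd)

text \<open>Integrality forces divisibility by the denominator, since the fibre over \<open>t = 0\<close> is reduced.\<close>

lemma integral_tv_dvd:
  assumes b: "integral_elem (range ev) (ev p / j d)" and p: "degree p < m"
    and d: "d = [:- a, 1:] ^ \<nu> * \<delta>" "poly \<delta> a \<noteq> 0"
  shows "\<exists>h. tv p = smult (monom 1 (m * \<nu>)) h"
proof -
  have d0: "d \<noteq> 0" using d by auto
  obtain P where P: "lead_coeff P = 1" "\<forall>i. coeff P i \<in> range ev" "poly P (ev p / j d) = 0"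
    using b unfolding integral_elem_def by blast
  let ?N = "degree P"
  have "\<exists>A. \<forall>i. coeff P i = ev (A i)" using P(2) by (intro choice) auto
  then obtain A' where A': "\<And>i. coeff P i = ev (A' i)" by blast
  \<comment> \<open>Substitution acts on representatives, not on values of \<open>ev\<close>. The
    leading one is therefore taken to be 1 itself, so that its image is 1.\<close>
  define A where "A i = (if i = ?N then 1 else A' i)" for i
  have A: "coeff P i = ev (A i)" for i using A' P(1) by (simp add: A_def ev.hom_1)
  define E where "E = (\<Sum>i\<le>?N. A i * p ^ i * [:d:] ^ (?N - i))"
  have "ev E = (\<Sum>i\<le>?N. coeff P i * (ev p / j d) ^ i * j d ^ ?N)"
    unfolding E_def ev.hom_sum
  proof (rule sum.cong[OF refl])
    fix i assume "i \<in> {..?N}"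
    then have "j d ^ ?N = j d ^ i * j d ^ (?N - i)" by (simp flip: power_add)
    then show "ev (A i * p ^ i * [:d:] ^ (?N - i)) = coeff P i * (ev p / j d) ^ i * j d ^ ?N"
      using d0 by (simp add: ev.homs A power_divide)
  qed
  also have "\<dots> = poly P (ev p / j d) * j d ^ ?N" by (simp add: poly_altdef sum_distrib_right)
  finally have "ev E = 0" using P(3) by simp
  from W_dvd_tv[OF this] have WE: "W dvd tv E" .
  have "\<exists>h. tv p = smult (monom 1 r) h" if "r \<le> m * \<nu>" for r
    using that
  proof (induction r)
    case 0
    then show ?case by (intro exI[of _ "tv p"]) (simp add: monom_0 flip: one_pCons)
  next
    case (Suc r)
    then obtain h where h: "tv p = smult (monom 1 r) h" by auto
    \<comment> \<open>The power of t still missing. As it is positive, only the top power of h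
      survives at t = 0, which makes h vanish there and yields one more factor t.\<close>
    define D where "D = m * \<nu> - r"
    have D0: "D > 0" using Suc.prems by (simp add: D_def)
    have td: "tx d = monom 1 r * (monom 1 D * tx \<delta>)"
      using Suc.prems unfolding d(1) by (simp add: tx.hom_mult tx_linear_power D_def mult_monom flip: mult.assoc)
    define G where "G = (\<Sum>i\<le>?N. tv (A i) * h ^ i * [:monom 1 D * tx \<delta>:] ^ (?N - i))"
    have "tv E = [:monom 1 r ^ ?N:] * G"
      unfolding E_def G_def tv.hom_sum sum_distrib_left
    proof (rule sum.cong[OF refl])
      fix i assume "i \<in> {..?N}"
      then have N: "(monom 1 r :: 'k poly) ^ ?N = monom 1 r ^ i * monom 1 r ^ (?N - i)" by (simp flip: power_add)
      have q: "[:monom 1 r * (monom 1 D * tx \<delta>):] = smult (monom 1 r) [:monom 1 D * tx \<delta>:]" by simp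
      have "tv (A i * p ^ i * [:d:] ^ (?N - i)) = tv (A i) * (smult (monom 1 r) h) ^ i * (smult (monom 1 r) [:monom 1 D * tx \<delta>:]) ^ (?N - i)"
        unfolding tv.homs tv_const h td q ..
      also have "\<dots> = [:monom 1 r ^ ?N:] * (tv (A i) * h ^ i * [:monom 1 D * tx \<delta>:] ^ (?N - i))"
        unfolding N smult_power by (simp add: mult_ac)
      finally show "tv (A i * p ^ i * [:d:] ^ (?N - i)) = [:monom 1 r ^ ?N:] * (tv (A i) * h ^ i * [:monom 1 D * tx \<delta>:] ^ (?N - i))" .
    qed
    then have tvE: "tv E = smult (monom 1 r ^ ?N) G" by simp
    have "(monom 1 r :: 'k poly) ^ ?N \<noteq> 0" by (simp add: monom_eq_0_iff)
    from W_dvd_smult_cancel[OF this WE[unfolded tvE]] have WG: "W dvd G" .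
    have hv: "at_zero v h = 0" if v: "v ^ m = e (poly u a)" for v
    proof -
      have "0 = at_zero v G" using at_zero_W[OF v WG] by simp
      also have "\<dots> = (\<Sum>i\<le>?N. if i = ?N then at_zero v h ^ ?N else 0)"
        unfolding G_def at_zero_homs
        using D0 by (intro sum.cong) (auto simp: A_def at_zero_homs poly_monom power_0_left tv.hom_1)
      finally show ?thesis by simp
    qed
    have "map_poly (\<lambda>q. poly q 0) h = 0"
    proof (rule poly_eq_0_if_all_roots_of_unity_multiples[OF _ m_unit])
      show "e (poly u a) \<noteq> 0" using u_unit by simp
      have "degree h < m" using degree_tv[OF p] unfolding h by simp
      then show "degree (map_poly (\<lambda>q. poly q 0) h) < m"
        using m by (intro degree_lessI) (auto simp: coeff_map_poly coeff_eq_0)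
      show "poly (map_poly (\<lambda>q. poly q 0) h) v = 0" if "v ^ m = e (poly u a)" for v
        using hv[OF that] by (simp add: at_zero_def)
    qed
    then have "poly (coeff h l) 0 = 0" for l by (simp add: poly_eq_iff coeff_map_poly)
    then have "[:[:0, 1:]:] dvd h" by (simp add: const_poly_dvd_iff poly_eq_0_iff_dvd)
    then obtain h' where "h = smult [:0, 1:] h'" by (auto simp: dvd_def)
    then have "tv p = smult (monom 1 (Suc r)) h'" unfolding h by (simp add: monom_Suc mult.commute)
    then show ?case by blast
  qed
  then show ?thesis by blast
qed

section \<open>A local integral basis at x = a\<close>

definition fl :: "nat \<Rightarrow> nat" where "fl l = (s * l) div m"

text \<open>If the lth coefficient of p has order k at a, comparing orders in t gives m \<nu> \<le>
  m k + s l, hence \<nu> \<le> k + \<open>fl l\<close>. So near a the element b is a combination of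
  the y^l / (x - a)^(\<open>fl l\<close>) with coefficients regular at a.\<close>

lemma integral_local_form:
  assumes "b \<in> normal_closure"
  obtains p d \<nu> \<delta> p' where "degree p < m" "d \<noteq> 0" "b = ev p / j d" "d = [:- a, 1:] ^ \<nu> * \<delta>" "poly \<delta> a \<noteq> 0"
    "\<And>l. coeff p l * [:- a, 1:] ^ fl l = [:- a, 1:] ^ \<nu> * p' l"
proof -
  obtain p d where pd: "degree p < m" "d \<noteq> 0" "b = ev p / j d"
    using assms unfolding normal_closure_def by (blast elim: function_fieldE)
  obtain \<nu> \<delta> where d: "d = [:- a, 1:] ^ \<nu> * \<delta>" "poly \<delta> a \<noteq> 0" by (rule degree_1_local[OF pd(2)])
  obtain h where h: "tv p = smult (monom 1 (m * \<nu>)) h"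
    using integral_tv_dvd[OF _ pd(1) d] assms pd(3) unfolding normal_closure_def by blast
  have "[:- a, 1:] ^ \<nu> dvd coeff p l * [:- a, 1:] ^ fl l" for l
  proof (cases "coeff p l = 0")
    case False
    obtain k w where k: "coeff p l = [:- a, 1:] ^ k * w" "poly w a \<noteq> 0" by (rule degree_1_local[OF False])
    have "monom 1 (m * \<nu>) dvd coeff (tv p) l" unfolding h by simp
    also have "coeff (tv p) l = monom 1 (m * k + s * l) * tx w"
    proof -
      have "monom 1 (m * k + s * l) = monom 1 (m * k) * (monom 1 (s * l) :: 'k poly)" by (simp add: mult_monom)
      then show ?thesis unfolding coeff_tv k(1) tx.hom_mult tx_linear_power by (simp only: mult_ac)
    qed
    finally have "monom 1 (m * \<nu>) dvd monom 1 (m * k + s * l) * tx w" .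
    moreover have "tx w \<noteq> 0" using k(2) poly_tx_0[of w] by (metis e.hom_eq_0 poly_0)
    moreover have "order 0 (monom 1 (m * k + s * l) * tx w) = m * k + s * l"
    proof -
      have "monom 1 (m * k + s * l) * tx w \<noteq> 0" using \<open>tx w \<noteq> 0\<close> by (simp add: monom_eq_0_iff)
      moreover have "order 0 (tx w) = 0" using k(2) by (intro order_0I) simp
      ultimately show ?thesis by (simp add: order_mult)
    qed
    ultimately have "m * \<nu> \<le> m * k + s * l" by (simp add: monom_1_dvd_iff)
    then have "(m * \<nu>) div m \<le> (m * k + s * l) div m" by (rule div_le_mono)
    then have "\<nu> \<le> k + fl l" using m by (simp add: fl_def)
    then have "[:- a, 1:] ^ \<nu> dvd [:- a, 1:] ^ (k + fl l)" by (rule le_imp_power_dvd)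
    then show ?thesis unfolding k(1) by (simp add: power_add mult_ac dvd_mult)
  qed simp
  then have "\<exists>p'. \<forall>l. coeff p l * [:- a, 1:] ^ fl l = [:- a, 1:] ^ \<nu> * p' l" by (intro choice) (auto simp: dvd_def)
  then show ?thesis using that pd d by blast
qed

definition el :: "nat \<Rightarrow> 'o" where "el l = y ^ l / j ([:- a, 1:] ^ fl l)"

text \<open>The right side is a polynomial in x, which gives integrality. It vanishes at a unless m
  divides s l, which decides the values at points.\<close>

lemma el_power: "el l ^ m = j ([:- a, 1:] ^ ((s * l) mod m) * u ^ l)"
proof -
  have "s * l = fl l * m + (s * l) mod m" by (simp add: fl_def)
  then have e: "[:- a, 1:] ^ (s * l) = ([:- a, 1:] ^ fl l) ^ m * [:- a, 1:] ^ ((s * l) mod m)"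
    by (metis power_add power_mult)
  have "(y ^ l) ^ m = (y ^ m) ^ l" by (simp only: power_mult[symmetric] mult.commute)
  also have "\<dots> = j ([:- a, 1:] ^ (s * l) * u ^ l)"
    by (simp add: y_power j.homs power_mult_distrib power_mult f_local)
  also have "\<dots> = j ([:- a, 1:] ^ fl l) ^ m * j ([:- a, 1:] ^ ((s * l) mod m) * u ^ l)"
    unfolding e by (simp only: j.hom_mult j.hom_power mult.assoc)
  finally have "(y ^ l) ^ m = j ([:- a, 1:] ^ fl l) ^ m * j ([:- a, 1:] ^ ((s * l) mod m) * u ^ l)" .
  then show ?thesis unfolding el_def power_divide by (simp add: j.hom_power)
qed

lemma j_normal_closure: "j p \<in> normal_closure"
  using ev_normal_closure[of "[:p:]"] by simp

lemma el_normal_closure: "el l \<in> normal_closure"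
proof -
  have "el l \<in> function_field"
    unfolding el_def using function_fieldI[of "[:- a, 1:] ^ fl l" "monom 1 l"] by simp
  moreover have "integral_elem (range ev) (el l)"
  proof (rule A.integral_elem_root[OF _ m])
    show "el l ^ m \<in> range ev" unfolding el_power by (metis ev_const rangeI)
  qed
  ultimately show ?thesis by (simp add: normal_closure_def)
qed

definition g :: nat where "g = gcd m s"
definition m' :: nat where "m' = m div g"
definition s' :: nat where "s' = s div g"

lemma g_pos: "g > 0" and m_eq: "m = m' * g" and s_eq: "s = s' * g"
  using m by (auto simp: g_def m'_def s'_def)

lemma m'_pos: "m' > 0"
  using m m_eq by (cases m') auto

lemma m_dvd_iff: "m dvd s * l \<longleftrightarrow> m' dvd l"
proof -
  have "coprime m' s'" unfolding m'_def s'_def g_def using m by (intro div_gcd_coprime) simp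
  have sl: "s * l = (s' * l) * g" by (metis s_eq mult.assoc mult.commute)
  have "m dvd s * l \<longleftrightarrow> m' * g dvd (s' * l) * g" unfolding sl by (subst m_eq) (rule refl)
  also have "\<dots> \<longleftrightarrow> m' dvd s' * l" using g_pos by simp
  also have "\<dots> \<longleftrightarrow> m' dvd l" using \<open>coprime m' s'\<close> by (rule coprime_dvd_mult_right_iff)
  finally show ?thesis .
qed

lemma mod_m_eq_0_iff: "s * l mod m = 0 \<longleftrightarrow> m' dvd l"
  unfolding m_dvd_iff[symmetric] by (rule dvd_eq_mod_eq_0[symmetric])

lemma sm': "s * (m' * i) = m * (s' * i)"
proof -
  have "s * (m' * i) = (s' * g) * (m' * i)" by (simp only: s_eq[symmetric])
  also have "\<dots> = (m' * g) * (s' * i)" by (simp only: mult_ac)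
  finally show ?thesis by (simp only: m_eq[symmetric])
qed

lemma fl_multiple: "fl (m' * i) = s' * i"
  unfolding fl_def sm' using m by simp

lemma el_multiple: "el (m' * i) = el m' ^ i"
  using fl_multiple[of i] fl_multiple[of 1] by (simp add: el_def power_divide power_mult j.hom_power)

text \<open>A rational point over a as an algebra homomorphism to the constants. \<open>H\<close> is
  constrained only on \<open>normal_closure\<close>, so different functions may describe one point;
  points are compared by their kernels.\<close>

definition point_hom :: "('o \<Rightarrow> 'a) \<Rightarrow> bool" where
  "point_hom H \<longleftrightarrow> (\<forall>b\<in>normal_closure. \<forall>b'\<in>normal_closure. H (b + b') = H b + H b' \<and> H (b * b') = H b * H b') \<and>
     (\<forall>p. H (j p) = poly p a)"

context
  fixes H assumes H: "point_hom H"
begin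

lemma point_hom_add: "b \<in> normal_closure \<Longrightarrow> b' \<in> normal_closure \<Longrightarrow> H (b + b') = H b + H b'"
  and point_hom_mult: "b \<in> normal_closure \<Longrightarrow> b' \<in> normal_closure \<Longrightarrow> H (b * b') = H b * H b'"
  and point_hom_j: "H (j p) = poly p a"
  using H unfolding point_hom_def by auto

lemma point_hom_power: "b \<in> normal_closure \<Longrightarrow> H (b ^ i) = H b ^ i"
proof (induction i)
  case 0
  then show ?case using point_hom_j[of 1] by (simp add: j.hom_1)
next
  case (Suc i)
  then show ?case by (simp add: point_hom_mult field_subring.power_mem[OF field_subring_normal_closure])
qed

lemma point_hom_sum: "finite I \<Longrightarrow> (\<And>i. i \<in> I \<Longrightarrow> F i \<in> normal_closure) \<Longrightarrow> H (sum F I) = (\<Sum>i\<in>I. H (F i))"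
proof (induction I rule: finite_induct)
  case empty
  then show ?case using point_hom_j[of 0] by (simp add: j.hom_0)
next
  case (insert i I)
  then show ?case by (simp add: point_hom_add field_subring.sum_mem[OF field_subring_normal_closure])
qed

lemma point_hom_root: "H (el m') ^ g = poly u a"
proof -
  have "el m' ^ g = el m" using el_multiple[of g] by (simp flip: m_eq)
  also have "\<dots> = j u"
  proof -
    have "fl m = s" using m by (simp add: fl_def)
    then show ?thesis by (simp add: el_def y_power f_local j.hom_mult)
  qed
  finally show ?thesis using point_hom_power[OF el_normal_closure, of m' g] by (simp add: point_hom_j)
qed

text \<open>For \<open>m'\<close> not dividing l, the mth power of \<open>el l\<close> has the
  factor x - a, so its value is nilpotent in a field. Otherwise \<open>el l\<close> is a power of
  \<open>el m'\<close>.\<close>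

lemma point_hom_el: "H (el l) = (if m' dvd l then H (el m') ^ (l div m') else 0)"
proof (cases "m' dvd l")
  case True
  then obtain i where l: "l = m' * i" by blast
  show ?thesis using True m'_pos unfolding l el_multiple by (simp add: point_hom_power[OF el_normal_closure])
next
  case False
  then have "s * l mod m \<noteq> 0" unfolding mod_m_eq_0_iff .
  have "H (el l) ^ m = H (el l ^ m)" by (simp add: point_hom_power[OF el_normal_closure])
  also have "\<dots> = 0" using \<open>s * l mod m \<noteq> 0\<close> by (simp add: el_power point_hom_j)
  finally show ?thesis using False by simp
qed

text \<open>The right side involves \<open>H\<close> only through its value at \<open>el m'\<close>.
  The factor \<delta>(a) \<noteq> 0 stands for a denominator that is a unit at a.\<close>

lemma point_hom_formula:
  assumes p: "degree p < m" "d \<noteq> 0" "b = ev p / j d" "d = [:- a, 1:] ^ \<nu> * \<delta>" "poly \<delta> a \<noteq> 0"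
    "\<And>l. coeff p l * [:- a, 1:] ^ fl l = [:- a, 1:] ^ \<nu> * p' l" and b: "b \<in> normal_closure"
  shows "poly \<delta> a * H b = (\<Sum>l<m. poly (p' l) a * (if m' dvd l then H (el m') ^ (l div m') else 0))"
proof -
  interpret B: field_subring normal_closure by (rule field_subring_normal_closure)
  have nz: "j ([:- a, 1:] ^ i) \<noteq> 0" for i by simp
  have "j ([:- a, 1:] ^ \<nu>) * (j \<delta> * b) = ev p"
    using p(2,3) unfolding p(4) by (simp add: j.hom_mult)
  also have "\<dots> = (\<Sum>l<m. j (coeff p l) * y ^ l)" unfolding ev_def by (rule j.poly_map_poly_sum[OF p(1)])
  also have "\<dots> = (\<Sum>l<m. j ([:- a, 1:] ^ \<nu>) * (j (p' l) * el l))"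
  proof (rule sum.cong[OF refl])
    fix l
    have "j (coeff p l) * y ^ l = j (coeff p l * [:- a, 1:] ^ fl l) * el l"
      using nz[of "fl l"] by (simp add: el_def j.hom_mult)
    then show "j (coeff p l) * y ^ l = j ([:- a, 1:] ^ \<nu>) * (j (p' l) * el l)"
      unfolding p(6) by (simp only: j.hom_mult mult.assoc)
  qed
  also have "\<dots> = j ([:- a, 1:] ^ \<nu>) * (\<Sum>l<m. j (p' l) * el l)" by (simp add: sum_distrib_left)
  finally have "j \<delta> * b = (\<Sum>l<m. j (p' l) * el l)" using nz[of \<nu>] by simp
  then have "H (j \<delta> * b) = (\<Sum>l<m. H (j (p' l) * el l))"
    by (simp add: point_hom_sum B.mult_mem j_normal_closure el_normal_closure)
  moreover have "H (j (p' l) * el l) = poly (p' l) a * (if m' dvd l then H (el m') ^ (l div m') else 0)" for l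
    unfolding point_hom_mult[OF j_normal_closure el_normal_closure] point_hom_j by (subst point_hom_el) (rule refl)
  ultimately show ?thesis by (simp only: point_hom_mult[OF j_normal_closure b] point_hom_j)
qed

end

lemma point_hom_unique:
  assumes "point_hom H" "point_hom H'" "H (el m') = H' (el m')" "b \<in> normal_closure"
  shows "H b = H' b"
proof -
  obtain p d \<nu> \<delta> p' where *: "degree p < m" "d \<noteq> 0" "b = ev p / j d" "d = [:- a, 1:] ^ \<nu> * \<delta>" "poly \<delta> a \<noteq> 0"
    "\<And>l. coeff p l * [:- a, 1:] ^ fl l = [:- a, 1:] ^ \<nu> * p' l" by (rule integral_local_form[OF assms(4)]) blast
  have "poly \<delta> a * H b = poly \<delta> a * H' b"
    unfolding point_hom_formula[OF assms(1) * assms(4)] point_hom_formula[OF assms(2) * assms(4)] assms(3) ..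
  with *(5) show ?thesis by simp
qed

text \<open>On a branch over \<open>t = 0\<close>, the function \<open>b\<close> becomes \<open>h / \<delta>\<close>, which is regular there
  with value \<open>k\<close> at \<open>v\<close>.\<close>

definition represents :: "'k \<Rightarrow> 'o \<Rightarrow> 'k \<Rightarrow> bool" where
  "represents v b k \<longleftrightarrow> (\<exists>p d r h \<delta>. d \<noteq> 0 \<and> b = ev p / j d \<and> W dvd (tv p - smult (monom 1 r) h) \<and>
     tx d = monom 1 r * \<delta> \<and> poly \<delta> 0 \<noteq> 0 \<and> k * poly \<delta> 0 = at_zero v h)"

text \<open>Two presentations of b are cross-multiplied; their powers of t can be cancelled modulo
  \<open>W\<close>, and evaluation at t = 0 compares the two values.\<close>

lemma represents_unique:
  assumes v: "v ^ m = e (poly u a)" and "represents v b k" "represents v b k'"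
  shows "k = k'"
proof -
  obtain p d r h \<delta> where 1: "d \<noteq> 0" "b = ev p / j d" "W dvd (tv p - smult (monom 1 r) h)"
     "tx d = monom 1 r * \<delta>" "poly \<delta> 0 \<noteq> 0" "k * poly \<delta> 0 = at_zero v h" using assms(2) unfolding represents_def by blast
  obtain p' d' r' h' \<delta>' where 2: "d' \<noteq> 0" "b = ev p' / j d'" "W dvd (tv p' - smult (monom 1 r') h')"
     "tx d' = monom 1 r' * \<delta>'" "poly \<delta>' 0 \<noteq> 0" "k' * poly \<delta>' 0 = at_zero v h'" using assms(3) unfolding represents_def by blast
  have "ev p * j d' = ev p' * j d" using 1(1,2) 2(1,2) by (simp add: frac_eq_eq)
  then have "ev (p * [:d':] - p' * [:d:]) = 0" by (simp only: ev.homs ev_const) simp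
  then have "W dvd tv (p * [:d':] - p' * [:d:])" by (rule W_dvd_tv)
  then have 3: "W dvd tv p * [:tx d':] - tv p' * [:tx d:]" by (simp only: tv.homs tv_const)
  have "W dvd (tv p * [:tx d':] - tv p' * [:tx d:]) - (tv p - smult (monom 1 r) h) * [:tx d':] + (tv p' - smult (monom 1 r') h') * [:tx d:]"
    by (rule dvd_add[OF dvd_diff[OF 3 dvd_mult2[OF 1(3)]] dvd_mult2[OF 2(3)]])
  also have "\<dots> = smult (monom 1 r) h * [:tx d':] - smult (monom 1 r') h' * [:tx d:]"
    by (simp only: left_diff_distrib) simp
  also have "\<dots> = smult (monom 1 r * monom 1 r') (h * [:\<delta>':] - h' * [:\<delta>:])"
    unfolding 1(4) 2(4) by (simp add: smult_diff_right mult_ac)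
  finally have "W dvd h * [:\<delta>':] - h' * [:\<delta>:]" by (rule W_dvd_smult_cancel[rotated]) (simp add: monom_eq_0_iff)
  from at_zero_W[OF v this] have "at_zero v h * poly \<delta>' 0 = at_zero v h' * poly \<delta> 0" by (simp only: at_zero_homs at_zero_const) simp
  then have "(k - k') * (poly \<delta> 0 * poly \<delta>' 0) = 0"
    unfolding 1(6)[symmetric] 2(6)[symmetric] by (simp add: algebra_simps)
  with 1(5) 2(5) show ?thesis by simp
qed

lemma represents_add_mult:
  assumes "represents v b k" "represents v b' k'"
  shows "represents v (b + b') (k + k')" "represents v (b * b') (k * k')"
proof -
  obtain p d r h \<delta> where 1: "d \<noteq> 0" "b = ev p / j d" "W dvd (tv p - smult (monom 1 r) h)"
     "tx d = monom 1 r * \<delta>" "poly \<delta> 0 \<noteq> 0" "k * poly \<delta> 0 = at_zero v h" using assms(1) unfolding represents_def by blast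
  obtain p' d' r' h' \<delta>' where 2: "d' \<noteq> 0" "b' = ev p' / j d'" "W dvd (tv p' - smult (monom 1 r') h')"
     "tx d' = monom 1 r' * \<delta>'" "poly \<delta>' 0 \<noteq> 0" "k' * poly \<delta>' 0 = at_zero v h'" using assms(2) unfolding represents_def by blast
  have mm: "monom 1 (r + r') = monom 1 r * (monom 1 r' :: 'k poly)" by (simp add: mult_monom)
  have td: "tx (d * d') = monom 1 (r + r') * (\<delta> * \<delta>')"
    unfolding mm tx.hom_mult 1(4) 2(4) by (simp only: mult_ac)
  show "represents v (b + b') (k + k')" unfolding represents_def
  proof (intro exI conjI)
    show "d * d' \<noteq> 0" using 1 2 by simp
    show "b + b' = ev (p * [:d':] + p' * [:d:]) / j (d * d')"
      unfolding 1(2) 2(2) using 1(1) 2(1) by (simp only: ev.homs ev_const j.hom_mult) (simp add: add_frac_eq)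
    have "W dvd (tv p - smult (monom 1 r) h) * [:tx d':] + (tv p' - smult (monom 1 r') h') * [:tx d:]"
      by (rule dvd_add[OF dvd_mult2[OF 1(3)] dvd_mult2[OF 2(3)]])
    also have "\<dots> = tv (p * [:d':] + p' * [:d:]) - smult (monom 1 (r + r')) (h * [:\<delta>':] + h' * [:\<delta>:])"
      unfolding 1(4) 2(4) tv.homs tv_const mm
      by (simp only: left_diff_distrib) (simp add: smult_add_right mult_ac 1(4) 2(4))
    finally show "W dvd tv (p * [:d':] + p' * [:d:]) - smult (monom 1 (r + r')) (h * [:\<delta>':] + h' * [:\<delta>:])" .
    show "(k + k') * poly (\<delta> * \<delta>') 0 = at_zero v (h * [:\<delta>':] + h' * [:\<delta>:])"
      by (simp only: at_zero_homs at_zero_const 1(6)[symmetric] 2(6)[symmetric] poly_mult) (simp add: algebra_simps)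
  qed (use td 1 2 in auto)
  show "represents v (b * b') (k * k')" unfolding represents_def
  proof (intro exI conjI)
    show "d * d' \<noteq> 0" using 1 2 by simp
    show "b * b' = ev (p * p') / j (d * d')" unfolding 1(2) 2(2) by (simp add: ev.hom_mult j.hom_mult)
    have "W dvd (tv p - smult (monom 1 r) h) * tv p' + smult (monom 1 r) h * (tv p' - smult (monom 1 r') h')"
      by (rule dvd_add[OF dvd_mult2[OF 1(3)] dvd_mult[OF 2(3)]])
    also have "\<dots> = tv (p * p') - smult (monom 1 (r + r')) (h * h')"
      unfolding tv.homs mm by (simp only: left_diff_distrib right_diff_distrib) (simp add: mult.commute)
    finally show "W dvd tv (p * p') - smult (monom 1 (r + r')) (h * h')" .
    show "(k * k') * poly (\<delta> * \<delta>') 0 = at_zero v (h * h')"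
      by (simp only: at_zero_homs 1(6)[symmetric] 2(6)[symmetric] poly_mult) (simp add: algebra_simps)
  qed (use td 1 2 in auto)
qed

text \<open>The value is rational although v need not be: terms with \<open>m'\<close> not dividing
  l carry a positive power of t and vanish, and in the others v enters through a power of
  v^\<open>m'\<close> = e z.\<close>

lemma represents_exists:
  assumes z: "v ^ m' = e z" and b: "b \<in> normal_closure"
  shows "\<exists>k. represents v b (e k)"
proof -
  obtain p d \<nu> \<delta> p' where *: "degree p < m" "d \<noteq> 0" "b = ev p / j d" "d = [:- a, 1:] ^ \<nu> * \<delta>" "poly \<delta> a \<noteq> 0"
    "\<And>l. coeff p l * [:- a, 1:] ^ fl l = [:- a, 1:] ^ \<nu> * p' l" by (rule integral_local_form[OF b]) blast
  \<comment> \<open>This is \<open>tv p\<close> divided by t^(m \<nu>): the exponent s l of t splits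
    into m times \<open>fl l\<close>, absorbed by the local form, and the remainder modulo
    m.\<close>
  define h where "h = (\<Sum>l<m. monom (tx (p' l) * monom 1 (s * l mod m)) l)"
  have fl: "m * fl l + s * l mod m = s * l" for l by (simp add: fl_def)
  have "coeff (tv p) l = monom 1 (m * \<nu>) * coeff h l" for l
  proof (cases "l < m")
    case True
    have ch: "coeff h l = tx (p' l) * monom 1 (s * l mod m)"
      using True unfolding h_def coeff_sum by simp
    have "tx (coeff p l) * monom 1 (m * fl l) = monom 1 (m * \<nu>) * tx (p' l)"
      using arg_cong[OF *(6)[of l], of tx] by (simp only: tx.hom_mult tx_linear_power)
    then have "tx (coeff p l) * monom 1 (m * fl l) * monom 1 (s * l mod m) = monom 1 (m * \<nu>) * tx (p' l) * monom 1 (s * l mod m)"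
      by simp
    then have "tx (coeff p l) * monom 1 (m * fl l + s * l mod m) = monom 1 (m * \<nu>) * coeff h l"
      unfolding ch by (simp only: mult.assoc mult_monom mult_1_right)
    then show ?thesis unfolding coeff_tv fl .
  next
    case False
    then show ?thesis using *(1) unfolding h_def coeff_sum coeff_tv by (simp add: coeff_eq_0 tx.hom_0)
  qed
  then have tvp: "tv p = smult (monom 1 (m * \<nu>)) h" by (intro poly_eqI) simp
  define k where "k = (\<Sum>l<m. poly (p' l) a * (if m' dvd l then z ^ (l div m') else 0)) / poly \<delta> a"
  have "at_zero v h = (\<Sum>l<m. e (poly (p' l) a * (if m' dvd l then z ^ (l div m') else 0)))"
    unfolding h_def at_zero_homs
  proof (rule sum.cong[OF refl])
    fix l
    have "at_zero v (monom (tx (p' l) * monom 1 (s * l mod m)) l) = poly (tx (p' l) * monom 1 (s * l mod m)) 0 * v ^ l"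
      by (simp add: at_zero_def map_poly_monom poly_monom)
    also have "\<dots> = e (poly (p' l) a * (if m' dvd l then z ^ (l div m') else 0))"
    proof (cases "m' dvd l")
      case True
      then obtain i where l: "l = m' * i" by blast
      have "s * l mod m = 0" using True unfolding mod_m_eq_0_iff .
      moreover have "v ^ l = e (z ^ i)" unfolding l power_mult z e.hom_power ..
      ultimately show ?thesis using True m'_pos by (simp add: l e.hom_mult poly_monom)
    next
      case False
      then have "s * l mod m \<noteq> 0" unfolding mod_m_eq_0_iff .
      then show ?thesis using False by (simp add: poly_monom power_0_left e.hom_0)
    qed
    finally show "at_zero v (monom (tx (p' l) * monom 1 (s * l mod m)) l) = e (poly (p' l) a * (if m' dvd l then z ^ (l div m') else 0))" .
  qed
  also have "\<dots> = e (k * poly \<delta> a)" using *(5) by (simp add: k_def flip: e.hom_sum)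
  finally have "e k * poly (tx \<delta>) 0 = at_zero v h" by (simp add: e.hom_mult)
  moreover have "tx d = monom 1 (m * \<nu>) * tx \<delta>" unfolding *(4) by (simp add: tx.hom_mult tx_linear_power)
  moreover have "poly (tx \<delta>) 0 \<noteq> 0" using *(5) by simp
  ultimately have "represents v b (e k)"
    unfolding represents_def using *(2,3) tvp
    by (intro exI[of _ p] exI[of _ d] exI[of _ "m * \<nu>"] exI[of _ h] exI[of _ "tx \<delta>"]) simp
  then show ?thesis ..
qed

text \<open>The choice v^\<open>m'\<close> = e z places v on the fibre v^m = u(a), and
  \<open>el m'\<close> takes the value v^\<open>m'\<close> there. Evaluation on this branch is the
  wanted homomorphism.\<close>

lemma point_hom_exists:
  assumes z: "z ^ g = poly u a"
  obtains H where "point_hom H" "H (el m') = z"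
proof -
  obtain v where v: "v ^ m' = e z" using nth_root_exists[OF m'_pos] by blast
  have "v ^ m = (v ^ m') ^ g" by (simp add: m_eq[symmetric] flip: power_mult)
  then have vm: "v ^ m = e (poly u a)" unfolding v by (simp add: z flip: e.hom_power)
  define H where "H b = (SOME k. represents v b (e k))" for b
  have HI: "H b = k" if "represents v b (e k)" for b k
  proof -
    have "represents v b (e (H b))" unfolding H_def using that by (rule someI)
    from represents_unique[OF vm this that] show ?thesis by (simp add: e.hom_eq_iff)
  qed
  have H: "represents v b (e (H b))" if "b \<in> normal_closure" for b
    unfolding H_def by (rule someI_ex[OF represents_exists[OF v that]])
  have "point_hom H" unfolding point_hom_def
  proof (intro conjI ballI allI)
    fix b b' assume "b \<in> normal_closure" "b' \<in> normal_closure"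
    note r = H[OF this(1)] H[OF this(2)]
    show "H (b + b') = H b + H b'" "H (b * b') = H b * H b'"
      using represents_add_mult[OF r] by (auto intro!: HI simp: e.homs)
  next
    fix p
    have "represents v (j p) (e (poly p a))" unfolding represents_def
      by (intro exI[of _ "[:p:]"] exI[of _ 1] exI[of _ 0] exI[of _ "[:tx p:]"]) (simp add: j.hom_1 tx.hom_1 monom_0 flip: one_pCons)
    then show "H (j p) = poly p a" by (rule HI)
  qed
  moreover have "represents v (el m') (e z)" unfolding represents_def
  proof (intro exI conjI)
    show "[:- a, 1:] ^ s' \<noteq> 0" by simp
    show "el m' = ev (monom 1 m') / j ([:- a, 1:] ^ s')" using fl_multiple[of 1] by (simp add: el_def)
    show "tx ([:- a, 1:] ^ s') = monom 1 (m * s') * 1" by (simp add: tx_linear_power)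
    show "poly (1 :: 'k poly) 0 \<noteq> 0" by simp
    have "s * m' = m * s'" using sm'[of 1] by simp
    then show "W dvd tv (monom 1 m') - smult (monom 1 (m * s')) (monom 1 m')"
      by (simp add: tv_y smult_monom)
    show "e z * poly 1 0 = at_zero v (monom 1 m')" by (simp add: v)
  qed
  then have "H (el m') = z" by (rule HI)
  ultimately show ?thesis using that by blast
qed

section \<open>Degree-1 maximal ideals as kernels of homomorphisms\<close>

sublocale N: parametrized_ring normal_closure "norm_ring m f" A.\<phi>
  by (rule parametrized_norm_ring)

definition hom_kernel :: "('o \<Rightarrow> 'a) \<Rightarrow> ('a poly poly set \<times> 'a poly poly set) set set" where
  "hom_kernel H = {A.\<phi> b | b. b \<in> normal_closure \<and> H b = 0}"

lemma mem_hom_kernel: "b \<in> normal_closure \<Longrightarrow> A.\<phi> b \<in> hom_kernel H \<longleftrightarrow> H b = 0"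
  by (auto simp: hom_kernel_def N.\<psi>_eq_iff)

lemma hom_kernel_point:
  assumes H: "point_hom H"
  shows "hom_kernel H \<in> norm_points m f a"
proof -
  have in_carrierE: thesis if "x \<in> carrier (norm_ring m f)" "\<And>b. x = A.\<phi> b \<Longrightarrow> b \<in> normal_closure \<Longrightarrow> thesis" for x thesis
    by (rule imageE[OF that(1)[unfolded N.carrier_eq]]) (rule that(2))
  note add = point_hom_add[OF H] and mult = point_hom_mult[OF H] and jj = point_hom_j[OF H]
  have jc: "j p \<in> normal_closure" for p by (rule j_normal_closure)
  have H1: "H 1 = 1" and H0: "H 0 = 0" using jj[of 1] jj[of 0] by (simp_all add: j.homs)
  have Hneg: "H (- b) = - H b" if "b \<in> normal_closure" for b
    using add[OF that N.uminus_mem[OF that]] H0 by (simp add: eq_neg_iff_add_eq_0 add.commute)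
  have Hminus: "H (b - b') = H b - H b'" if "b \<in> normal_closure" "b' \<in> normal_closure" for b b'
    using add[OF that(1) N.uminus_mem[OF that(2)]] Hneg[OF that(2)] by simp
  have id: "ideal (hom_kernel H) (norm_ring m f)"
  proof (rule idealI)
    show "ring (norm_ring m f)" by (rule N.ring_axioms)
    show "subgroup (hom_kernel H) (add_monoid (norm_ring m f))"
    proof
      show "hom_kernel H \<subseteq> carrier (add_monoid (norm_ring m f))"
        by (auto simp: hom_kernel_def N.carrier_eq)
      show "x \<otimes>\<^bsub>add_monoid (norm_ring m f)\<^esub> x' \<in> hom_kernel H" if x: "x \<in> hom_kernel H" "x' \<in> hom_kernel H" for x x'
      proof -
        obtain b where b: "x = A.\<phi> b" "b \<in> normal_closure" "H b = 0" using x(1) unfolding hom_kernel_def by blast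
        obtain b' where b': "x' = A.\<phi> b'" "b' \<in> normal_closure" "H b' = 0" using x(2) unfolding hom_kernel_def by blast
        show ?thesis using b b' by (simp add: N.add_\<psi> mem_hom_kernel N.add_mem add)
      qed
      show "\<one>\<^bsub>add_monoid (norm_ring m f)\<^esub> \<in> hom_kernel H"
        by (simp add: N.zero_\<psi> mem_hom_kernel N.zero_mem H0)
      show "inv\<^bsub>add_monoid (norm_ring m f)\<^esub> x \<in> hom_kernel H" if x: "x \<in> hom_kernel H" for x
      proof -
        obtain b where b: "x = A.\<phi> b" "b \<in> normal_closure" "H b = 0" using x unfolding hom_kernel_def by blast
        have "inv\<^bsub>add_monoid (norm_ring m f)\<^esub> x = \<ominus>\<^bsub>norm_ring m f\<^esub> x" by (simp add: a_inv_def)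
        then show ?thesis using b by (simp add: N.a_inv_\<psi> mem_hom_kernel N.uminus_mem Hneg)
      qed
    qed
    fix x r assume "x \<in> hom_kernel H" "r \<in> carrier (norm_ring m f)"
    then obtain b b' where "x = A.\<phi> b" "b \<in> normal_closure" "H b = 0" "r = A.\<phi> b'" "b' \<in> normal_closure"
      unfolding hom_kernel_def N.carrier_eq by blast
    then show "r \<otimes>\<^bsub>norm_ring m f\<^esub> x \<in> hom_kernel H" "x \<otimes>\<^bsub>norm_ring m f\<^esub> r \<in> hom_kernel H"
      by (simp_all add: N.mult_\<psi> mem_hom_kernel N.mult_mem mult)
  qed
  have split: "b - j [:H b:] \<in> normal_closure \<and> H (b - j [:H b:]) = 0" if "b \<in> normal_closure" for b
    using that by (simp add: N.diff_mem jc Hminus jj)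
  have max: "maximalideal (hom_kernel H) (norm_ring m f)"
  proof (rule maximalidealI[OF id])
    have "A.\<phi> 1 \<in> carrier (norm_ring m f)" "A.\<phi> 1 \<notin> hom_kernel H"
      by (simp_all add: N.\<psi>_closed mem_hom_kernel N.one_mem H1)
    then show "carrier (norm_ring m f) \<noteq> hom_kernel H" by blast
    fix J assume J: "ideal J (norm_ring m f)" "hom_kernel H \<subseteq> J" "J \<subseteq> carrier (norm_ring m f)"
    show "J = hom_kernel H \<or> J = carrier (norm_ring m f)"
    proof (cases "J \<subseteq> hom_kernel H")
      case False
      then obtain x where x: "x \<in> J" "x \<notin> hom_kernel H" by blast
      then have "x \<in> carrier (norm_ring m f)" using J(3) by blast
      then obtain b where b: "x = A.\<phi> b" "b \<in> normal_closure" by (rule in_carrierE)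
      have Hb: "H b \<noteq> 0" using x(2) b by (simp add: mem_hom_kernel)
      \<comment> \<open>Its value is inverse to that of b, so 1 - k b lies in the kernel and an
        ideal that also contains b contains 1.\<close>
      define k where "k = j [:inverse (H b):]"
      have kn: "k \<in> normal_closure" by (simp add: k_def jc)
      have "H (1 - k * b) = 0"
        using Hb b(2) kn by (simp add: Hminus N.mult_mem N.one_mem mult H1) (simp add: k_def jj)
      then have "A.\<phi> (1 - k * b) \<in> J"
        using J(2) b(2) kn by (auto simp: mem_hom_kernel N.diff_mem N.one_mem N.mult_mem)
      moreover have "A.\<phi> (k * b) \<in> J"
        using ideal.I_l_closed[OF J(1) x(1), of "A.\<phi> k"] b kn by (simp add: N.\<psi>_closed N.mult_\<psi>)
      ultimately have "A.\<phi> (1 - k * b) \<oplus>\<^bsub>norm_ring m f\<^esub> A.\<phi> (k * b) \<in> J"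
        using additive_subgroup.a_closed[OF ideal.axioms(1)[OF J(1)]] by blast
      then have "\<one>\<^bsub>norm_ring m f\<^esub> \<in> J"
        using b(2) kn by (simp add: N.add_\<psi> N.diff_mem N.one_mem N.mult_mem N.one_\<psi>)
      then show ?thesis using ideal.one_imp_carrier[OF J(1)] by simp
    qed (use J(2) in blast)
  qed
  have "\<exists>k. x \<ominus>\<^bsub>norm_ring m f\<^esub> norm_map m f [:k:] \<in> hom_kernel H" if x: "x \<in> carrier (norm_ring m f)" for x
  proof -
    obtain b where b: "x = A.\<phi> b" "b \<in> normal_closure" using x by (rule in_carrierE)
    show ?thesis using split[OF b(2)] b
      by (intro exI[of _ "H b"]) (simp add: norm_map_eq N.minus_\<psi> jc mem_hom_kernel)
  qed
  moreover have "{p. norm_map m f p \<in> hom_kernel H} = {p. [:- a, 1:] dvd p}"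
    by (simp add: norm_map_eq mem_hom_kernel jc jj poly_eq_0_iff_dvd)
  ultimately show ?thesis using max by (simp add: norm_points_def)
qed

text \<open>The condition on the residue field supplies a constant congruent to b modulo P, and this
  constant is H b. It is unique because a constant in P is divisible by x - a and hence
  zero.\<close>

lemma point_is_hom_kernel:
  assumes P: "P \<in> norm_points m f a"
  obtains H where "point_hom H" "P = hom_kernel H"
proof -
  have max: "maximalideal P (norm_ring m f)"
    and res: "\<And>x. x \<in> carrier (norm_ring m f) \<Longrightarrow> \<exists>k. x \<ominus>\<^bsub>norm_ring m f\<^esub> norm_map m f [:k:] \<in> P"
    and over: "\<And>p. norm_map m f p \<in> P \<longleftrightarrow> [:- a, 1:] dvd p"
    using P unfolding norm_points_def by auto
  have id: "ideal P (norm_ring m f)" using max by (rule maximalideal.axioms(1))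
  have Pc: "P \<subseteq> carrier (norm_ring m f)" using ideal.Icarr[OF id] by blast
  have jc: "j p \<in> normal_closure" for p by (rule j_normal_closure)
  have Padd: "A.\<phi> (b + b') \<in> P" if "A.\<phi> b \<in> P" "A.\<phi> b' \<in> P" "b \<in> normal_closure" "b' \<in> normal_closure" for b b'
    using additive_subgroup.a_closed[OF ideal.axioms(1)[OF id] that(1,2)] that(3,4) by (simp add: N.add_\<psi>)
  have Pmult: "A.\<phi> (b' * b) \<in> P" if "A.\<phi> b \<in> P" "b \<in> normal_closure" "b' \<in> normal_closure" for b b'
    using ideal.I_l_closed[OF id that(1), of "A.\<phi> b'"] that by (simp add: N.mult_\<psi> N.\<psi>_closed)
  have Pneg: "A.\<phi> (- b) \<in> P" if "A.\<phi> b \<in> P" "b \<in> normal_closure" for b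
    using Pmult[OF that, of "- 1"] by (simp add: N.uminus_mem N.one_mem)
  have ex: "\<exists>k. A.\<phi> (b - j [:k:]) \<in> P" if "b \<in> normal_closure" for b
    using res[OF N.\<psi>_closed[OF that]] that by (simp add: norm_map_eq N.minus_\<psi> jc)
  have uniq: "k = k'" if "A.\<phi> (b - j [:k:]) \<in> P" "A.\<phi> (b - j [:k':]) \<in> P" "b \<in> normal_closure" for b k k'
  proof -
    have "A.\<phi> ((b - j [:k:]) + (- (b - j [:k':]))) \<in> P"
      using that by (intro Padd Pneg) (auto simp: N.diff_mem jc N.uminus_mem)
    moreover have "(b - j [:k:]) + (- (b - j [:k':])) = j [:k' - k:]"
      using j.hom_diff[of "[:k':]" "[:k:]"] by simp
    ultimately have "[:- a, 1:] dvd [:k' - k:]" using over by (simp add: norm_map_eq)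
    then have "poly [:k' - k:] a = 0" using poly_eq_0_iff_dvd by blast
    then show ?thesis by simp
  qed
  define H where "H b = (SOME k. A.\<phi> (b - j [:k:]) \<in> P)" for b
  have H: "A.\<phi> (b - j [:H b:]) \<in> P" if "b \<in> normal_closure" for b
    unfolding H_def by (rule someI_ex[OF ex[OF that]])
  have HI: "H b = k" if "A.\<phi> (b - j [:k:]) \<in> P" "b \<in> normal_closure" for b k
    using uniq[OF H that(1)] that(2) by blast
  have "point_hom H" unfolding point_hom_def
  proof (intro conjI ballI allI)
    fix b b' assume b: "b \<in> normal_closure" "b' \<in> normal_closure"
    have "A.\<phi> ((b - j [:H b:]) + (b' - j [:H b':])) \<in> P"
      using b by (intro Padd H) (auto simp: N.diff_mem jc)
    moreover have "(b - j [:H b:]) + (b' - j [:H b':]) = b + b' - j [:H b + H b':]"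
      using j.hom_add[of "[:H b:]" "[:H b':]"] by (simp add: algebra_simps)
    ultimately show "H (b + b') = H b + H b'" using b by (intro HI) (auto simp: N.add_mem)
    \<comment> \<open>The usual expansion: b b' - H b H b' is a combination of b - H b and b' - H
      b', both in P.\<close>
    have "A.\<phi> (b' * (b - j [:H b:]) + j [:H b:] * (b' - j [:H b':])) \<in> P"
      using b by (intro Padd Pmult H) (auto simp: N.diff_mem N.mult_mem jc)
    moreover have "b' * (b - j [:H b:]) + j [:H b:] * (b' - j [:H b':]) = b * b' - j [:H b * H b':]"
      using j.hom_mult[of "[:H b:]" "[:H b':]"] by (simp add: algebra_simps)
    ultimately show "H (b * b') = H b * H b'" using b by (intro HI) (auto simp: N.mult_mem)
  next
    fix p
    have "[:- a, 1:] dvd p - [:poly p a:]" by (simp flip: poly_eq_0_iff_dvd)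
    then have "A.\<phi> (j (p - [:poly p a:])) \<in> P" using over by (simp add: norm_map_eq)
    then show "H (j p) = poly p a" by (intro HI jc) (simp add: j.hom_diff)
  qed
  moreover have "P = hom_kernel H"
  proof (intro equalityI subsetI)
    fix x assume x: "x \<in> P"
    have "x \<in> A.\<phi> ` normal_closure" using x Pc unfolding N.carrier_eq by (rule subsetD[rotated])
    then obtain b where b: "x = A.\<phi> b" "b \<in> normal_closure" by (rule imageE)
    have "H b = 0" using x b by (intro HI) (simp_all add: j.hom_0)
    then show "x \<in> hom_kernel H" using b by (simp add: mem_hom_kernel)
  next
    fix x assume "x \<in> hom_kernel H"
    then obtain b where b: "x = A.\<phi> b" "b \<in> normal_closure" "H b = 0" unfolding hom_kernel_def by blast
    then show "x \<in> P" using H[OF b(2)] by (simp add: j.hom_0)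
  qed
  ultimately show ?thesis using that by blast
qed

theorem card_norm_points: "card (norm_points m f a) = card {z. z ^ gcd m s = poly u a}"
proof -
  have "\<forall>z. \<exists>H. z ^ g = poly u a \<longrightarrow> point_hom H \<and> H (el m') = z"
    using point_hom_exists by metis
  then obtain Hz where Hz: "\<And>z. z ^ g = poly u a \<Longrightarrow> point_hom (Hz z)" "\<And>z. z ^ g = poly u a \<Longrightarrow> Hz z (el m') = z"
    by metis
  have "bij_betw (\<lambda>z. hom_kernel (Hz z)) {z. z ^ g = poly u a} (norm_points m f a)"
    unfolding bij_betw_def
  proof
    show "inj_on (\<lambda>z. hom_kernel (Hz z)) {z. z ^ g = poly u a}"
    proof (rule inj_onI)
      fix z z' assume z: "z \<in> {z. z ^ g = poly u a}" "z' \<in> {z. z ^ g = poly u a}" "hom_kernel (Hz z) = hom_kernel (Hz z')"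
      \<comment> \<open>Its value at the point of w is w - z, so it separates the point of z from
        all the others.\<close>
      let ?b = "el m' + j [:- z:]"
      have bn: "?b \<in> normal_closure" by (intro N.add_mem el_normal_closure j_normal_closure)
      have v: "Hz w ?b = w - z" if "w \<in> {z. z ^ g = poly u a}" for w
        using that Hz[of w] by (simp add: point_hom_add[OF _ el_normal_closure j_normal_closure] point_hom_j)
      have "A.\<phi> ?b \<in> hom_kernel (Hz z')" using mem_hom_kernel[OF bn, of "Hz z"] v[OF z(1)] z(3) by simp
      then show "z = z'" using mem_hom_kernel[OF bn, of "Hz z'"] v[OF z(2)] by simp
    qed
    show "(\<lambda>z. hom_kernel (Hz z)) ` {z. z ^ g = poly u a} = norm_points m f a"
    proof (intro equalityI subsetI)
      fix P assume "P \<in> norm_points m f a"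
      then obtain H where H: "point_hom H" "P = hom_kernel H" by (rule point_is_hom_kernel)
      let ?z = "H (el m')"
      have z: "?z ^ g = poly u a" by (rule point_hom_root[OF H(1)])
      have "Hz ?z b = H b" if "b \<in> normal_closure" for b
        using point_hom_unique[OF Hz(1)[OF z] H(1) Hz(2)[OF z] that] .
      then have "hom_kernel (Hz ?z) = P" unfolding H(2) hom_kernel_def by auto
      then show "P \<in> (\<lambda>z. hom_kernel (Hz z)) ` {z. z ^ g = poly u a}" using z by blast
    qed (auto intro: hom_kernel_point Hz(1))
  qed
  then show ?thesis unfolding g_def by (simp add: bij_betw_same_card[symmetric])
qed

end

section \<open>Densities\<close>

text \<open>The ambient field is an algebraic closure of the rational functions over the algebraic
  closure of the base, so an mth root of f is available there.\<close>

lemma curve_model_exists: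
  fixes f :: "'a::field poly"
  assumes "has_simple_root f" "m > 0"
  obtains y c where "curve_model (to_ac :: 'a \<Rightarrow> 'a alg_closure)
    (\<lambda>p. to_ac (to_fract p) :: 'a alg_closure poly fract alg_closure) f m y c"
proof -
  let ?\<iota> = "\<lambda>p. to_ac (to_fract p) :: 'a alg_closure poly fract alg_closure"
  obtain c where c: "poly (map_poly to_ac f) c = 0" "poly (pderiv (map_poly to_ac f)) c \<noteq> 0"
    using assms(1) unfolding has_simple_root_def by blast
  obtain y where y: "y ^ m = ?\<iota> (map_poly to_ac f)" using nth_root_exists[OF assms(2)] by blast
  have "curve_model (to_ac :: 'a \<Rightarrow> 'a alg_closure) ?\<iota> f m y c"
    using inj_type_ring_hom_to_ac inj_type_ring_hom_comp[OF inj_type_ring_hom_to_fract inj_type_ring_hom_to_ac]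
    by (rule curve_model.intro) (unfold_locales, use assms(2) y c in auto)
  then show ?thesis using that by blast
qed

lemma simple_root_imp_irreducible:
  fixes f :: "'a::field poly"
  assumes "has_simple_root f" "m > 0"
  shows "curve_irreducible m f" "curve_geom_irreducible m f" "norm_irreducible m f" "norm_geom_irreducible m f"
proof -
  obtain y c where "curve_model (to_ac :: 'a \<Rightarrow> 'a alg_closure)
    (\<lambda>p. to_ac (to_fract p) :: 'a alg_closure poly fract alg_closure) f m y c"
    by (rule curve_model_exists[OF assms])
  then interpret curve_model "to_ac :: 'a \<Rightarrow> 'a alg_closure" "\<lambda>p. to_ac (to_fract p) :: 'a alg_closure poly fract alg_closure" f m y c .
  interpret N: parametrized_ring normal_closure "norm_ring m f" A.\<phi> by (rule parametrized_norm_ring)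
  show "curve_irreducible m f" unfolding curve_irreducible_def by (rule A.irreducible_spectrum)
  show "norm_irreducible m f" unfolding norm_irreducible_def by (rule N.irreducible_spectrum)
  have jr: "j p \<in> range ev" for p by (metis ev_const rangeI)
  show "curve_geom_irreducible m f"
    unfolding curve_geom_irreducible_def geom_irreducible_spectrum_def coord_map_eq
    by (rule geom_irreducible[OF parametrized_coord_ring _ jr]) (auto intro: ev_function_field)
  have jn: "j p \<in> normal_closure" for p using ev_normal_closure[of "[:p:]"] by simp
  show "norm_geom_irreducible m f"
    unfolding norm_geom_irreducible_def geom_irreducible_spectrum_def norm_map_eq
    by (rule geom_irreducible[OF parametrized_norm_ring _ jn]) (auto simp: normal_closure_def)
qed

lemma card_norm_points_root_count:
  fixes f :: "'a::{field,finite} poly"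
  assumes "has_simple_root f" "m > 0" "of_nat m \<noteq> (0::'a)" "f = [:- a, 1:] ^ s * u" "poly u a \<noteq> 0"
  shows "card (norm_points m f a) = root_count (gcd m s) (poly u a)"
proof -
  obtain y c where cm: "curve_model (to_ac :: 'a \<Rightarrow> 'a alg_closure)
    (\<lambda>p. to_ac (to_fract p) :: 'a alg_closure poly fract alg_closure) f m y c"
    by (rule curve_model_exists[OF assms(1,2)])
  have "of_nat m \<noteq> (0 :: 'a alg_closure)"
    using assms(3) to_ac_eq_0_iff[of "of_nat m :: 'a"] by (simp only: to_ac_of_nat) simp
  then have "curve_point_model (to_ac :: 'a \<Rightarrow> 'a alg_closure)
    (\<lambda>p. to_ac (to_fract p) :: 'a alg_closure poly fract alg_closure) f m y c a s u"
    using assms(4,5) by (intro curve_point_model.intro[OF cm] curve_point_model_axioms.intro)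
  then show ?thesis unfolding root_count_def by (rule curve_point_model.card_norm_points)
qed

text \<open>Translation by 1 permutes the field, so it leaves the sum of all elements
  unchanged.\<close>

lemma of_nat_card_UNIV: "of_nat CARD('a) = (0::'a::{field,finite})"
proof -
  have "(\<Sum>x\<in>(UNIV::'a set). x) = (\<Sum>x\<in>UNIV. x + 1)"
    by (rule sum.reindex_bij_witness[of _ "\<lambda>x. x + 1" "\<lambda>x. x - 1"]) auto
  also have "\<dots> = (\<Sum>x\<in>UNIV. x) + of_nat CARD('a)" by (simp add: sum.distrib)
  finally show ?thesis by simp
qed

lemma of_nat_nonzero_if_coprime_card:
  assumes "gcd CARD('a) m = 1"
  shows "of_nat m \<noteq> (0::'a::{field,finite})"
proof
  assume "of_nat m = (0::'a)"
  then have "CHAR('a) dvd m" "CHAR('a) dvd CARD('a)"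
    using of_nat_card_UNIV[where 'a='a] by (simp_all add: of_nat_eq_0_iff_char_dvd)
  then have "CHAR('a) dvd 1" using assms by (metis gcd_greatest)
  moreover have "Factorial_Ring.prime CHAR('a)" by (intro prime_CHAR_semidom finite_imp_CHAR_pos) simp
  ultimately show False by (simp add: prime_gt_1_nat)
qed

lemma card_curve_points: "card (curve_points m f a) = root_count m (poly f a)"
proof -
  have "curve_points m f a = {a} \<times> {y. y ^ m = poly f a}" by (auto simp: curve_points_def)
  then show ?thesis by (simp add: root_count_def card_cartesian_product)
qed

lemma power_free_local_form:
  fixes f :: "'a::{field,finite} poly"
  assumes "power_free n f"
  obtains s u where "f = [:- a, 1:] ^ s * u" "poly u a \<noteq> 0" "s < n"
proof -
  have "f \<noteq> 0" using assms by (rule power_free_not_0)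
  from order_decomp[OF this, of a] obtain u where u: "f = [:- a, 1:] ^ order a f * u" "\<not> [:- a, 1:] dvd u" by blast
  have "order a f < n"
  proof (rule ccontr)
    assume "\<not> order a f < n"
    then have "[:- a, 1:] ^ n dvd f" using u(1) by (metis dvd_triv_left dvd_power_mono not_less)
    then show False using assms by (auto simp: power_free_def dest!: spec[of _ "[:- a, 1:]"])
  qed
  with u that show ?thesis by (auto simp: poly_eq_0_iff_dvd)
qed

section \<open>From jets to the two limiting laws\<close>

lemma card_nonzero_polys_below: "card {v \<in> polys_below n. v \<noteq> (0 :: 'a::{field,finite} poly)} = CARD('a) ^ n - 1"
proof -
  have "{v \<in> polys_below n. v \<noteq> (0 :: 'a poly)} = polys_below n - {0}" by auto
  then show ?thesis by (simp add: card_Diff_singleton card_polys_below polys_below_iff)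
qed

text \<open>The common part of both conclusions: they differ only in the point count, in the
  function c of the jet that computes it, and in the law of c on nonzero jets.\<close>

theorem density_from_jets:
  fixes x :: "nat \<Rightarrow> 'a::{field,finite}" and cnt :: "'a poly \<Rightarrow> 'a \<Rightarrow> nat" and c :: "'a poly \<Rightarrow> nat"
  assumes n: "n \<ge> 2" and x: "bij_betw x {1..CARD('a)} UNIV"
    and Q: "\<And>f. f \<noteq> 0 \<Longrightarrow> has_simple_root f \<Longrightarrow> Q f"
    and cnt: "\<And>f a. power_free n f \<Longrightarrow> has_simple_root f \<Longrightarrow> cnt f a = c (jet n a f)"
    and law: "\<And>k. real (card {v \<in> polys_below n. v \<noteq> 0 \<and> int (c v) = k}) / (real CARD('a) ^ n - 1) = law k"
  shows "(\<lambda>d. real (card {f \<in> power_free_polys n d. Q f \<and> (\<forall>i\<in>{1..CARD('a)}. int (cnt f (x i)) = k i)}) /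
      real (card {f \<in> power_free_polys n d. Q f})) \<longlonglongrightarrow> (\<Prod>i\<in>{1..CARD('a)}. law (k i))"
proof -
  define \<kappa> where "\<kappa> a = k (the_inv_into {1..CARD('a)} x a)" for a
  have \<kappa>: "\<kappa> (x i) = k i" if "i \<in> {1..CARD('a)}" for i
    using that x by (simp add: \<kappa>_def bij_betw_def the_inv_into_f_f)
  have all: "(\<forall>i\<in>{1..CARD('a)}. int (cnt f (x i)) = k i) \<longleftrightarrow> (\<forall>a. int (cnt f a) = \<kappa> a)" for f
  proof
    assume *: "\<forall>i\<in>{1..CARD('a)}. int (cnt f (x i)) = k i"
    show "\<forall>a. int (cnt f a) = \<kappa> a"
    proof
      fix a
      obtain i where "i \<in> {1..CARD('a)}" "a = x i" using bij_betw_imp_surj_on[OF x] by blast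
      then show "int (cnt f a) = \<kappa> a" using * \<kappa> by simp
    qed
  qed (simp add: \<kappa>)
  let ?S = "\<lambda>r. \<forall>a. int (c (jet n a r)) = \<kappa> a"
  have "(\<lambda>d. real (card {f \<in> power_free_polys n d. Q f \<and> (\<forall>a. int (cnt f a) = \<kappa> a)}) / real (card {f \<in> power_free_polys n d. Q f}))
    \<longlonglongrightarrow> real (card {r \<in> admissible n. ?S r}) / real (card (admissible n :: 'a poly set))"
    using n Q by (rule power_free_local_density) (simp_all add: cnt jet_mod_local_modulus)
  also have "real (card {r \<in> admissible n. ?S r}) = (\<Prod>a\<in>UNIV. real (card {v \<in> polys_below n. v \<noteq> 0 \<and> int (c v) = \<kappa> a}))"
    using card_admissible_local[of n "\<lambda>a v. int (c v) = \<kappa> a"] by simp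
  also have "real (card (admissible n :: 'a poly set)) = (\<Prod>a\<in>(UNIV :: 'a set). real CARD('a) ^ n - 1)"
  proof -
    have "card (admissible n :: 'a poly set) = (\<Prod>a\<in>(UNIV :: 'a set). CARD('a) ^ n - 1)"
      using card_admissible_local[of n "\<lambda>(a :: 'a) v. True"] by (simp add: card_nonzero_polys_below)
    then show ?thesis using card_UNIV_field_ge2[where 'a='a] by (simp add: of_nat_diff)
  qed
  also have "(\<Prod>a\<in>UNIV. real (card {v \<in> polys_below n. v \<noteq> 0 \<and> int (c v) = \<kappa> a})) / (\<Prod>a\<in>(UNIV :: 'a set). real CARD('a) ^ n - 1) = (\<Prod>a\<in>UNIV. law (\<kappa> a))"
    unfolding prod_dividef[symmetric] law ..
  also have "\<dots> = (\<Prod>i\<in>{1..CARD('a)}. law (k i))"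
    using prod.reindex_bij_betw[OF x, of "\<lambda>a. law (\<kappa> a)"] \<kappa> by simp
  finally show ?thesis unfolding all .
qed

text \<open>The left side is the proportion of jets of order s among all nonzero jets.\<close>

lemma weight_eq:
  fixes q :: real
  assumes "q > 1" "s < n"
  shows "q ^ (n - 1 - s) * (q - 1) / (q ^ n - 1) = 1 / q ^ s * (1 - 1 / q) / (1 - 1 / q ^ n)"
proof -
  define A B where "A = q ^ s" and "B = q ^ (n - 1 - s)"
  have "n = s + 1 + (n - 1 - s)" using assms(2) by simp
  then have qn: "q ^ n = A * q * B" unfolding A_def B_def by (metis power_add power_one_right)
  have pos: "A > 0" "B > 0" "q > 0" using assms by (auto simp: A_def B_def)
  have "1 / A * (1 - 1 / q) / (1 - 1 / (A * q * B)) = 1 / A * ((q - 1) / q) / ((A * q * B - 1) / (A * q * B))"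
    using pos by (simp add: diff_divide_distrib)
  also have "\<dots> = B * (q - 1) / (A * q * B - 1)" using pos by simp
  finally show ?thesis unfolding qn A_def[symmetric] B_def[symmetric] ..
qed

text \<open>The order s occurs with weight \<open>w s\<close>; given s, the leading coefficient is
  uniform on the units, and the number of its roots of exponent gcd(m, s) follows
  \<open>card_root_count\<close>, where gcd(m, s, q - 1) appears.\<close>

lemma norm_law_jets:
  fixes k :: int
  assumes m: "m > 0" and n: "n \<ge> 2"
  defines "q \<equiv> CARD('a::{field,finite})"
  shows "real (card {v :: 'a poly \<in> polys_below n. v \<noteq> 0 \<and> int (root_count (gcd m (order 0 v)) (coeff v (order 0 v))) = k}) / (real q ^ n - 1)
    = norm_law q m n k" (is "?count / _ = _")
proof -
  have q: "real q > 1" using card_UNIV_field_ge2[where 'a='a] by (simp add: q_def)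
  define G where "G s = gcd m (gcd s (q - 1))" for s
  define w where "w s = 1 / real q ^ s * (1 - 1 / real q) / (1 - 1 / real q ^ n)" for s
  define R where "R s = (if k = 0 then 1 - 1 / real (G s) else 0) + (if real_of_int k = real (G s) then 1 / real (G s) else 0)" for s
  have Gpos: "G s > 0" for s using m by (simp add: G_def)
  have "real (card {v :: 'a poly \<in> polys_below n. v \<noteq> 0 \<and> int (root_count (gcd m (order 0 v)) (coeff v (order 0 v))) = k})
      = (\<Sum>s<n. real q ^ (n - 1 - s) * real (card {u :: 'a. u \<noteq> 0 \<and> int (root_count (gcd m s) u) = k}))"
    by (subst card_jets_by_order) (simp add: q_def)
  also have "\<dots> = (\<Sum>s<n. real q ^ (n - 1 - s) * ((real q - 1) * R s))"
  proof (rule sum.cong[OF refl])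
    fix s
    have "gcd m s > 0" using m by simp
    from card_root_count[OF this, of k, where 'a='a]
    show "real q ^ (n - 1 - s) * real (card {u :: 'a. u \<noteq> 0 \<and> int (root_count (gcd m s) u) = k}) =
      real q ^ (n - 1 - s) * ((real q - 1) * R s)"
      by (simp add: R_def G_def q_def gcd.assoc)
  qed
  finally have count: "?count = \<dots>" .
  have "\<dots> / (real q ^ n - 1) = (\<Sum>s<n. w s * R s)"
    unfolding sum_divide_distrib
  proof (rule sum.cong[OF refl])
    fix s assume "s \<in> {..<n}"
    then have "w s = real q ^ (n - 1 - s) * (real q - 1) / (real q ^ n - 1)" unfolding w_def using weight_eq[OF q, of s n] by simp
    then show "real q ^ (n - 1 - s) * ((real q - 1) * R s) / (real q ^ n - 1) = w s * R s"
      by (simp only: times_divide_eq_left mult.assoc)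
  qed
  also have "\<dots> = norm_law q m n k"
  proof -
    have I: "{0..n - 1} = {..<n}" using n by auto
    consider "k = 0" | "k \<ge> 1" | "k < 0" by linarith
    then show ?thesis
    proof cases
      case 1
      have "(\<Sum>s<n. w s * R s) = (\<Sum>s<n. (1 - 1 / real (G s)) * w s)"
      proof (rule sum.cong[OF refl])
        fix s
        show "w s * R s = (1 - 1 / real (G s)) * w s"
          using Gpos[of s] unfolding R_def 1 by simp
      qed
      also have "\<dots> = norm_law q m n k" unfolding norm_law_def I G_def w_def 1 if_P[OF refl] ..
      finally show ?thesis .
    next
      case 2
      have "(\<Sum>s<n. w s * (if real_of_int k = real (G s) then 1 / real (G s) else 0)) = (\<Sum>s | s \<in> {..<n} \<and> int (G s) = k. w s / of_int k)"
        by (subst sum.inter_filter) (auto intro!: sum.cong)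
      moreover have "1 / real q ^ s * (1 - 1 / real q) / (of_int k * (1 - 1 / real q ^ n)) = w s / of_int k" for s
        unfolding w_def by (simp add: mult.commute)
      ultimately show ?thesis using 2 unfolding norm_law_def I G_def[symmetric] R_def by simp
    next
      case 3
      then have "real_of_int k \<noteq> real (G s)" for s by (metis of_nat_0_le_iff of_int_0_le_iff not_le)
      then show ?thesis using 3 by (simp add: norm_law_def R_def)
    qed
  qed
  finally show ?thesis unfolding count .
qed

text \<open>For order 0 the value f(a) is a uniform unit and the root count decides; for positive
  order f(a) = 0 and y = 0 is the only point. The total weight of positive orders is the middle
  probability.\<close>

lemma curve_law_jets:
  fixes k :: int
  assumes m: "m > 0" and n: "n \<ge> 2"
  defines "q \<equiv> CARD('a::{field,finite})"
  shows "real (card {v :: 'a poly \<in> polys_below n. v \<noteq> 0 \<and> int (root_count m (coeff v 0)) = k}) / (real q ^ n - 1) = curve_law q m n k"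
    (is "?count / _ = _")
proof -
  have q: "real q > 1" using card_UNIV_field_ge2[where 'a='a] by (simp add: q_def)
  have cU: "card (UNIV - {0 :: 'a}) = q - 1" by (simp add: card_Diff_singleton q_def)
  define G where "G = gcd m (q - 1)"
  define w where "w s = 1 / real q ^ s * (1 - 1 / real q) / (1 - 1 / real q ^ n)" for s
  \<comment> \<open>Rephrases a condition on the constant coefficient in terms of the order, so that
    \<open>card_jets_by_order\<close> applies; a positive order always means one point.\<close>
  define P where "P s u \<longleftrightarrow> int (if s = 0 then root_count m u else 1) = k" for s :: nat and u :: 'a
  define R where "R s = (if s = 0 then (if k = 0 then 1 - 1 / real G else 0) + (if real_of_int k = real G then 1 / real G else 0) else if k = 1 then 1 else 0)" for s :: nat
  have Gpos: "G > 0" using m by (simp add: G_def)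
  have rc0: "root_count m (0::'a) = 1"
  proof -
    have "{z::'a. z ^ m = 0} = {0}" using m by auto
    then show ?thesis by (simp add: root_count_def)
  qed
  have "int (root_count m (coeff v 0)) = k \<longleftrightarrow> P (order 0 v) (coeff v (order 0 v))" if "v \<noteq> 0" for v :: "'a poly"
  proof (cases "order 0 v = 0")
    case False
    then have "coeff v 0 = 0" using that by (simp add: order_eq_0_iff poly_0_coeff_0)
    with False show ?thesis by (simp add: P_def rc0)
  qed (simp add: P_def)
  then have "{v :: 'a poly \<in> polys_below n. v \<noteq> 0 \<and> int (root_count m (coeff v 0)) = k} =
     {v \<in> polys_below n. v \<noteq> 0 \<and> P (order 0 v) (coeff v (order 0 v))}" by blast
  then have "real (card {v :: 'a poly \<in> polys_below n. v \<noteq> 0 \<and> int (root_count m (coeff v 0)) = k})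
      = (\<Sum>s<n. real q ^ (n - 1 - s) * real (card {u :: 'a. u \<noteq> 0 \<and> P s u}))"
    by (simp add: card_jets_by_order q_def)
  also have "\<dots> = (\<Sum>s<n. real q ^ (n - 1 - s) * ((real q - 1) * R s))"
  proof (rule sum.cong[OF refl])
    fix s
    have "real (card {u :: 'a. u \<noteq> 0 \<and> P s u}) = (real q - 1) * R s"
    proof (cases "s = 0")
      case True
      then show ?thesis using card_root_count[OF m, of k, where 'a='a] by (simp add: P_def R_def G_def q_def)
    next
      case False
      have "{u :: 'a. u \<noteq> 0 \<and> P s u} = (if k = 1 then UNIV - {0} else {})" using False by (auto simp: P_def)
      then show ?thesis using False cU q by (simp add: R_def of_nat_diff)
    qed
    then show "real q ^ (n - 1 - s) * real (card {u :: 'a. u \<noteq> 0 \<and> P s u}) = real q ^ (n - 1 - s) * ((real q - 1) * R s)" by simp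
  qed
  finally have count: "?count = \<dots>" .
  have "\<dots> / (real q ^ n - 1) = (\<Sum>s<n. w s * R s)"
    unfolding sum_divide_distrib
  proof (rule sum.cong[OF refl])
    fix s assume "s \<in> {..<n}"
    then have "w s = real q ^ (n - 1 - s) * (real q - 1) / (real q ^ n - 1)" unfolding w_def using weight_eq[OF q, of s n] by simp
    then show "real q ^ (n - 1 - s) * ((real q - 1) * R s) / (real q ^ n - 1) = w s * R s"
      by (simp only: times_divide_eq_left mult.assoc)
  qed
  also have "\<dots> = w 0 * ((if k = 0 then 1 - 1 / real G else 0) + (if real_of_int k = real G then 1 / real G else 0)) + (if k = 1 then (\<Sum>s\<in>{0<..<n}. w s) else 0)"
  proof -
    have "{..<n} = insert 0 {0<..<n}" using n by auto
    then show ?thesis by (simp add: R_def sum.If_cases)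
  qed
  finally have weighted: "?count / (real q ^ n - 1) = w 0 * ((if k = 0 then 1 - 1 / real G else 0) + (if real_of_int k = real G then 1 / real G else 0)) + (if k = 1 then (\<Sum>s\<in>{0<..<n}. w s) else 0)"
    unfolding count .
  \<comment> \<open>Telescoping, since q^(-s) (1 - 1/q) = q^(-s) - q^(-s-1).\<close>
  have tail: "(\<Sum>s\<in>{0<..<n}. w s) = (1 / real q - 1 / real q ^ n) / (1 - 1 / real q ^ n)"
  proof -
    have "(\<Sum>s\<in>{0<..<r}. 1 / real q ^ s * (1 - 1 / real q)) = 1 / real q - 1 / real q ^ r" if "r \<ge> 1" for r
      using that
    proof (induction r rule: dec_induct)
      case base
      have "{0<..<1::nat} = {}" by auto
      then show ?case by simp
    next
      case (step r)
      have "{0<..<Suc r} = insert r {0<..<r}" using step by auto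
      then have "(\<Sum>s\<in>{0<..<Suc r}. 1 / real q ^ s * (1 - 1 / real q)) = 1 / real q ^ r * (1 - 1 / real q) + (1 / real q - 1 / real q ^ r)"
        using step by simp
      then show ?case by (simp add: right_diff_distrib)
    qed
    from this[of n] show ?thesis using n unfolding w_def by (simp only: sum_divide_distrib[symmetric])
  qed
  have "real_of_int k = real G \<longleftrightarrow> k = int G" by (metis of_int_eq_iff of_int_of_nat_eq)
  then show ?thesis
    using Gpos unfolding weighted tail curve_law_def G_def[symmetric] w_def[of 0]
    by (cases "k = 0"; cases "k = 1"; cases "k = int G") (simp_all add: mult.commute)
qed

theorem theorem3p1:
  fixes x :: "nat \<Rightarrow> 'a :: {field, finite}"
    and q m n :: nat
    and k :: "nat \<Rightarrow> int"
    and M :: "'w measure" and U :: "nat \<Rightarrow> 'w \<Rightarrow> int"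
    and N :: "'v measure" and V :: "nat \<Rightarrow> 'v \<Rightarrow> int"
  assumes "q = CARD('a)"
    and "bij_betw x {1..q} UNIV"
    and "m > 0" and "gcd q m = 1" and "n \<ge> 2"
    and "iid_with_law M {1..q} U (curve_law q m n)"
    and "iid_with_law N {1..q} V (norm_law q m n)"
  shows
    "(\<forall>Q \<in> {\<lambda>f :: 'a poly. True, curve_irreducible m, curve_geom_irreducible m}.
       (\<lambda>d. real (card {f \<in> power_free_polys n d.
                Q f \<and> (\<forall>i\<in>{1..q}. int (card (curve_points m f (x i))) = k i)}) /
            real (card {f \<in> power_free_polys n d. Q f}))
       \<longlonglongrightarrow> measure M {w \<in> space M. \<forall>i\<in>{1..q}. U i w = k i}) \<and>
     (\<forall>Q \<in> {\<lambda>f :: 'a poly. True, norm_irreducible m, norm_geom_irreducible m}.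
       (\<lambda>d. real (card {f \<in> power_free_polys n d.
                Q f \<and> (\<forall>i\<in>{1..q}. int (card (norm_points m f (x i))) = k i)}) /
            real (card {f \<in> power_free_polys n d. Q f}))
       \<longlonglongrightarrow> measure N {w \<in> space N. \<forall>i\<in>{1..q}. V i w = k i})"
proof -
  note q = assms(1) and m = assms(3) and n = assms(5)
  have ne: "{1..q} \<noteq> {}" using card_UNIV_field_ge2[where 'a='a] by (simp add: q)
  have x: "bij_betw x {1..CARD('a)} UNIV" using assms(2) by (simp add: q)
  have mu: "of_nat m \<noteq> (0::'a)" using assms(4) by (intro of_nat_nonzero_if_coprime_card) (simp add: q)
  have irr: "Q f" if "Q \<in> {\<lambda>f :: 'a poly. True, curve_irreducible m, curve_geom_irreducible m} \<union>
      {\<lambda>f :: 'a poly. True, norm_irreducible m, norm_geom_irreducible m}" "has_simple_root f" for Q f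
    using that simple_root_imp_irreducible[OF that(2) m] by auto
  \<comment> \<open>This holds for every f, since the points of the curve itself need no model; n >
    0 keeps the constant coefficient f(a) in the jet.\<close>
  have curve: "card (curve_points m f a) = root_count m (coeff (jet n a f) 0)" for f :: "'a poly" and a
  proof -
    have "coeff (jet n a f) 0 = coeff (f \<circ>\<^sub>p [:a, 1:]) 0" using n by (simp add: jet_def coeff_poly_cutoff)
    also have "\<dots> = poly f a" by (simp add: poly_0_coeff_0[symmetric] poly_pcompose)
    finally have "coeff (jet n a f) 0 = poly f a" .
    then show ?thesis by (simp add: card_curve_points)
  qed
  \<comment> \<open>Being power-free keeps the order at a below n, so the jet still shows the order
    s and the value u(a).\<close>
  have norm: "card (norm_points m f a) = root_count (gcd m (order 0 (jet n a f))) (coeff (jet n a f) (order 0 (jet n a f)))"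
    if pf: "power_free n f" and sr: "has_simple_root f" for f :: "'a poly" and a
  proof -
    obtain s u where su: "f = [:- a, 1:] ^ s * u" "poly u a \<noteq> 0" "s < n"
      using pf by (rule power_free_local_form)
    show ?thesis
      using card_norm_points_root_count[OF sr m mu su(1,2)] jet_order[OF su] by simp
  qed
  show ?thesis
    unfolding iid_with_law_prob[OF assms(6) finite_atLeastAtMost ne] iid_with_law_prob[OF assms(7) finite_atLeastAtMost ne]
  proof (intro conjI ballI)
    fix Q assume "Q \<in> {\<lambda>f :: 'a poly. True, curve_irreducible m, curve_geom_irreducible m}"
    then show "(\<lambda>d. real (card {f \<in> power_free_polys n d. Q f \<and> (\<forall>i\<in>{1..q}. int (card (curve_points m f (x i))) = k i)}) /
        real (card {f \<in> power_free_polys n d. Q f})) \<longlonglongrightarrow> (\<Prod>i\<in>{1..q}. curve_law q m n (k i))"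
      unfolding q using irr curve curve_law_jets[OF m n, where 'a='a]
      by (intro density_from_jets[OF n x, where c = "\<lambda>v. root_count m (coeff v 0)"]) auto
  next
    fix Q assume "Q \<in> {\<lambda>f :: 'a poly. True, norm_irreducible m, norm_geom_irreducible m}"
    then show "(\<lambda>d. real (card {f \<in> power_free_polys n d. Q f \<and> (\<forall>i\<in>{1..q}. int (card (norm_points m f (x i))) = k i)}) /
        real (card {f \<in> power_free_polys n d. Q f})) \<longlonglongrightarrow> (\<Prod>i\<in>{1..q}. norm_law q m n (k i))"
      unfolding q using irr norm norm_law_jets[OF m n, where 'a='a]
      by (intro density_from_jets[OF n x, where c = "\<lambda>v. root_count (gcd m (order 0 v)) (coeff v (order 0 v))"]) auto
  qed
qed

end
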